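(* Let $X: M^m \to \mathbb{R}^{m+n}_n$ be a spacelike entire self-shrinking graph. Assume that the origin $o$ of $\mathbb{R}^{m+n}_n$ belongs to $M^m$ and that $M^m$ is not a linear subspace of $\mathbb{R}^{m+n}_n$. Then the $w$-function of $M^m$ satisfies $$\limsup_{R\to \infty} \frac{(\log R)^2}{\int_{D_R} w^2 (\log w)^2 e^{-\frac{z}{4}}} < \infty.$$
   Context: $\mathbb{R}^{m+n}_n$ is the linear space $\mathbb{R}^{m+n}$ with the indefinite inner product $\langle a,b\rangle=\sum_{i=1}^m a_ib_i-\sum_{\alpha=m+1}^{m+n}a_\alpha b_\alpha$. An $m$-dimensional submanifold $M^m$ (smooth, with position vector $X$) is spacelike if the induced metric is Riemannian. It is an entire graph if $M^m=\{(x,u(x)) : x\in\mathbb{R}^m\}$ for a smooth map $u=(u^1,\dots,u^n):\mathbb{R}^m\to\mathbb{R}^n$. The second fundamental form is $B_{UW}=(\overline{\nabla}_UW)^N$, where $\overline\nabla$ is the flat connection and $(\cdot)^N$ is the orthogonal projection onto the normal bundle, and $H=\sum_{i=1}^m B_{e_ie_i}$ for a local orthonormal frame $\{e_i\}$ of $TM^m$ is the mean curvature vector. $M^m$ is a self-shrinker (self-shrinking) if $H=-\frac12X^N$. The function $z$ is $z=\langle X,X\rangle$, and $D_R=M^m\cap\{p\in\mathbb{R}^{m+n}_n: z(p)\le R^2\}$. Integrals over subsets of $M^m$ are with respect to the Riemannian volume of the induced metric. The $w$-function: fix a spacelike $m$-plane $P_2$ through the origin in $\mathbb{R}^{m+n}_n$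 (an $m$-dimensional linear subspace on which $\langle\cdot,\cdot\rangle$ is positive definite) with an oriented orthonormal basis $a_1,\dots,a_m$. For a local oriented orthonormal frame $e_1,\dots,e_m$ of $TM^m$, set $w=\langle e_1\wedge\dots\wedge e_m,a_1\wedge\dots\wedge a_m\rangle=\det(\langle e_i,a_j\rangle)_{1\le i,j\le m}$, multiplied by $-1$ if necessary so that $w\ge1$ on $M^m$ (equivalently, $w=|\det(\langle e_i,a_j\rangle)|$). When $P_2=\mathbb{R}^m\times\{0\}$ one has $w=1/\sqrt{\det(g_{ij})}$ with $g_{ij}=\delta_{ij}-\sum_{\alpha}u^\alpha_iu^\alpha_j$, where $u^\alpha_i=\partial u^\alpha/\partial x_i$. *)

theory Defs
  imports "HOL-Analysis.Analysis"
begin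

(* R^{m+n}_n, with the positive definite factor first. *)
type_synonym ('m, 'n) pseudo_euclidean = "(real ^ 'm) \<times> (real ^ 'n)"

definition pinner :: "('m::finite, 'n::finite) pseudo_euclidean \<Rightarrow> ('m, 'n) pseudo_euclidean \<Rightarrow> real"
  where "pinner a b = (\<Sum>i\<in>UNIV. fst a $ i * fst b $ i) - (\<Sum>\<alpha>\<in>UNIV. snd a $ \<alpha> * snd b $ \<alpha>)"

definition positive_definite_on :: "('m::finite, 'n::finite) pseudo_euclidean set \<Rightarrow> bool"
  where "positive_definite_on P \<longleftrightarrow> (\<forall>v\<in>P. v \<noteq> 0 \<longrightarrow> 0 < pinner v v)"

definition orthonormal_basis_of ::
    "('m::finite, 'n::finite) pseudo_euclidean set \<Rightarrow> ('m \<Rightarrow> ('m, 'n) pseudo_euclidean) \<Rightarrow> bool"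
  where "orthonormal_basis_of P e \<longleftrightarrow>
    span (range e) = P \<and> (\<forall>i j. pinner (e i) (e j) = (if i = j then 1 else 0))"

definition spacelike_plane :: "('m::finite, 'n::finite) pseudo_euclidean set \<Rightarrow> bool"
  where "spacelike_plane P \<longleftrightarrow> subspace P \<and> dim P = CARD('m) \<and> positive_definite_on P"

(* C^k and smoothness, meant for open sets S. *)
primrec Ck_on ::
    "nat \<Rightarrow> 'a::euclidean_space set \<Rightarrow> ('a \<Rightarrow> 'b::real_normed_vector) \<Rightarrow> bool"
  where
    "Ck_on 0 S f \<longleftrightarrow> continuous_on S f"
  | "Ck_on (Suc k) S f \<longleftrightarrow>
       (\<forall>x\<in>S. f differentiable (at x)) \<and>
       (\<forall>v. Ck_on k S (\<lambda>x. frechet_derivative f (at x) v))"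

definition smooth_on :: "'a::euclidean_space set \<Rightarrow> ('a \<Rightarrow> 'b::real_normed_vector) \<Rightarrow> bool"
  where "smooth_on S f \<longleftrightarrow> (\<forall>k. Ck_on k S f)"

(* The graph M of u has the global parametrization x |-> (x, u x). Geometric objects at a
   point of M, and vector fields along M, are indexed by the parameter x. *)
definition graph_position :: "(real ^ 'm \<Rightarrow> real ^ 'n) \<Rightarrow> real ^ 'm \<Rightarrow> ('m::finite, 'n::finite) pseudo_euclidean"
  where "graph_position u x = (x, u x)"

definition entire_graph :: "(real ^ 'm \<Rightarrow> real ^ 'n) \<Rightarrow> ('m::finite, 'n::finite) pseudo_euclidean set"
  where "entire_graph u = range (graph_position u)"

definition tangent_space ::
    "(real ^ 'm \<Rightarrow> real ^ 'n) \<Rightarrow> real ^ 'm \<Rightarrow> ('m::finite, 'n::finite) pseudo_euclidean set"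
  where "tangent_space u x = range (frechet_derivative (graph_position u) (at x))"

definition spacelike_graph :: "(real ^ 'm::finite \<Rightarrow> real ^ 'n::finite) \<Rightarrow> bool"
  where "spacelike_graph u \<longleftrightarrow> (\<forall>x. positive_definite_on (tangent_space u x))"

(* Orthogonal projection to the normal space; well defined when the tangent space is spacelike. *)
definition normal_part ::
    "(real ^ 'm \<Rightarrow> real ^ 'n) \<Rightarrow> real ^ 'm \<Rightarrow> ('m, 'n) pseudo_euclidean \<Rightarrow> ('m::finite, 'n::finite) pseudo_euclidean"
  where "normal_part u x p =
    (THE v. (\<forall>t\<in>tangent_space u x. pinner v t = 0) \<and> p - v \<in> tangent_space u x)"

(* B_{UW} for tangent vector fields U, W along the graph. The tangent vector U x is the image of
   the coordinate vector fst (U x) under the differential of the parametrization, so the flat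
   derivative of W along U is the derivative of W in the coordinate direction fst (U x). *)
definition second_fundamental_form ::
    "(real ^ 'm \<Rightarrow> real ^ 'n) \<Rightarrow> (real ^ 'm \<Rightarrow> ('m, 'n) pseudo_euclidean)
      \<Rightarrow> (real ^ 'm \<Rightarrow> ('m, 'n) pseudo_euclidean) \<Rightarrow> real ^ 'm \<Rightarrow> ('m::finite, 'n::finite) pseudo_euclidean"
  where "second_fundamental_form u U W x =
    normal_part u x (frechet_derivative W (at x) (fst (U x)))"

definition local_orthonormal_frame ::
    "(real ^ 'm \<Rightarrow> real ^ 'n) \<Rightarrow> (real ^ 'm) set
      \<Rightarrow> ('m \<Rightarrow> real ^ 'm \<Rightarrow> ('m::finite, 'n::finite) pseudo_euclidean) \<Rightarrow> bool"
  where "local_orthonormal_frame u S e \<longleftrightarrow>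
    open S \<and> (\<forall>i. smooth_on S (e i)) \<and>
    (\<forall>y\<in>S. orthonormal_basis_of (tangent_space u y) (\<lambda>i. e i y))"

(* H does not depend on the frame, so it is specified relationally, as in has_derivative. *)
definition has_mean_curvature ::
    "(real ^ 'm \<Rightarrow> real ^ 'n) \<Rightarrow> ('m::finite, 'n::finite) pseudo_euclidean \<Rightarrow> real ^ 'm \<Rightarrow> bool"
  where "has_mean_curvature u H x \<longleftrightarrow>
    (\<exists>S e. x \<in> S \<and> local_orthonormal_frame u S e \<and>
      H = (\<Sum>i\<in>UNIV. second_fundamental_form u (e i) (e i) x))"

definition self_shrinker :: "(real ^ 'm::finite \<Rightarrow> real ^ 'n::finite) \<Rightarrow> bool"
  where "self_shrinker u \<longleftrightarrow>
    (\<forall>x. has_mean_curvature u (- (1 / 2) *\<^sub>R normal_part u x (graph_position u x)) x)"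

definition z_fun :: "('m::finite, 'n::finite) pseudo_euclidean \<Rightarrow> real"
  where "z_fun p = pinner p p"

definition D_set ::
    "(real ^ 'm \<Rightarrow> real ^ 'n) \<Rightarrow> real \<Rightarrow> ('m::finite, 'n::finite) pseudo_euclidean set"
  where "D_set u R = entire_graph u \<inter> {p. z_fun p \<le> R\<^sup>2}"

(* The absolute value makes this independent of the orthonormal basis chosen in the tangent space
   (and of all orientations). *)
definition w_fun ::
    "(real ^ 'm \<Rightarrow> real ^ 'n) \<Rightarrow> ('m \<Rightarrow> ('m, 'n) pseudo_euclidean)
      \<Rightarrow> ('m::finite, 'n::finite) pseudo_euclidean \<Rightarrow> real"
  where "w_fun u a p =
    (let e = (SOME e. orthonormal_basis_of (tangent_space u (fst p)) e)
     in \<bar>det (\<chi> i j. pinner (e i) (a j))\<bar>)"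

definition metric_matrix :: "(real ^ 'm::finite \<Rightarrow> real ^ 'n::finite) \<Rightarrow> real ^ 'm \<Rightarrow> real ^ 'm ^ 'm"
  where "metric_matrix u x =
    (\<chi> i j. pinner (frechet_derivative (graph_position u) (at x) (axis i 1))
                   (frechet_derivative (graph_position u) (at x) (axis j 1)))"

(* sqrt (det g) dx, pushed forward to a measure on the ambient space carried by the graph. *)
definition riemannian_volume ::
    "(real ^ 'm \<Rightarrow> real ^ 'n) \<Rightarrow> ('m::finite, 'n::finite) pseudo_euclidean measure"
  where "riemannian_volume u =
    distr (density lborel (\<lambda>x. ennreal (sqrt (det (metric_matrix u x))))) borel (graph_position u)"

end

theory Submission
  imports Defs
begin

text \<open>
  Parametrize the graph by \<open>x\<close>, with induced metric \<open>g\<close>, inverse metric \<open>G\<close> and weight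
  \<open>\<rho> = sqrt (det g) exp (- z / 4)\<close>. The self-shrinker equation says \<open>G\<^sub>k\<^sub>l X\<^sub>k\<^sub>l = (x \<bullet> DX - X) / 2\<close>, so the
  operator \<open>L = G\<^sub>k\<^sub>l \<partial>\<^sub>k \<partial>\<^sub>l - x \<bullet> D / 2\<close> is symmetric for \<open>\<rho> dx\<close>. A computation in an orthonormal frame
  and the Cauchy-Schwarz inequality in the negative definite normal space give \<open>L (ln w) \<ge> 0\<close>, with
  equality at a point only if the second fundamental form vanishes there. Testing this inequality
  with \<open>\<psi> ln w\<close>, where \<open>\<psi> = (max 0 (1 - |x|^2 / R^2))^2\<close>, bounds the weighted Dirichlet integral of \<open>ln w\<close> by
  \<open>C / R^2\<close> times the integral of \<open>w^2 (ln w)^2\<close>: the extra \<open>w^2\<close> arises because \<open>G \<le> C w^2\<close> in the Euclidean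
  sense. Since \<open>z \<le> |x|^2\<close>, the part of the graph over the Euclidean ball of radius \<open>R\<close> lies in \<open>D_R\<close>. Hence the
  integral grows at least like \<open>R^2\<close>, unless \<open>ln w\<close> is constant; in that case \<open>u\<close> is linear.
\<close>


section \<open>Partial derivatives\<close>

text \<open>The delicate point is the comparison of the inverse metric with \<open>w^2\<close>.
  Cramer's rule costs one factor \<open>1 / det g\<close>, because the entries of \<open>g\<close>
  are bounded. For a general plane \<open>P2\<close> one has
  \<open>w = |det A| / sqrt (det g)\<close>, where \<open>A\<close> pairs the coordinate tangent
  vectors with the basis \<open>a\<close>, so \<open>|det A|\<close> must be bounded below uniformly
  over the graph. This holds because the differential of \<open>u\<close> is a contraction, which
  makes \<open>A\<close> expand by at least a factor \<open>\<kappa>\<close> that depends on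
  \<open>a\<close> alone. The sign of \<open>L (ln w)\<close> has a similar source. Seen as a graph
  over a tangent space, the plane has slope less than 1. Hence the trace term in
  \<open>L (ln w)\<close>, which has no sign, is dominated by the square of the second fundamental
  form, and strictness of the slope bound yields the equality case. The third derivatives of
  \<open>u\<close> in \<open>L (ln w)\<close> are removed by differentiating the self-shrinker
  equation. Cutting off on Euclidean balls keeps every test function compactly supported; the
  integral over \<open>D_R\<close> only has to be bounded from below.\<close>

definition has_pd :: "('a::real_normed_vector \<Rightarrow> 'b::real_normed_vector) \<Rightarrow> 'b \<Rightarrow> 'a \<Rightarrow> 'a \<Rightarrow> bool"
  where "has_pd f d x v \<longleftrightarrow> ((\<lambda>t. f (x + t *\<^sub>R v)) has_vector_derivative d) (at 0)"

lemma has_pd_real: "has_pd f d x v \<longleftrightarrow> ((\<lambda>t. f (x + t *\<^sub>R v)) has_real_derivative d) (at 0)"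
  by (simp add: has_pd_def has_real_derivative_iff_has_vector_derivative)

lemma has_pd_unique: "has_pd f d x v \<Longrightarrow> has_pd f e x v \<Longrightarrow> d = e"
  unfolding has_pd_def by (rule vector_derivative_unique_at)

lemma has_pd_const: "has_pd (\<lambda>x. c) 0 x v"
  by (simp add: has_pd_def)

lemma has_pd_diff: "has_pd f d x v \<Longrightarrow> has_pd g e x v \<Longrightarrow> has_pd (\<lambda>y. f y - g y) (d - e) x v"
  unfolding has_pd_def by (rule has_vector_derivative_diff)

lemma has_pd_sum: "(\<And>i. i \<in> I \<Longrightarrow> has_pd (f i) (d i) x v) \<Longrightarrow> has_pd (\<lambda>y. \<Sum>i\<in>I. f i y) (\<Sum>i\<in>I. d i) x v"
  unfolding has_pd_def by (rule has_vector_derivative_sum)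

lemma has_pd_bilinear:
  assumes "bounded_bilinear b" "has_pd f d x v" "has_pd g e x v"
  shows "has_pd (\<lambda>y. b (f y) (g y)) (b (f x) e + b d (g x)) x v"
  using bounded_bilinear.has_vector_derivative[OF assms(1)] assms(2,3) 
  unfolding has_pd_def by fastforce

lemmas has_pd_mult = has_pd_bilinear[OF bounded_bilinear_mult]
  and has_pd_scaleR = has_pd_bilinear[OF bounded_bilinear_scaleR]

lemma has_pd_compose:
  assumes "has_pd f d x v" "(g has_real_derivative e) (at (f x))"
  shows "has_pd (\<lambda>y. g (f y)) (e * d) x v"
  using assms DERIV_chain2[of g e "\<lambda>t. f (x + t *\<^sub>R v)" 0 d] unfolding has_pd_real by simp

lemma has_pd_has_derivative: "(f has_derivative f') (at x) \<Longrightarrow> has_pd f (f' v) x v"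
proof -
  assume f: "(f has_derivative f') (at x)"
  have 1: "((\<lambda>t::real. x + t *\<^sub>R v) has_derivative (\<lambda>t. t *\<^sub>R v)) (at 0)"
    by (auto intro!: derivative_eq_intros)
  have 2: "((\<lambda>t. f (x + t *\<^sub>R v)) has_derivative (\<lambda>t. f' (t *\<^sub>R v))) (at 0)"
    using has_derivative_compose[OF 1, of f f'] f by simp
  interpret bounded_linear f' using f by (rule has_derivative_bounded_linear)
  show ?thesis unfolding has_pd_def has_vector_derivative_def
    using 2 by (simp add: scale)
qed

lemma has_pd_Pair: "has_pd f d x v \<Longrightarrow> has_pd g e x v \<Longrightarrow> has_pd (\<lambda>y. (f y, g y)) (d, e) x v"
  unfolding has_pd_def by (rule has_vector_derivative_Pair)

lemma has_pd_id: "has_pd (\<lambda>y. y) v x v"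
  unfolding has_pd_def by (auto intro!: derivative_eq_intros)

lemma has_pd_power2: "has_pd f d x v \<Longrightarrow> has_pd (\<lambda>y. (f y :: real)\<^sup>2) (2 * f x * d) x v"
  by (drule has_pd_compose[where g="\<lambda>t. t\<^sup>2" and e="2 * f x"]) (auto intro!: derivative_eq_intros)

lemma has_pd_linear: "bounded_linear h \<Longrightarrow> has_pd f d x v \<Longrightarrow> has_pd (\<lambda>y. h (f y)) (h d) x v"
  unfolding has_pd_def by (rule bounded_linear.has_vector_derivative)

text \<open>Recentring a directional derivative along its own line, which is what the one-variable
  mean value theorem requires.\<close>

lemma has_pd_along_line:
  assumes "has_pd f d (x + s *\<^sub>R v) v"
  shows "((\<lambda>t. f (x + t *\<^sub>R v)) has_vector_derivative d) (at s)"
proof -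
  have "((\<lambda>t. f (x + s *\<^sub>R v + (t - s) *\<^sub>R v)) has_vector_derivative 1 *\<^sub>R d) (at s)"
    using assms unfolding has_pd_def 
    by (intro vector_diff_chain_at[of "\<lambda>t. t - s" 1 s "\<lambda>t. f (x + s *\<^sub>R v + t *\<^sub>R v)", unfolded o_def])
      (auto intro!: derivative_eq_intros)
  moreover have "x + s *\<^sub>R v + (t - s) *\<^sub>R v = x + t *\<^sub>R v" for t
    by (simp add: scaleR_left_diff_distrib)
  ultimately show ?thesis by simp
qed

lemma has_pd_transform:
  assumes "has_pd f d x v" "open S" "x \<in> S" "\<And>y. y \<in> S \<Longrightarrow> f y = g y"
  shows "has_pd g d x v"
proof -
  have "open ((\<lambda>t. x + t *\<^sub>R v) -` S)"
    using assms(2) by (intro open_vimage continuous_intros)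
  then show ?thesis
    using assms unfolding has_pd_def
    by - (rule has_vector_derivative_transform_within_open[of "\<lambda>t. f (x + t *\<^sub>R v)" d 0], auto)
qed

lemma has_pd_mvt:
  fixes f :: "'a::real_normed_vector \<Rightarrow> real"
  assumes "\<And>y. has_pd f (f' y) y v" "0 < s"
  shows "\<exists>\<xi>. 0 < \<xi> \<and> \<xi> < s \<and> f (x + s *\<^sub>R v) - f x = s * f' (x + \<xi> *\<^sub>R v)"
proof -
  have "((\<lambda>t. f (x + t *\<^sub>R v)) has_real_derivative f' (x + t *\<^sub>R v)) (at t)" for t
    using has_pd_along_line[OF assms(1)] by (simp add: has_real_derivative_iff_has_vector_derivative)
  from MVT2[OF assms(2) this] show ?thesis by auto
qed

text \<open>The second difference of \<open>h\<close> over a small parallelogram is evaluated twice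
  by the mean value theorem, once in each order. This gives equal values of \<open>hvw\<close> and
  \<open>hwv\<close> at two nearby points, and continuity does the rest.\<close>

lemma has_pd_commute_real:
  fixes h :: "'a::real_normed_vector \<Rightarrow> real"
  assumes v: "\<And>x. has_pd h (hv x) x v" and w: "\<And>x. has_pd h (hw x) x w"
    and vw: "\<And>x. has_pd hv (hvw x) x w" and wv: "\<And>x. has_pd hw (hwv x) x v"
    and cont: "continuous_on UNIV hvw" "continuous_on UNIV hwv"
  shows "hvw x = hwv x"
proof (rule ccontr)
  assume ne: "hvw x \<noteq> hwv x"
  define \<epsilon> where "\<epsilon> = \<bar>hvw x - hwv x\<bar> / 2"
  have "\<epsilon> > 0" using ne by (simp add: \<epsilon>_def)
  obtain d1 where d1: "d1 > 0" "\<And>y. dist y x < d1 \<Longrightarrow> dist (hvw y) (hvw x) < \<epsilon>"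
    using cont(1) \<open>\<epsilon> > 0\<close> unfolding continuous_on_iff by (metis UNIV_I)
  obtain d2 where d2: "d2 > 0" "\<And>y. dist y x < d2 \<Longrightarrow> dist (hwv y) (hwv x) < \<epsilon>"
    using cont(2) \<open>\<epsilon> > 0\<close> unfolding continuous_on_iff by (metis UNIV_I)
  \<comment> \<open>The parallelogram with sides \<open>s v\<close> and \<open>s w\<close> has to
    lie in both balls; the summand 1 keeps the denominator positive.\<close>
  define s where "s = min d1 d2 / (norm v + norm w + 1)"
  have nn: "norm v + norm w + 1 > 0" by (simp add: add_nonneg_pos)
  then have s: "s > 0" using d1(1) d2(1) by (simp add: s_def)
  have near: "dist (x + a *\<^sub>R v + b *\<^sub>R w) x < min d1 d2" if "0 < a" "a < s" "0 < b" "b < s" for a b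
  proof -
    have "norm (a *\<^sub>R v + b *\<^sub>R w) \<le> a * norm v + b * norm w"
      using that by (intro norm_triangle_le) simp
    also have "\<dots> \<le> s * norm v + s * norm w"
      using that by (intro add_mono mult_right_mono) auto
    also have "\<dots> < s * (norm v + norm w + 1)" using s by (simp add: algebra_simps)
    also have "\<dots> = min d1 d2" using nn by (simp add: s_def)
    finally show ?thesis by (simp add: dist_norm add.assoc)
  qed
  have sh: "has_pd (\<lambda>y. g (y + c)) (g' (y + c)) y z" if "\<And>y. has_pd g (g' y) y z" 
    for g g' :: "'a \<Rightarrow> real" and c y z
    using that[of "y + c"] by (simp add: has_pd_def algebra_simps)
  define \<Delta> where "\<Delta> = h (x + s *\<^sub>R v + s *\<^sub>R w) - h (x + s *\<^sub>R w) - h (x + s *\<^sub>R v) + h x"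
  obtain a where a: "0 < a" "a < s" and a1:
    "(h (x + s *\<^sub>R v + s *\<^sub>R w) - h (x + s *\<^sub>R v)) - (h (x + s *\<^sub>R w) - h x)
      = s * (hv (x + a *\<^sub>R v + s *\<^sub>R w) - hv (x + a *\<^sub>R v))"
    using has_pd_mvt[of "\<lambda>y. h (y + s *\<^sub>R w) - h y" "\<lambda>y. hv (y + s *\<^sub>R w) - hv y" v s x]
      has_pd_diff[OF sh[of h hv v] v] v s by blast
  obtain b where b: "0 < b" "b < s" and b1:
    "hv (x + a *\<^sub>R v + s *\<^sub>R w) - hv (x + a *\<^sub>R v) = s * hvw (x + a *\<^sub>R v + b *\<^sub>R w)"
    using has_pd_mvt[OF vw s, of "x + a *\<^sub>R v"] by blast
  obtain c where c: "0 < c" "c < s" and c1: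
    "(h (x + s *\<^sub>R w + s *\<^sub>R v) - h (x + s *\<^sub>R w)) - (h (x + s *\<^sub>R v) - h x)
      = s * (hw (x + c *\<^sub>R w + s *\<^sub>R v) - hw (x + c *\<^sub>R w))"
    using has_pd_mvt[of "\<lambda>y. h (y + s *\<^sub>R v) - h y" "\<lambda>y. hw (y + s *\<^sub>R v) - hw y" w s x]
      has_pd_diff[OF sh[of h hw w] w] w s by blast
  obtain d where d: "0 < d" "d < s" and e1:
    "hw (x + c *\<^sub>R w + s *\<^sub>R v) - hw (x + c *\<^sub>R w) = s * hwv (x + c *\<^sub>R w + d *\<^sub>R v)"
    using has_pd_mvt[OF wv s, of "x + c *\<^sub>R w"] by blast
  have "s * (s * hvw (x + a *\<^sub>R v + b *\<^sub>R w)) = s * (s * hwv (x + d *\<^sub>R v + c *\<^sub>R w))"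
    using a1 b1 c1 e1 by (simp add: algebra_simps)
  then have "hvw (x + a *\<^sub>R v + b *\<^sub>R w) = hwv (x + d *\<^sub>R v + c *\<^sub>R w)" using s by simp
  moreover have "dist (hvw (x + a *\<^sub>R v + b *\<^sub>R w)) (hvw x) < \<epsilon>"
    using near[OF a b] d1 by simp
  moreover have "dist (hwv (x + d *\<^sub>R v + c *\<^sub>R w)) (hwv x) < \<epsilon>"
    using near[OF d c] d2 by simp
  ultimately show False unfolding \<epsilon>_def dist_real_def by argo
qed

lemma has_pd_commute:
  fixes h :: "'a::real_normed_vector \<Rightarrow> 'b::euclidean_space"
  assumes "\<And>x. has_pd h (hv x) x v" "\<And>x. has_pd h (hw x) x w"
    "\<And>x. has_pd hv (hvw x) x w" "\<And>x. has_pd hw (hwv x) x v"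
    "continuous_on UNIV hvw" "continuous_on UNIV hwv"
  shows "hvw x = hwv x"
proof (rule euclidean_eqI)
  fix b :: 'b
  assume "b \<in> Basis"
  show "hvw x \<bullet> b = hwv x \<bullet> b"
    using assms by (intro has_pd_commute_real[of "\<lambda>x. h x \<bullet> b" "\<lambda>x. hv x \<bullet> b" v "\<lambda>x. hw x \<bullet> b" w])
      (auto intro!: continuous_intros has_pd_linear[OF bounded_linear_inner_left])
qed

text \<open>Squaring turns the merely Lipschitz positive part into a function with a continuous
  derivative; this is why the cutoff is a square.\<close>

lemma DERIV_max_power2: "((\<lambda>t. (max 0 t)\<^sup>2) has_real_derivative 2 * max 0 t) (at t)"
proof -
  consider "t < 0" | "t = 0" | "t > 0" by linarith
  then show ?thesis
  proof cases
    case 1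
    then have "((\<lambda>t. (max 0 t)\<^sup>2) has_real_derivative 0) (at t)"
      by (intro has_field_derivative_transform_within_open[OF DERIV_const, where S="{..<0}"]) auto
    then show ?thesis using 1 by simp
  next
    case 3
    have "((\<lambda>t::real. t\<^sup>2) has_real_derivative 2 * t) (at t)"
      by (auto intro!: derivative_eq_intros)
    then have "((\<lambda>t. (max 0 t)\<^sup>2) has_real_derivative 2 * t) (at t)"
      by (rule has_field_derivative_transform_within_open[where S="{0<..}"]) (use 3 in auto)
    then show ?thesis using 3 by simp
  next
    case 2
    have "((\<lambda>h::real. (max 0 h)\<^sup>2 / h) \<longlongrightarrow> 0) (at 0)"
    proof (rule Lim_null_comparison)
      show "\<forall>\<^sub>F h in at 0. norm ((max 0 h)\<^sup>2 / h) \<le> \<bar>h::real\<bar>"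
        by (rule always_eventually) (auto simp: max_def power2_eq_square)
      show "((\<lambda>h::real. \<bar>h\<bar>) \<longlongrightarrow> 0) (at 0)" by (auto intro!: tendsto_eq_intros)
    qed
    then show ?thesis using 2 by (simp add: DERIV_def)
  qed
qed

section \<open>Integrals of partial derivatives\<close>

lemma inverse_ennreal_antimono:
  includes ennreal.lifting
  shows "x \<le> y \<Longrightarrow> inverse y \<le> inverse (x :: ennreal)"
  by transfer (rule ereal_inverse_antimono)

lemma lborel_integral_translation:
  fixes f :: "'a::euclidean_space \<Rightarrow> real"
  assumes "f \<in> borel_measurable borel"
  shows "integral\<^sup>L lborel (\<lambda>x. f (x + c)) = integral\<^sup>L lborel f"
proof -
  have "integral\<^sup>L lborel f = integral\<^sup>L (distr lborel borel ((+) c)) f"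
    by (simp add: lborel_distr_plus)
  also have "\<dots> = integral\<^sup>L lborel (\<lambda>x. f (c + x))"
    using assms by (subst integral_distr) auto
  finally show ?thesis by (simp add: add.commute)
qed

lemma has_pd_zero_outside:
  assumes "has_pd f d x v" "\<And>y. norm y > R \<Longrightarrow> f y = 0" "norm x > R"
  shows "d = 0"
proof -
  have "open {y::'a. norm y > R}" by (intro open_Collect_less continuous_intros)
  then have o: "open ((\<lambda>t. x + t *\<^sub>R v) -` {y. norm y > R})"
    by (intro open_vimage continuous_intros)
  have "((\<lambda>t. f (x + t *\<^sub>R v)) has_vector_derivative 0) (at 0)"
    by (rule has_vector_derivative_transform_within_open[OF has_vector_derivative_const[of 0] o])
      (use assms in auto)
  then show ?thesis using assms(1) unfolding has_pd_def by (metis vector_derivative_unique_at)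
qed

lemma integrable_continuous_compact_support:
  fixes f :: "'a::euclidean_space \<Rightarrow> real"
  assumes "continuous_on UNIV f" "\<And>y. norm y > R \<Longrightarrow> f y = 0"
  shows "integrable lborel f"
proof -
  have "integrable lborel (\<lambda>x. indicator (cball 0 R) x *\<^sub>R f x)"
    by (intro borel_integrable_compact continuous_on_subset[OF assms(1)]) auto
  moreover have "(\<lambda>x. indicator (cball 0 R) x *\<^sub>R f x) = f"
    using assms(2) by (auto simp: fun_eq_iff indicator_def not_le)
  ultimately show ?thesis by simp
qed

text \<open>The divergence theorem for compact support, one direction at a time: difference
  quotients have integral zero by translation invariance, and dominated convergence passes to the
  derivative.\<close>

lemma integral_has_pd_zero:
  fixes f :: "'a::euclidean_space \<Rightarrow> real"
  assumes pd: "\<And>x. has_pd f (f' x) x v" and cf: "continuous_on UNIV f" and cf': "continuous_on UNIV f'"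
    and supp: "\<And>y. norm y > R \<Longrightarrow> f y = 0"
  shows "integral\<^sup>L lborel f' = 0"
proof -
  have supp': "f' y = 0" if "norm y > R" for y
    using has_pd_zero_outside[OF pd supp that] by simp
  have "compact (f' ` cball 0 R)"
    by (intro compact_continuous_image continuous_on_subset[OF cf']) auto
  then obtain B0 where B0: "\<And>y. y \<in> cball 0 R \<Longrightarrow> norm (f' y) \<le> B0"
    by (meson bounded_iff compact_imp_bounded image_eqI)
  \<comment> \<open>For negative \<open>R\<close> the ball is empty and \<open>B0\<close> may be
    negative; the maximum also covers the points outside the ball, where \<open>f'\<close>
    vanishes.\<close>
  define B where "B = max B0 0"
  have B: "\<bar>f' y\<bar> \<le> B" for y
    using B0[of y] supp'[of y] by (cases "norm y > R") (auto simp: B_def)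
  define h where "h n = 1 / real (Suc n)" for n
  have h0: "h n > 0" "h n \<le> 1" for n by (auto simp: h_def)
  define q where "q n x = (f (x + h n *\<^sub>R v) - f x) / h n" for n x
  have qint: "integral\<^sup>L lborel (q n) = 0" for n
  proof -
    have "integrable lborel f" by (rule integrable_continuous_compact_support[OF cf supp])
    moreover have "integrable lborel (\<lambda>x. f (x + h n *\<^sub>R v))"
    proof (rule integrable_continuous_compact_support)
      show "continuous_on UNIV (\<lambda>x. f (x + h n *\<^sub>R v))"
        by (intro continuous_on_compose2[OF cf] continuous_intros) auto
      show "f (y + h n *\<^sub>R v) = 0" if "norm y > R + norm (h n *\<^sub>R v)" for y
        using that norm_triangle_ineq4[of "y + h n *\<^sub>R v" "h n *\<^sub>R v"] by (intro supp) simp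
    qed
    ultimately have "integral\<^sup>L lborel (q n) = (integral\<^sup>L lborel (\<lambda>x. f (x + h n *\<^sub>R v)) - integral\<^sup>L lborel f) / h n"
      unfolding q_def by simp
    also have "\<dots> = 0"
      using lborel_integral_translation[of f] borel_measurable_continuous_onI[OF cf] by simp
    finally show ?thesis .
  qed
  have lim: "(\<lambda>n. q n x) \<longlonglongrightarrow> f' x" for x
  proof -
    have "((\<lambda>t. (f (x + t *\<^sub>R v) - f x) / t) \<longlongrightarrow> f' x) (at 0)"
      using pd[of x] unfolding has_pd_real DERIV_def by simp
    moreover have "filterlim h (at 0) sequentially"
      unfolding filterlim_at h_def using LIMSEQ_Suc[OF lim_1_over_n] by (auto simp del: of_nat_Suc)
    ultimately show ?thesis unfolding q_def by (rule filterlim_compose)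
  qed
  \<comment> \<open>Since \<open>h n \<le> 1\<close>, all quotients are supported in one ball of
    radius \<open>R + norm v\<close>; inside it the mean value theorem bounds them by the supremum
    of \<open>f'\<close>.\<close>
  have bound: "norm (q n x) \<le> B * indicator (cball 0 (R + norm v)) x" for n x
  proof (cases "norm x > R + norm v")
    case True
    have "norm (h n *\<^sub>R v) \<le> norm v" using h0[of n] by (simp add: mult_left_le_one_le)
    then have "norm (x + h n *\<^sub>R v) > R" 
      using True norm_triangle_ineq4[of "x + h n *\<^sub>R v" "h n *\<^sub>R v"] by simp
    moreover have "norm x > R" using True by (smt (verit) norm_ge_zero)
    ultimately show ?thesis using supp B[of x] by (simp add: q_def)
  next
    case False
    obtain \<xi> where "f (x + h n *\<^sub>R v) - f x = h n * f' (x + \<xi> *\<^sub>R v)"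
      using has_pd_mvt[OF pd h0(1)] by blast
    then show ?thesis using False h0[of n] B[of "x + \<xi> *\<^sub>R v"] by (simp add: q_def)
  qed
  have "(\<lambda>n. integral\<^sup>L lborel (q n)) \<longlonglongrightarrow> integral\<^sup>L lborel f'"
  proof (rule integral_dominated_convergence[where w="\<lambda>x. B * indicator (cball 0 (R + norm v)) x"])
    show "f' \<in> borel_measurable lborel" using borel_measurable_continuous_onI[OF cf'] by simp
    show "q n \<in> borel_measurable lborel" for n
      unfolding q_def using borel_measurable_continuous_onI[OF cf] by measurable
    show "integrable lborel (\<lambda>x. B * indicator (cball 0 (R + norm v)) x)"
      by (intro integrable_mult_right integrable_real_indicator) (auto intro: emeasure_bounded_finite[unfolded infinity_ennreal_def])
  qed (use lim bound in auto)
  then show ?thesis using qint LIMSEQ_unique[of "\<lambda>n. 0::real"] by simp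
qed

section \<open>Determinants and inverse matrices\<close>

text \<open>The Leibniz formula has \<open>m!\<close> terms. The crude bound serves for powers of
  contractions and for the cofactors of the metric.\<close>

lemma abs_det_le:
  fixes M :: "real ^ 'm ^ 'm"
  assumes "\<And>i j. \<bar>M $ i $ j\<bar> \<le> b"
  shows "\<bar>det M\<bar> \<le> fact CARD('m) * b ^ CARD('m)"
proof -
  have b: "0 \<le> b" using assms[of undefined undefined] by linarith
  have "\<bar>det M\<bar> \<le> (\<Sum>p | p permutes (UNIV :: 'm set). \<bar>of_int (sign p) * (\<Prod>i\<in>UNIV. M $ i $ p i)\<bar>)"
    unfolding det_def by (rule sum_abs)
  also have "\<dots> \<le> (\<Sum>p | p permutes (UNIV :: 'm set). b ^ CARD('m))"
  proof (rule sum_mono)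
    fix p :: "'m \<Rightarrow> 'm"
    have "\<bar>\<Prod>i\<in>UNIV. M $ i $ p i\<bar> \<le> (\<Prod>i\<in>(UNIV::'m set). b)"
      unfolding abs_prod using assms by (intro prod_mono) auto
    moreover have "\<bar>of_int (sign p) :: real\<bar> = 1" by (simp add: sign_def)
    ultimately show "\<bar>of_int (sign p) * (\<Prod>i\<in>UNIV. M $ i $ p i)\<bar> \<le> b ^ CARD('m)"
      by (simp add: abs_mult)
  qed
  also have "\<dots> = fact CARD('m) * b ^ CARD('m)"
    by (simp add: card_permutations)
  finally show ?thesis .
qed

text \<open>Powers of a contraction are contractions, so their determinants are bounded.\<close>

lemma abs_det_contraction:
  fixes N :: "real ^ 'm ^ 'm"
  assumes "\<And>v. norm (N *v v) \<le> norm v"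
  shows "\<bar>det N\<bar> \<le> 1"
proof (rule ccontr)
  assume "\<not> \<bar>det N\<bar> \<le> 1"
  then have g: "\<bar>det N\<bar> > 1" by simp
  have c: "\<exists>K :: real ^ 'm ^ 'm. (\<forall>v. norm (K *v v) \<le> norm v) \<and> det K = det N ^ k" for k
  proof (induction k)
    case 0
    show ?case by (intro exI[of _ "mat 1"]) auto
  next
    case (Suc k)
    then obtain K :: "real ^ 'm ^ 'm" where "\<And>v. norm (K *v v) \<le> norm v" "det K = det N ^ k" by blast
    then show ?case
      using assms order_trans
      by (intro exI[of _ "N ** K"]) (simp add: det_mul flip: matrix_vector_mul_assoc, blast)
  qed
  have "\<bar>det N\<bar> ^ k \<le> fact CARD('m)" for k
  proof -
    obtain K :: "real ^ 'm ^ 'm" where K: "\<And>v. norm (K *v v) \<le> norm v" "det K = det N ^ k" using c by blast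
    have "\<bar>K $ i $ j\<bar> \<le> 1" for i j
    proof -
      have "\<bar>K $ i $ j\<bar> = \<bar>(K *v axis j 1) $ i\<bar>" by (simp add: matrix_vector_mul_component inner_axis)
      also have "\<dots> \<le> norm (K *v axis j 1)" by (rule component_le_norm_cart)
      also have "\<dots> \<le> 1" using K(1)[of "axis j 1"] by simp
      finally show ?thesis .
    qed
    from abs_det_le[OF this] show ?thesis by (simp add: K(2) power_abs)
  qed
  moreover obtain k where "fact CARD('m) < \<bar>det N\<bar> ^ k" using real_arch_pow[OF g] by blast
  ultimately show False by (meson not_le)
qed

text \<open>An expanding matrix is injective, hence invertible, and \<open>c\<close> times its
  inverse is a contraction.\<close>

lemma abs_det_expanding:
  fixes M :: "real ^ 'm ^ 'm"
  assumes c: "c > 0" and M: "\<And>v. norm (M *v v) \<ge> c * norm v"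
  shows "\<bar>det M\<bar> \<ge> c ^ CARD('m)"
proof -
  have "v = 0" if "M *v v = 0" for v
    using M[of v] c that by (simp add: mult_le_0_iff)
  then have "inj ((*v) M)"
    by (simp add: linear_injective_0 matrix_vector_mul_linear)
  then obtain N where N: "N ** M = mat 1"
    using matrix_left_invertible_injective[of M] by blast
  have MN: "M ** N = mat 1" using N matrix_left_right_inverse by blast
  have "norm ((c *\<^sub>R N) *v v) \<le> norm v" for v
  proof -
    have "c * norm (N *v v) \<le> norm (M *v (N *v v))" by (rule M)
    then show ?thesis using c by (simp add: matrix_vector_mul_assoc MN scaleR_matrix_vector_assoc[symmetric])
  qed
  then have 1: "\<bar>det (c *\<^sub>R N)\<bar> \<le> 1" by (rule abs_det_contraction)
  \<comment> \<open>The scalar matrix is recognised as the matrix of a homothety, whose determinant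
    is known.\<close>
  have "(c *\<^sub>R mat 1 :: real^'m^'m) = matrix ((*\<^sub>R) c)"
    by (simp add: matrix_def mat_def vec_eq_iff axis_def)
  then have "det (c *\<^sub>R mat 1 :: real^'m^'m) = c ^ CARD('m)"
    by (simp only: det_matrix_scaleR)
  moreover have "(c *\<^sub>R N) ** M = c *\<^sub>R mat 1" 
  proof -
    have "(c *\<^sub>R N) ** M = c *\<^sub>R (N ** M)"
      by (simp add: matrix_matrix_mult_def vec_eq_iff sum_distrib_left mult.assoc)
    then show ?thesis by (simp add: N)
  qed
  ultimately have "det (c *\<^sub>R N) * det M = c ^ CARD('m)" by (metis det_mul)
  then have "\<bar>det (c *\<^sub>R N)\<bar> * \<bar>det M\<bar> = c ^ CARD('m)" using c by (metis abs_mult abs_of_pos zero_less_power)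
  then show ?thesis using mult_right_mono[OF 1, of "\<bar>det M\<bar>"] by simp
qed

section \<open>Continuity and differentiation of determinants and inverses\<close>

lemma tendsto_det:
  fixes M :: "'a \<Rightarrow> real ^ 'm ^ 'm"
  assumes "\<And>i j. ((\<lambda>x. M x $ i $ j) \<longlongrightarrow> L $ i $ j) F"
  shows "((\<lambda>x. det (M x)) \<longlongrightarrow> det L) F"
  unfolding det_def by (intro tendsto_intros assms)

lemma continuous_on_det:
  fixes M :: "'a::topological_space \<Rightarrow> real ^ 'm ^ 'm"
  assumes "\<And>i j. continuous_on S (\<lambda>x. M x $ i $ j)"
  shows "continuous_on S (\<lambda>x. det (M x))"
  unfolding det_def by (intro continuous_intros assms)

text \<open>Writing the inverse as a quotient of determinants makes continuity immediate and later
  bounds its entries by cofactors over the determinant.\<close>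

definition cramer_inv :: "real ^ 'm ^ 'm \<Rightarrow> real ^ 'm ^ 'm"
  where "cramer_inv M = (\<chi> k l. det (\<chi> i j. if j = k then axis l 1 $ i else M $ i $ j) / det M)"

lemma cramer_inv_right: "det M \<noteq> 0 \<Longrightarrow> M ** cramer_inv M = mat 1"
  and cramer_inv_left: "det M \<noteq> 0 \<Longrightarrow> cramer_inv M ** M = mat 1"
proof -
  assume d: "det M \<noteq> 0"
  have "M *v (\<chi> k. cramer_inv M $ k $ l) = axis l 1" for l
    by (subst cramer[OF d]) (simp add: cramer_inv_def)
  then have "(\<Sum>k\<in>UNIV. M $ i $ k * cramer_inv M $ k $ l) = (if i = l then 1 else 0)" for i l
    by (simp add: matrix_vector_mult_def vec_eq_iff axis_def)
  then show r: "M ** cramer_inv M = mat 1"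
    by (simp add: matrix_matrix_mult_def mat_def)
  then show "cramer_inv M ** M = mat 1" using matrix_left_right_inverse by blast
qed

lemma sum_cramer_inv_right: "det M \<noteq> 0 \<Longrightarrow> (\<Sum>k\<in>UNIV. M $ i $ k * cramer_inv M $ k $ j) = (if i = j then 1 else 0)"
  and sum_cramer_inv_left: "det M \<noteq> 0 \<Longrightarrow> (\<Sum>k\<in>UNIV. cramer_inv M $ i $ k * M $ k $ j) = (if i = j then 1 else 0)"
  using cramer_inv_right[of M] cramer_inv_left[of M]
  by (simp_all add: matrix_matrix_mult_def mat_def vec_eq_iff)

lemma tendsto_cramer_inv:
  fixes M :: "'a \<Rightarrow> real ^ 'm ^ 'm"
  assumes "\<And>i j. ((\<lambda>x. M x $ i $ j) \<longlongrightarrow> L $ i $ j) F" "det L \<noteq> 0"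
  shows "((\<lambda>x. cramer_inv (M x) $ i $ j) \<longlongrightarrow> cramer_inv L $ i $ j) F"
proof -
  have "((\<lambda>x. det (\<chi> k l. if l = i then axis j 1 $ k else M x $ k $ l)) \<longlongrightarrow>
      det (\<chi> k l. if l = i then axis j 1 $ k else L $ k $ l)) F"
    by (rule tendsto_det) (simp add: assms(1))
  then show ?thesis
    unfolding cramer_inv_def using assms by (simp add: tendsto_divide tendsto_det)
qed

lemma continuous_on_cramer_inv:
  fixes M :: "'a::topological_space \<Rightarrow> real ^ 'm ^ 'm"
  assumes "\<And>i j. continuous_on S (\<lambda>x. M x $ i $ j)" "\<And>x. x \<in> S \<Longrightarrow> det (M x) \<noteq> 0"
  shows "continuous_on S (\<lambda>x. cramer_inv (M x) $ i $ j)"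
  using assms unfolding continuous_on_def by (blast intro: tendsto_cramer_inv)

text \<open>The resolvent identity \<open>n t - n 0 = - n t (m t - m 0) n 0\<close> leaves only the
  difference of \<open>m\<close> to be divided by \<open>t\<close>, so continuity of the inverse
  suffices for the limit.\<close>

lemma has_pd_cramer_inv:
  fixes M :: "'a::real_normed_vector \<Rightarrow> real ^ 'm ^ 'm"
  assumes pd: "\<And>i j. has_pd (\<lambda>y. M y $ i $ j) (M' i j) x v" and d: "\<And>y. det (M y) \<noteq> 0"
  shows "has_pd (\<lambda>y. cramer_inv (M y) $ i $ j)
    (- (\<Sum>p\<in>UNIV. \<Sum>q\<in>UNIV. cramer_inv (M x) $ i $ p * M' p q * cramer_inv (M x) $ q $ j)) x v"
proof -
  define m n where "m t = M (x + t *\<^sub>R v)" and "n t = cramer_inv (m t)" for t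
  have dm: "((\<lambda>t. m t $ i $ j) has_real_derivative M' i j) (at 0)" for i j
    using pd unfolding has_pd_real m_def .
  have "((\<lambda>t. m t $ i $ j) \<longlongrightarrow> m 0 $ i $ j) (at 0)" for i j
    using dm[of i j] DERIV_isCont isCont_def by blast
  then have lim_n: "((\<lambda>t. n t $ i $ j) \<longlongrightarrow> n 0 $ i $ j) (at 0)" for i j
    unfolding n_def using d by (intro tendsto_cramer_inv) (auto simp: m_def)
  have inv: "n t ** m t = mat 1" "m t ** n t = mat 1" for t
    unfolding n_def m_def using d by (auto intro: cramer_inv_left cramer_inv_right)
  have eq: "n t - n 0 = - (n t ** (m t - m 0) ** n 0)" for t
  proof -
    have "n t ** (m t - m 0) ** n 0 = n t ** m t ** n 0 - n t ** (m 0 ** n 0)"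
      unfolding matrix_mul_assoc
      by (simp add: matrix_matrix_mult_def vec_eq_iff algebra_simps sum_subtractf)
    then show ?thesis by (simp add: inv)
  qed
  have ent: "(n t $ i $ j - n 0 $ i $ j) / t =
     - (\<Sum>p\<in>UNIV. \<Sum>q\<in>UNIV. n t $ i $ p * ((m t $ p $ q - m 0 $ p $ q) / t) * n 0 $ q $ j)" for t
  proof -
    have "n t $ i $ j - n 0 $ i $ j = (n t - n 0) $ i $ j" by simp
    also have "\<dots> = - (\<Sum>q\<in>UNIV. \<Sum>p\<in>UNIV. n t $ i $ p * (m t $ p $ q - m 0 $ p $ q) * n 0 $ q $ j)"
      unfolding eq by (simp add: matrix_matrix_mult_def sum_distrib_right)
    also have "\<dots> = - (\<Sum>p\<in>UNIV. \<Sum>q\<in>UNIV. n t $ i $ p * (m t $ p $ q - m 0 $ p $ q) * n 0 $ q $ j)"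
      by (subst sum.swap) simp
    finally show ?thesis by (simp add: sum_divide_distrib)
  qed
  have "((\<lambda>t. (m t $ p $ q - m 0 $ p $ q) / t) \<longlongrightarrow> M' p q) (at 0)" for p q
    using dm[of p q] unfolding DERIV_def by simp
  then have "((\<lambda>t. (n t $ i $ j - n 0 $ i $ j) / t) \<longlongrightarrow>
     - (\<Sum>p\<in>UNIV. \<Sum>q\<in>UNIV. n 0 $ i $ p * M' p q * n 0 $ q $ j)) (at 0)"
    unfolding ent by (intro tendsto_intros lim_n)
  then show ?thesis
    unfolding has_pd_real DERIV_def n_def m_def by simp
qed

text \<open>Expanding \<open>r\<close> in the rows of \<open>M\<close> has coefficients
  \<open>r\<close> times the inverse matrix; only the coefficient of row \<open>j\<close>
  contributes to the determinant.\<close>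

lemma det_replace_row:
  fixes M :: "real ^ 'm ^ 'm"
  assumes d: "det M \<noteq> 0"
  shows "det (\<chi> i. if i = j then r else M $ i) = (\<Sum>q\<in>UNIV. r $ q * cramer_inv M $ q $ j) * det M"
proof -
  define c where "c = (\<chi> k. \<Sum>q\<in>UNIV. r $ q * cramer_inv M $ q $ k)"
  have "(\<Sum>k\<in>UNIV. c $ k *s row k M) = r"
  proof (subst vec_eq_iff, rule allI)
    fix l
    have "(\<Sum>k\<in>UNIV. c $ k *s row k M) $ l = (\<Sum>k\<in>UNIV. \<Sum>q\<in>UNIV. r $ q * (cramer_inv M $ q $ k * M $ k $ l))"
      by (simp add: c_def row_def sum_distrib_right mult.assoc)
    also have "\<dots> = (\<Sum>q\<in>UNIV. r $ q * (\<Sum>k\<in>UNIV. cramer_inv M $ q $ k * M $ k $ l))"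
      by (subst sum.swap) (simp add: sum_distrib_left)
    also have "\<dots> = r $ l" by (simp add: sum_cramer_inv_left[OF d] if_distrib cong: if_cong)
    finally show "(\<Sum>k\<in>UNIV. c $ k *s row k M) $ l = r $ l" .
  qed
  moreover have "row i M = M $ i" for i by (simp add: row_def)
  ultimately have "det (\<chi> i. if i = j then r else M $ i) = c $ j * det M"
    using cramer_lemma_transpose[of j c M] by (simp cong: if_cong)
  then show ?thesis by (simp add: c_def)
qed

text \<open>Jacobi's formula. The product rule in the Leibniz formula differentiates one row at a
  time, and \<open>det_replace_row\<close> evaluates each resulting determinant.\<close>

lemma has_pd_det:
  fixes M :: "'a::real_normed_vector \<Rightarrow> real ^ 'm ^ 'm"
  assumes pd: "\<And>i j. has_pd (\<lambda>y. M y $ i $ j) (M' i j) x v" and d: "det (M x) \<noteq> 0"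
  shows "has_pd (\<lambda>y. det (M y)) ((\<Sum>i\<in>UNIV. \<Sum>j\<in>UNIV. M' i j * cramer_inv (M x) $ j $ i) * det (M x)) x v"
proof -
  have dm: "((\<lambda>t. M (x + t *\<^sub>R v) $ i $ j) has_real_derivative M' i j) (at 0)" for i j
    using pd unfolding has_pd_real .
  have "((\<lambda>t. det (M (x + t *\<^sub>R v))) has_real_derivative
     (\<Sum>p | p permutes (UNIV :: 'm set). of_int (sign p) *
        (\<Sum>j\<in>UNIV. M' j (p j) * (\<Prod>i\<in>UNIV - {j}. M (x + 0 *\<^sub>R v) $ i $ p i)))) (at 0)"
    unfolding det_def by (intro DERIV_sum DERIV_cmult has_field_derivative_prod dm)
  moreover have "(\<Sum>p | p permutes (UNIV :: 'm set). of_int (sign p) *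
        (\<Sum>j\<in>UNIV. M' j (p j) * (\<Prod>i\<in>UNIV - {j}. M x $ i $ p i)))
     = (\<Sum>j\<in>UNIV. det (\<chi> i. if i = j then (\<chi> k. M' j k) else M x $ i))"
  proof -
    have "(\<Prod>i\<in>UNIV. (\<chi> i. if i = j then (\<chi> k. M' j k) else M x $ i) $ i $ p i)
       = M' j (p j) * (\<Prod>i\<in>UNIV - {j}. M x $ i $ p i)" for j and p :: "'m \<Rightarrow> 'm"
      by (subst prod.remove[of _ j]) auto
    then show ?thesis unfolding det_def
      by (subst sum.swap) (simp add: sum_distrib_left)
  qed
  ultimately show ?thesis unfolding has_pd_real
    by (simp add: det_replace_row[OF d] sum_distrib_right)
qed

section \<open>Spacelike graphs\<close>

lemma pinner_inner: "pinner p q = fst p \<bullet> fst q - snd p \<bullet> snd q"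
  by (simp add: pinner_def inner_vec_def)

text \<open>Although indefinite, the product is bounded for the Euclidean norm, so product rules and
  continuity come from the general theory of bilinear maps.\<close>

lemma bounded_bilinear_pinner: "bounded_bilinear pinner"
proof -
  have "bounded_bilinear (\<lambda>p q :: ('m::finite, 'n::finite) pseudo_euclidean. fst p \<bullet> fst q)"
    "bounded_bilinear (\<lambda>p q :: ('m::finite, 'n::finite) pseudo_euclidean. snd p \<bullet> snd q)"
    by (auto intro!: bounded_bilinear.comp[OF bounded_bilinear_inner] bounded_linear_fst bounded_linear_snd)
  show ?thesis unfolding bounded_bilinear_def pinner_inner
  proof (intro conjI allI)
    have "\<bar>fst p \<bullet> fst q - snd p \<bullet> snd q\<bar> \<le> norm p * norm q * 2" for p q :: "('m::finite, 'n::finite) pseudo_euclidean"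
    proof -
      have "\<bar>fst p \<bullet> fst q\<bar> \<le> norm p * norm q"
        by (rule order_trans[OF Cauchy_Schwarz_ineq2]) (intro mult_mono norm_ge_zero; metis norm_fst_le prod.collapse)
      moreover have "\<bar>snd p \<bullet> snd q\<bar> \<le> norm p * norm q"
        by (rule order_trans[OF Cauchy_Schwarz_ineq2]) (intro mult_mono norm_ge_zero; metis norm_snd_le prod.collapse)
      ultimately show ?thesis by linarith
    qed
    then show "\<exists>K. \<forall>p q :: ('m::finite, 'n::finite) pseudo_euclidean.
       norm (fst p \<bullet> fst q - snd p \<bullet> snd q) \<le> norm p * norm q * K" unfolding real_norm_def by blast
  qed (auto simp: algebra_simps)
qed

interpretation pinner: bounded_bilinear pinner
  by (rule bounded_bilinear_pinner)

lemma pinner_commute: "pinner p q = pinner q p"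
  by (simp add: pinner_inner inner_commute)

lemmas has_pd_pinner = has_pd_bilinear[OF bounded_bilinear_pinner]

text \<open>Here \<open>G\<close> is the inverse metric, \<open>\<gamma>\<close> collects the Christoffel symbols and \<open>\<alpha>\<close> the second derivatives of the
  position vector paired with the normal fields \<open>N\<^sub>i\<close> below. The left-hand side comes from differentiating \<open>G\<close>
  in the self-shrinker equation and cancels all Christoffel terms of the drift Laplacian of \<open>ln w\<close>.\<close>

lemma trace_identity:
  fixes G :: "'m::finite \<Rightarrow> 'm \<Rightarrow> real" and \<alpha> \<gamma> :: "'m \<Rightarrow> 'm \<Rightarrow> 'm \<Rightarrow> real"
  assumes G: "\<And>k l. G k l = G l k" and \<alpha>: "\<And>i p k. \<alpha> i p k = \<alpha> i k p" and \<gamma>: "\<And>i p k. \<gamma> i p k = \<gamma> i k p"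
  shows "(\<Sum>i\<in>UNIV. \<Sum>k\<in>UNIV. \<Sum>l\<in>UNIV. \<Sum>p\<in>UNIV. G k p * \<gamma> l p i * \<alpha> i k l)
     + (\<Sum>i\<in>UNIV. \<Sum>k\<in>UNIV. \<Sum>l\<in>UNIV. \<Sum>p\<in>UNIV. G p l * \<gamma> k p i * \<alpha> i k l)
    = (\<Sum>k\<in>UNIV. \<Sum>l\<in>UNIV. G k l * (\<Sum>i\<in>UNIV. \<Sum>p\<in>UNIV. (\<alpha> i p l + \<gamma> i p l) * (\<alpha> p i k + \<gamma> p i k)
         - \<gamma> i p l * \<gamma> p i k - \<alpha> i p l * \<alpha> p i k))"
proof -
  \<comment> \<open>Expanding the right side leaves only products of one \<alpha> and one \<gamma>.
    Each of the two mixed contractions there, and each of the two on the left, becomes this one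
    after relabelling indices by symmetry.\<close>
  let ?T = "\<Sum>i\<in>UNIV. \<Sum>k\<in>UNIV. \<Sum>l\<in>UNIV. \<Sum>p\<in>UNIV. G k p * \<gamma> l p i * \<alpha> i k l"
  have 1: "(\<Sum>i\<in>UNIV. \<Sum>k\<in>UNIV. \<Sum>l\<in>UNIV. \<Sum>p\<in>UNIV. G p l * \<gamma> k p i * \<alpha> i k l) = ?T"
    by (subst (2) sum.swap) (simp add: G \<alpha>)
  have 2: "(\<Sum>k\<in>UNIV. \<Sum>l\<in>UNIV. \<Sum>i\<in>UNIV. \<Sum>p\<in>UNIV. G k l * (\<alpha> i p l * \<gamma> p i k)) = ?T"
  proof -
    have "(\<Sum>k\<in>UNIV. \<Sum>l\<in>UNIV. \<Sum>i\<in>UNIV. \<Sum>p\<in>UNIV. G k l * (\<alpha> i p l * \<gamma> p i k))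
      = (\<Sum>k\<in>UNIV. \<Sum>i\<in>UNIV. \<Sum>l\<in>UNIV. \<Sum>p\<in>UNIV. G k l * (\<alpha> i p l * \<gamma> p i k))"
      by (rule sum.cong[OF refl], subst sum.swap, simp)
    also have "\<dots> = (\<Sum>i\<in>UNIV. \<Sum>k\<in>UNIV. \<Sum>l\<in>UNIV. \<Sum>p\<in>UNIV. G k l * (\<alpha> i p l * \<gamma> p i k))"
      by (rule sum.swap)
    also have "\<dots> = (\<Sum>i\<in>UNIV. \<Sum>l\<in>UNIV. \<Sum>k\<in>UNIV. \<Sum>p\<in>UNIV. G k l * (\<alpha> i p l * \<gamma> p i k))"
      by (rule sum.cong[OF refl], subst sum.swap, simp)
    also have "\<dots> = (\<Sum>i\<in>UNIV. \<Sum>l\<in>UNIV. \<Sum>p\<in>UNIV. \<Sum>k\<in>UNIV. G k l * (\<alpha> i p l * \<gamma> p i k))"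
      by (rule sum.cong[OF refl], rule sum.cong[OF refl], subst sum.swap, simp)
    also have "\<dots> = ?T"
      by (intro sum.cong refl) (simp add: G \<alpha> \<gamma> mult_ac)
    finally show ?thesis .
  qed
  have 3: "(\<Sum>k\<in>UNIV. \<Sum>l\<in>UNIV. \<Sum>i\<in>UNIV. \<Sum>p\<in>UNIV. G k l * (\<gamma> i p l * \<alpha> p i k)) = ?T"
  proof -
    have "(\<Sum>k\<in>UNIV. \<Sum>l\<in>UNIV. \<Sum>i\<in>UNIV. \<Sum>p\<in>UNIV. G k l * (\<gamma> i p l * \<alpha> p i k))
      = (\<Sum>l\<in>UNIV. \<Sum>k\<in>UNIV. \<Sum>i\<in>UNIV. \<Sum>p\<in>UNIV. G k l * (\<gamma> i p l * \<alpha> p i k))"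
      by (rule sum.swap)
    also have "\<dots> = (\<Sum>l\<in>UNIV. \<Sum>k\<in>UNIV. \<Sum>p\<in>UNIV. \<Sum>i\<in>UNIV. G k l * (\<gamma> i p l * \<alpha> p i k))"
      by (rule sum.cong[OF refl], rule sum.cong[OF refl], rule sum.swap)
    also have "\<dots> = (\<Sum>k\<in>UNIV. \<Sum>l\<in>UNIV. \<Sum>i\<in>UNIV. \<Sum>p\<in>UNIV. G k l * (\<alpha> i p l * \<gamma> p i k))"
      by (intro sum.cong refl) (simp add: G mult_ac)
    finally show ?thesis using 2 by simp
  qed
  have "(\<Sum>k\<in>UNIV. \<Sum>l\<in>UNIV. G k l * (\<Sum>i\<in>UNIV. \<Sum>p\<in>UNIV. (\<alpha> i p l + \<gamma> i p l) * (\<alpha> p i k + \<gamma> p i k)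
         - \<gamma> i p l * \<gamma> p i k - \<alpha> i p l * \<alpha> p i k))
    = (\<Sum>k\<in>UNIV. \<Sum>l\<in>UNIV. \<Sum>i\<in>UNIV. \<Sum>p\<in>UNIV. G k l * (\<alpha> i p l * \<gamma> p i k) + G k l * (\<gamma> i p l * \<alpha> p i k))"
    unfolding sum_distrib_left by (intro sum.cong refl) (simp add: algebra_simps)
  also have "\<dots> = ?T + ?T"
    unfolding sum.distrib 2 3 ..
  finally show ?thesis using 1 by simp
qed

section \<open>The graph in its global parametrization\<close>

abbreviation ax :: "'m::finite \<Rightarrow> real ^ 'm" where "ax i \<equiv> axis i 1"

text \<open>Partial derivatives are explicit functions so that they can be differentiated again;
  three orders occur in the second derivatives of \<open>ln w\<close>. The assumption
  \<open>spacelike\<close> says that the differential of \<open>u\<close> strictly contracts. The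
  orthonormal bases in \<open>frame_ex\<close> will come from the frames in the definition of mean
  curvature, so no orthogonalisation is carried out.\<close>

locale spacelike_c3_graph =
  fixes u :: "real ^ 'm::finite \<Rightarrow> real ^ 'n::finite"
    and u1 :: "'m \<Rightarrow> real ^ 'm \<Rightarrow> real ^ 'n"
    and u2 :: "'m \<Rightarrow> 'm \<Rightarrow> real ^ 'm \<Rightarrow> real ^ 'n"
    and u3 :: "'m \<Rightarrow> 'm \<Rightarrow> 'm \<Rightarrow> real ^ 'm \<Rightarrow> real ^ 'n"
    and a :: "'m \<Rightarrow> ('m, 'n) pseudo_euclidean"
  assumes du: "\<And>x. (u has_derivative (\<lambda>v. \<Sum>i\<in>UNIV. v $ i *\<^sub>R u1 i x)) (at x)"
    and du1: "\<And>j x. (u1 j has_derivative (\<lambda>v. \<Sum>i\<in>UNIV. v $ i *\<^sub>R u2 j i x)) (at x)"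
    and du2: "\<And>j k x. (u2 j k has_derivative (\<lambda>v. \<Sum>i\<in>UNIV. v $ i *\<^sub>R u3 j k i x)) (at x)"
    and u3_cont: "\<And>i j k. continuous_on UNIV (u3 i j k)"
    and spacelike: "\<And>x v. v \<noteq> 0 \<Longrightarrow> norm (\<Sum>i\<in>UNIV. v $ i *\<^sub>R u1 i x) < norm v"
    and frame_ex: "\<And>x. \<exists>c :: 'm \<Rightarrow> real ^ 'm. \<forall>i j.
       pinner (\<Sum>k\<in>UNIV. c i $ k *\<^sub>R (ax k, u1 k x)) (\<Sum>k\<in>UNIV. c j $ k *\<^sub>R (ax k, u1 k x)) = (if i = j then 1 else 0)"
    and a_orth: "\<And>i j. pinner (a i) (a j) = (if i = j then 1 else 0)"
begin

definition X where "X x = (x, u x)"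
definition X1 where "X1 i x = (ax i, u1 i x)"
definition X2 :: "'m \<Rightarrow> 'm \<Rightarrow> real ^ 'm \<Rightarrow> ('m, 'n) pseudo_euclidean" where "X2 i j x = (0, u2 i j x)"
definition X3 :: "'m \<Rightarrow> 'm \<Rightarrow> 'm \<Rightarrow> real ^ 'm \<Rightarrow> ('m, 'n) pseudo_euclidean" where "X3 i j k x = (0, u3 i j k x)"

lemma pd_of_sum: "(f has_derivative (\<lambda>v. \<Sum>i\<in>UNIV. v $ i *\<^sub>R f' i)) (at x) \<Longrightarrow> has_pd f (f' l) x (ax l)"
  for f :: "real ^ 'm \<Rightarrow> 'b::real_normed_vector"
proof -
  assume "(f has_derivative (\<lambda>v. \<Sum>i\<in>UNIV. v $ i *\<^sub>R f' i)) (at x)"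
  from has_pd_has_derivative[OF this, of "ax l"] 
  have "has_pd f (\<Sum>i\<in>UNIV. ax l $ i *\<^sub>R f' i) x (ax l)" .
  moreover have "(\<Sum>i\<in>UNIV. ax l $ i *\<^sub>R f' i) = f' l"
    by (subst sum.remove[of _ l]) (auto simp: axis_def intro!: sum.neutral)
  ultimately show ?thesis by simp
qed

lemma pd_u: "has_pd u (u1 l x) x (ax l)" by (rule pd_of_sum[OF du])
lemma pd_u1: "has_pd (u1 i) (u2 i l x) x (ax l)" by (rule pd_of_sum[OF du1])
lemma pd_u2: "has_pd (u2 i j) (u3 i j l x) x (ax l)" by (rule pd_of_sum[OF du2])

lemma pd_X: "has_pd X (X1 l x) x (ax l)"
  unfolding X_def[abs_def] X1_def by (intro has_pd_Pair has_pd_id pd_u)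
lemma pd_X1: "has_pd (X1 i) (X2 i l x) x (ax l)"
  unfolding X1_def[abs_def] X2_def by (intro has_pd_Pair has_pd_const pd_u1)
lemma pd_X2: "has_pd (X2 i j) (X3 i j l x) x (ax l)"
  unfolding X2_def[abs_def] X3_def by (intro has_pd_Pair has_pd_const pd_u2)

lemma cont_u: "continuous_on UNIV u" and cont_u1: "continuous_on UNIV (u1 i)" and cont_u2: "continuous_on UNIV (u2 i j)"
  using du du1 du2 by (meson has_derivative_continuous continuous_at_imp_continuous_on)+

lemma cont_X[continuous_intros]: "continuous_on UNIV X" and cont_X1[continuous_intros]: "continuous_on UNIV (X1 i)"
  and cont_X2[continuous_intros]: "continuous_on UNIV (X2 i j)" and cont_X3[continuous_intros]: "continuous_on UNIV (X3 i j k)"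
  unfolding X_def[abs_def] X1_def[abs_def] X2_def[abs_def] X3_def[abs_def]
  by (intro continuous_intros cont_u cont_u1 cont_u2 u3_cont)+

lemmas cont_pinner[continuous_intros] = bounded_bilinear.continuous_on[OF bounded_bilinear_pinner]

lemma u2_sym: "u2 i j x = u2 j i x"
  using has_pd_commute[OF pd_u pd_u pd_u1 pd_u1 cont_u2 cont_u2] .

lemma u3_sym: "u3 i j k x = u3 i k j x"
  using has_pd_commute[OF pd_u1 pd_u1 pd_u2 pd_u2 u3_cont u3_cont] .

lemma X2_sym: "X2 i j x = X2 j i x" by (simp add: X2_def u2_sym)

lemma X3_sym: "X3 i j k x = X3 i k j x" "X3 i j k x = X3 j i k x"
proof -
  show "X3 i j k x = X3 i k j x" by (simp add: X3_def u3_sym)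
  have "u2 i j = u2 j i" using u2_sym by blast
  then have "has_pd (u2 i j) (u3 j i k x) x (ax k)" using pd_u2[of j i k x] by simp
  from has_pd_unique[OF this pd_u2] show "X3 i j k x = X3 j i k x" by (simp add: X3_def)
qed

definition DX where "DX x v = (\<Sum>i\<in>UNIV. v $ i *\<^sub>R X1 i x)"

lemma DX_Pair: "DX x v = (v, \<Sum>i\<in>UNIV. v $ i *\<^sub>R u1 i x)"
proof -
  have "(\<Sum>i\<in>UNIV. v $ i *\<^sub>R ax i) = v"
    using basis_expansion[of v] by (simp add: scalar_mult_eq_scaleR)
  then show ?thesis by (simp add: DX_def X1_def prod_eq_iff fst_sum snd_sum)
qed

text \<open>Let \<open>n = (p, q)\<close>. Testing normality against the tangent vector with the
  same horizontal part \<open>p\<close> gives \<open>|p|^2 = q \<bullet> L\<close> with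
  \<open>|L| < |p|\<close>, so \<open>|p| < |q|\<close>.\<close>

lemma normal_neg:
  assumes "\<And>k. pinner n (X1 k x) = 0" "n \<noteq> 0"
  shows "pinner n n < 0"
proof -
  define p q L where "p = fst n" and "q = snd n" and "L = (\<Sum>i\<in>UNIV. p $ i *\<^sub>R u1 i x)"
  have "pinner n (DX x p) = 0" by (simp add: DX_def pinner.sum_right pinner.scaleR_right assms)
  then have e: "p \<bullet> p = q \<bullet> L" by (simp add: DX_Pair pinner_inner p_def q_def L_def)
  show ?thesis
  proof (cases "p = 0")
    case True
    then have "q \<noteq> 0" using assms(2) by (simp add: p_def q_def prod_eq_iff)
    then show ?thesis using True by (simp add: pinner_inner p_def q_def)
  next
    case False
    have L: "norm L < norm p" unfolding L_def by (rule spacelike[OF False])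
    have "norm p * norm p \<le> norm q * norm L" 
      using e norm_cauchy_schwarz[of q L] by (simp add: dot_square_norm power2_eq_square)
    moreover have "norm p * norm p > 0" using False by simp
    ultimately have "norm p * norm p \<le> norm q * norm p" "norm q > 0"
      using L False by (smt (verit) mult_left_mono norm_ge_zero, smt (verit) mult_eq_0_iff norm_ge_zero)
    moreover have "norm q * norm L < norm q * norm p" using L \<open>norm q > 0\<close> by simp
    ultimately have "norm p < norm q" 
      using \<open>norm p * norm p \<le> norm q * norm L\<close> False by (smt (verit) mult_right_mono norm_ge_zero mult_right_less_imp_less)
    then have "p \<bullet> p < q \<bullet> q" unfolding dot_square_norm by (simp add: power_strict_mono)
    then show ?thesis by (simp add: pinner_inner p_def q_def)
  qed
qed

lemma normal_le: "(\<And>k. pinner n (X1 k x) = 0) \<Longrightarrow> pinner n n \<le> 0"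
  using normal_neg[of n x] by (cases "n = 0") (auto simp: pinner.zero_left)

text \<open>The form is negative on normal vectors, so two sign changes restore the usual
  inequality. As usual, \<open>s\<close> removes from \<open>b\<close> its component along
  \<open>n\<close>.\<close>

lemma normal_cauchy_schwarz:
  assumes "\<And>k. pinner n (X1 k x) = 0" "\<And>k. pinner b (X1 k x) = 0"
  shows "(pinner b n)\<^sup>2 \<le> pinner b b * pinner n n"
proof (cases "n = 0")
  case False
  define s where "s = pinner b n / pinner n n"
  have nn: "pinner n n < 0" using normal_neg[OF assms(1) False] .
  have "pinner (b - s *\<^sub>R n) (b - s *\<^sub>R n) \<le> 0"
    by (rule normal_le[of _ x]) (simp add: assms pinner.diff_left pinner.scaleR_left)
  then have "pinner b b - 2 * s * pinner b n + s * s * pinner n n \<le> 0"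
    by (simp add: pinner.diff_left pinner.diff_right pinner.scaleR_left pinner.scaleR_right 
        pinner_commute[of n b] algebra_simps)
  then have "pinner b b - (pinner b n)\<^sup>2 / pinner n n \<le> 0"
    using nn by (simp add: s_def power2_eq_square)
  then have "pinner b b * pinner n n - (pinner b n)\<^sup>2 \<ge> 0"
    using nn by (simp add: field_simps)
  then show ?thesis by simp
qed (simp add: pinner.zero_right)

section \<open>The metric, orthonormal frames and the pairing with the fixed plane\<close>

definition gm :: "real ^ 'm \<Rightarrow> real ^ 'm ^ 'm" where "gm x = (\<chi> i j. pinner (X1 i x) (X1 j x))"
definition G where "G x = cramer_inv (gm x)"
definition A :: "real ^ 'm \<Rightarrow> real ^ 'm ^ 'm" where "A x = (\<chi> i j. pinner (X1 i x) (a j))"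
definition Ai where "Ai x = cramer_inv (A x)"

text \<open>The rows are parameter vectors whose images under \<open>DX x\<close> form an orthonormal basis of the tangent space.\<close>

definition frame :: "real ^ 'm \<Rightarrow> real ^ 'm ^ 'm" where
  "frame x = (SOME C. \<forall>i j. pinner (DX x (C $ i)) (DX x (C $ j)) = (if i = j then 1 else 0))"

lemma frame: "pinner (DX x (frame x $ i)) (DX x (frame x $ j)) = (if i = j then 1 else 0)"
proof -
  obtain c :: "'m \<Rightarrow> real ^ 'm" where "\<forall>i j. pinner (DX x (c i)) (DX x (c j)) = (if i = j then 1 else 0)"
    using frame_ex[of x] unfolding DX_def X1_def by blast
  then have "\<exists>C :: real ^ 'm ^ 'm. \<forall>i j. pinner (DX x (C $ i)) (DX x (C $ j)) = (if i = j then 1 else 0)"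
    by (intro exI[of _ "vec_lambda c"]) simp
  from someI_ex[OF this] show ?thesis unfolding frame_def by blast
qed

lemma pinner_DX: "pinner (DX x v) (DX x w) = (\<Sum>i\<in>UNIV. \<Sum>j\<in>UNIV. v $ i * gm x $ i $ j * w $ j)"
  unfolding DX_def pinner.sum_left unfolding pinner.sum_right
  by (simp add: pinner.scaleR_left pinner.scaleR_right gm_def mult_ac)

text \<open>Orthonormality reads \<open>C ** gm x ** transpose C = mat 1\<close>. Determinants give
  positivity and the size of \<open>det C\<close>; cancelling factors gives
  \<open>transpose C ** C = G x\<close>.\<close>

lemma
  assumes "\<And>i j. pinner (DX x (C $ i)) (DX x (C $ j)) = (if i = j then 1 else 0)"
  shows det_gm_pos': "det (gm x) > 0"
    and G_orthonormal: "G x $ k $ l = (\<Sum>b\<in>UNIV. C $ b $ k * C $ b $ l)"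
    and abs_det_orthonormal: "\<bar>det C\<bar> = 1 / sqrt (det (gm x))"
proof -
  have "(C ** gm x ** transpose C) $ i $ j = pinner (DX x (C $ i)) (DX x (C $ j))" for i j
    by (subst pinner_DX, subst sum.swap) (simp add: matrix_matrix_mult_def transpose_def sum_distrib_right)
  then have mat: "C ** gm x ** transpose C = mat 1" by (simp add: vec_eq_iff assms mat_def)
  have dC: "(det C)\<^sup>2 * det (gm x) = 1"
    using arg_cong[OF mat, of det] by (simp add: det_mul power2_eq_square algebra_simps)
  then show pos: "det (gm x) > 0" by (smt (verit) mult_nonneg_nonpos zero_le_power2)
  then have nz: "det (gm x) \<noteq> 0" by simp
  have "C ** (gm x ** transpose C) = mat 1" using mat by (simp add: matrix_mul_assoc)
  then have "gm x ** transpose C ** C = mat 1" using matrix_left_right_inverse by blast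
  then have "G x ** (gm x ** (transpose C ** C)) = G x" by (simp add: matrix_mul_assoc)
  then have "transpose C ** C = G x"
    by (simp add: matrix_mul_assoc G_def cramer_inv_left[OF nz])
  then have "G x $ k $ l = (transpose C ** C) $ k $ l" by simp
  then show "G x $ k $ l = (\<Sum>b\<in>UNIV. C $ b $ k * C $ b $ l)"
    by (simp add: matrix_matrix_mult_def transpose_def)
  have "(det C)\<^sup>2 = 1 / det (gm x)" using dC nz by (simp add: field_simps)
  then have "sqrt ((det C)\<^sup>2) = 1 / sqrt (det (gm x))" by (simp add: real_sqrt_divide)
  then show "\<bar>det C\<bar> = 1 / sqrt (det (gm x))" by simp
qed

lemmas det_gm_pos = det_gm_pos'[OF frame]
  and G_frame = G_orthonormal[OF frame]

lemma det_gm: "det (gm x) \<noteq> 0" using det_gm_pos[of x] by simp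

lemma G_sym: "G x $ k $ l = G x $ l $ k"
  by (simp add: G_frame mult.commute)

lemma gm_sym: "gm x $ k $ l = gm x $ l $ k"
  by (simp add: gm_def pinner_commute)

text \<open>The adjoint of a contraction contracts: its value \<open>r\<close> at \<open>q\<close>
  is tested against the image of \<open>r\<close> under the differential of
  \<open>u\<close>.\<close>

lemma norm_adjoint_le: "norm (\<chi> i. u1 i x \<bullet> q) \<le> norm q"
proof -
  define r where "r = (\<chi> i. u1 i x \<bullet> q)"
  show ?thesis
  proof (cases "r = 0")
    case False
    have "norm r * norm r = r \<bullet> r" by (simp add: dot_square_norm power2_eq_square)
    also have "\<dots> = (\<Sum>i\<in>UNIV. r $ i *\<^sub>R u1 i x) \<bullet> q"
      by (subst inner_vec_def) (simp add: inner_sum_left r_def)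
    also have "\<dots> \<le> norm (\<Sum>i\<in>UNIV. r $ i *\<^sub>R u1 i x) * norm q" by (rule norm_cauchy_schwarz)
    also have "\<dots> \<le> norm r * norm q" using spacelike[OF False, of x] by (intro mult_right_mono) auto
    finally show ?thesis using False by (simp flip: r_def)
  qed (simp flip: r_def)
qed

text \<open>Chosen so that the two components of a vector of the plane with coordinates
  \<open>v\<close> have norms summing to at most \<open>norm v / \<kappa>\<close>. It is independent
  of the point of the graph.\<close>

definition \<kappa> where "\<kappa> = 1 / (1 + (\<Sum>j\<in>UNIV. norm (fst (a j)) + norm (snd (a j))))"

lemma \<kappa>_pos: "\<kappa> > 0"
  unfolding \<kappa>_def by (simp add: add_pos_nonneg sum_nonneg)

definition comb where "comb v = (\<Sum>j\<in>UNIV. v $ j *\<^sub>R a j)"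

lemma pinner_comb: "pinner (comb v) (comb v) = (norm v)\<^sup>2"
proof -
  have "pinner (comb v) (comb v) = (\<Sum>i\<in>UNIV. \<Sum>j\<in>UNIV. v $ i * (v $ j * (if i = j then 1 else 0)))"
    unfolding comb_def pinner.sum_left unfolding pinner.sum_right
    by (simp add: pinner.scaleR_left pinner.scaleR_right a_orth mult.left_commute)
  also have "\<dots> = v \<bullet> v" by (simp add: inner_vec_def if_distrib cong: if_cong)
  finally show ?thesis by (simp add: dot_square_norm)
qed

lemma A_comb: "(A x *v v) $ i = pinner (X1 i x) (comb v)"
  by (simp add: matrix_vector_mult_def A_def comb_def pinner.sum_right pinner.scaleR_right mult.commute)

text \<open>With \<open>comb v = (y, q)\<close>, the vector \<open>A x *v v\<close> is
  \<open>y\<close> minus the adjoint differential of \<open>u\<close> applied to \<open>q\<close>,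
  so its norm is at least \<open>|y| - |q|\<close>. Since \<open>|y|^2 - |q|^2 = |v|^2\<close> and
  \<open>|y| + |q|\<close> is at most \<open>|v| / \<kappa>\<close>, the difference is at least
  \<open>\<kappa> |v|\<close>.\<close>

lemma A_expanding: "norm (A x *v v) \<ge> \<kappa> * norm v"
proof (cases "v = 0")
  case False
  define y q where "y = fst (comb v)" and "q = snd (comb v)"
  have yq: "(norm y)\<^sup>2 - (norm q)\<^sup>2 = (norm v)\<^sup>2"
    using pinner_comb[of v] by (simp add: pinner_inner y_def q_def dot_square_norm)
  have "A x *v v = y - (\<chi> i. u1 i x \<bullet> q)"
    by (simp add: vec_eq_iff A_comb pinner_inner X1_def y_def q_def inner_axis')
  then have 1: "norm (A x *v v) \<ge> norm y - norm q"
    using norm_triangle_ineq2[of y "\<chi> i. u1 i x \<bullet> q"] norm_adjoint_le[of x q] by simp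
  have "norm y + norm q \<le> (\<Sum>j\<in>UNIV. norm v * (norm (fst (a j)) + norm (snd (a j))))"
  proof -
    have "norm y \<le> (\<Sum>j\<in>UNIV. norm v * norm (fst (a j)))" "norm q \<le> (\<Sum>j\<in>UNIV. norm v * norm (snd (a j)))"
      unfolding y_def q_def comb_def fst_sum snd_sum
      by (rule order_trans[OF norm_sum]; intro sum_mono; simp add: mult_right_mono component_le_norm_cart)+
    then show ?thesis by (simp add: distrib_left sum.distrib)
  qed
  also have "\<dots> \<le> norm v / \<kappa>"
    by (simp add: \<kappa>_def distrib_left sum.distrib sum_distrib_left)
  finally have 2: "norm y + norm q \<le> norm v / \<kappa>" .
  have "norm v * norm v = (norm y - norm q) * (norm y + norm q)"
    using yq by (simp add: power2_eq_square algebra_simps)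
  moreover have "norm v * norm v > 0" using False by simp
  ultimately have 3: "norm y - norm q > 0"
    by (smt (verit) norm_ge_zero mult_nonpos_nonneg)
  have "norm v * norm v \<le> (norm y - norm q) * (norm v / \<kappa>)"
    unfolding \<open>norm v * norm v = _\<close> using 2 3 by (intro mult_left_mono) auto
  then have "norm v * (\<kappa> * norm v) \<le> norm v * (norm y - norm q)"
    using \<kappa>_pos by (simp add: field_simps)
  then have "\<kappa> * norm v \<le> norm y - norm q" using False by simp
  then show ?thesis using 1 by simp
qed simp

lemma abs_det_A: "\<bar>det (A x)\<bar> \<ge> \<kappa> ^ CARD('m)"
  by (rule abs_det_expanding[OF \<kappa>_pos A_expanding])

lemma det_A: "det (A x) \<noteq> 0"
  using abs_det_A[of x] \<kappa>_pos by (metis abs_zero not_le zero_less_power)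

text \<open>Completeness follows from the fact that the frame reproduces the inverse metric; it is
  what allows coordinate and frame indices to be exchanged.\<close>

lemma frame_basis: "v = (\<Sum>b\<in>UNIV. pinner (DX x v) (DX x (frame x $ b)) *\<^sub>R frame x $ b)"
proof (subst vec_eq_iff, rule allI)
  fix k
  have "(\<Sum>b\<in>UNIV. pinner (DX x v) (DX x (frame x $ b)) *\<^sub>R frame x $ b) $ k
    = (\<Sum>b\<in>UNIV. \<Sum>i\<in>UNIV. \<Sum>j\<in>UNIV. v $ i * gm x $ i $ j * (frame x $ b $ j * frame x $ b $ k))"
    by (simp add: pinner_DX sum_distrib_right mult.assoc)
  also have "\<dots> = (\<Sum>i\<in>UNIV. \<Sum>b\<in>UNIV. \<Sum>j\<in>UNIV. v $ i * gm x $ i $ j * (frame x $ b $ j * frame x $ b $ k))"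
    by (rule sum.swap)
  also have "\<dots> = (\<Sum>i\<in>UNIV. \<Sum>j\<in>UNIV. v $ i * gm x $ i $ j * G x $ j $ k)"
    by (rule sum.cong[OF refl], subst sum.swap) (simp add: G_frame sum_distrib_left)
  also have "\<dots> = (\<Sum>i\<in>UNIV. v $ i * (\<Sum>j\<in>UNIV. gm x $ i $ j * G x $ j $ k))"
    by (simp add: sum_distrib_left mult.assoc)
  also have "\<dots> = v $ k"
    unfolding G_def sum_cramer_inv_right[OF det_gm] by (simp add: if_distrib cong: if_cong)
  finally show "v $ k = (\<Sum>b\<in>UNIV. pinner (DX x v) (DX x (frame x $ b)) *\<^sub>R frame x $ b) $ k" by simp
qed

lemma DX_sum: "DX x (\<Sum>b\<in>UNIV. s b *\<^sub>R c b) = (\<Sum>b\<in>UNIV. s b *\<^sub>R DX x (c b))"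
proof -
  have "DX x (\<Sum>b\<in>UNIV. s b *\<^sub>R c b) = (\<Sum>i\<in>UNIV. \<Sum>b\<in>UNIV. (s b * c b $ i) *\<^sub>R X1 i x)"
    by (simp add: DX_def scaleR_sum_left)
  also have "\<dots> = (\<Sum>b\<in>UNIV. \<Sum>i\<in>UNIV. (s b * c b $ i) *\<^sub>R X1 i x)" by (rule sum.swap)
  finally show ?thesis by (simp add: DX_def scaleR_sum_right)
qed

lemma DX_ax: "DX x (ax k) = X1 k x"
  unfolding DX_def by (subst sum.remove[of _ k]) (auto simp: axis_def intro!: sum.neutral)

lemma normal_frame:
  assumes "\<And>b. pinner n (DX x (frame x $ b)) = 0"
  shows "pinner n (X1 k x) = 0"
proof -
  have "pinner n (DX x (\<Sum>b\<in>UNIV. pinner (DX x (ax k)) (DX x (frame x $ b)) *\<^sub>R frame x $ b)) = 0"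
    unfolding DX_sum by (simp add: pinner.sum_right pinner.scaleR_right assms)
  then show ?thesis unfolding frame_basis[of "ax k" x, symmetric] by (simp only: DX_ax)
qed

text \<open>The product matrix represents the orthogonal projection from the plane spanned by
  \<open>a\<close> to the tangent space. The discarded normal part \<open>n\<close> has nonpositive
  square, so the projection does not shorten vectors. This is the source of
  \<open>w \<ge> 1\<close>.\<close>

lemma det_frame_A: "\<bar>det (frame x) * det (A x)\<bar> \<ge> 1"
proof -
  have M: "norm ((frame x ** A x) *v v) \<ge> 1 * norm v" for v
  proof -
    let ?E = "\<lambda>b. DX x (frame x $ b)"
    let ?p = "comb v"
    define n where "n = ?p - (\<Sum>b\<in>UNIV. pinner ?p (?E b) *\<^sub>R ?E b)"
    have ent: "((frame x ** A x) *v v) $ b = pinner ?p (?E b)" for b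
    proof -
      have "((frame x ** A x) *v v) $ b = (\<Sum>k\<in>UNIV. frame x $ b $ k * (A x *v v) $ k)"
        by (subst matrix_vector_mul_assoc[symmetric], subst matrix_vector_mult_def) simp
      then show ?thesis by (simp add: A_comb DX_def pinner.sum_right pinner.scaleR_right pinner_commute)
    qed
    have nE: "pinner n (?E b) = 0" for b
      by (simp add: n_def pinner.diff_left pinner.sum_left pinner.scaleR_left frame if_distrib cong: if_cong)
    then have "pinner n n \<le> 0" by (intro normal_le normal_frame)
    moreover have "pinner n n = pinner n ?p"
      by (subst (2) n_def) (simp add: pinner.diff_right pinner.sum_right pinner.scaleR_right nE)
    moreover have "pinner n ?p = pinner ?p ?p - (\<Sum>b\<in>UNIV. (pinner ?p (?E b))\<^sup>2)"
      by (simp add: n_def pinner.diff_left pinner.sum_left pinner.scaleR_left power2_eq_square pinner_commute[of "DX x _" "comb v"])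
    ultimately have "(norm v)\<^sup>2 \<le> (\<Sum>b\<in>UNIV. (pinner ?p (?E b))\<^sup>2)" by (simp add: pinner_comb)
    also have "\<dots> = (norm ((frame x ** A x) *v v))\<^sup>2"
      unfolding power2_norm_eq_inner inner_vec_def by (simp add: ent power2_eq_square)
    finally show ?thesis by (simp add: power2_le_iff_abs_le)
  qed
  from abs_det_expanding[of 1, OF _ M] show ?thesis by (simp add: det_mul)
qed

text \<open>The \<open>w\<close>-function in coordinates, with no choice of tangent basis, so that
  it can be differentiated; \<open>w_fun_eq\<close> makes the identification.\<close>

definition W where "W x = \<bar>det (A x)\<bar> / sqrt (det (gm x))"

lemma W_ge_1: "W x \<ge> 1"
  using det_frame_A[of x] by (simp add: W_def abs_mult abs_det_orthonormal[OF frame])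

text \<open>\<open>Xu\<close> is the basis of the tangent space dual to \<open>X1\<close>, and \<open>\<theta>\<close> is the basis of the plane spanned by \<open>a\<close>
  dual to \<open>X1\<close>; hence their difference \<open>N\<close> is normal. \<open>B\<close> is the second fundamental form.\<close>

definition \<theta> where "\<theta> i x = (\<Sum>j\<in>UNIV. Ai x $ j $ i *\<^sub>R a j)"
definition Xu where "Xu i x = (\<Sum>j\<in>UNIV. G x $ i $ j *\<^sub>R X1 j x)"
definition N where "N i x = \<theta> i x - Xu i x"
definition B where "B j l x = X2 j l x - (\<Sum>p\<in>UNIV. pinner (X2 j l x) (Xu p x) *\<^sub>R X1 p x)"

lemma gm_nth: "gm x $ i $ j = pinner (X1 i x) (X1 j x)"
  by (simp add: gm_def)

lemma A_nth: "A x $ i $ j = pinner (X1 i x) (a j)"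
  by (simp add: A_def)

lemma gm_G: "(\<Sum>k\<in>UNIV. gm x $ i $ k * G x $ k $ j) = (if i = j then 1 else 0)"
  unfolding G_def by (rule sum_cramer_inv_right[OF det_gm])

lemma A_Ai: "(\<Sum>k\<in>UNIV. A x $ i $ k * Ai x $ k $ j) = (if i = j then 1 else 0)"
  unfolding Ai_def by (rule sum_cramer_inv_right[OF det_A])

lemma pinner_X1_\<theta>: "pinner (X1 k x) (\<theta> i x) = (if k = i then 1 else 0)"
  using A_Ai[of x k i]
  by (simp add: \<theta>_def A_nth pinner.sum_right pinner.scaleR_right mult.commute)

lemma pinner_X1_Xu: "pinner (X1 k x) (Xu i x) = (if k = i then 1 else 0)"
  using gm_G[of x k i]
  by (simp add: Xu_def G_sym[of x i] gm_nth pinner.sum_right pinner.scaleR_right mult.commute)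

lemma N_normal: "pinner (N i x) (X1 k x) = 0"
  by (subst pinner_commute) (simp add: N_def pinner.diff_right pinner_X1_\<theta> pinner_X1_Xu)

lemma X1_Xu: "X1 k x = (\<Sum>p\<in>UNIV. gm x $ k $ p *\<^sub>R Xu p x)"
proof -
  have "(\<Sum>p\<in>UNIV. gm x $ k $ p *\<^sub>R Xu p x) = (\<Sum>p\<in>UNIV. \<Sum>j\<in>UNIV. (gm x $ k $ p * G x $ p $ j) *\<^sub>R X1 j x)"
    by (simp add: Xu_def scaleR_sum_right)
  also have "\<dots> = (\<Sum>j\<in>UNIV. (\<Sum>p\<in>UNIV. gm x $ k $ p * G x $ p $ j) *\<^sub>R X1 j x)"
    by (subst sum.swap) (simp add: scaleR_sum_left)
  also have "\<dots> = (\<Sum>j\<in>UNIV. (if k = j then X1 j x else 0))"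
    unfolding gm_G by (intro sum.cong) auto
  finally show ?thesis by simp
qed

lemma B_normal: "pinner (B j l x) (X1 k x) = 0"
proof -
  have "pinner (B j l x) (X1 k x) = pinner (X2 j l x) (X1 k x) - pinner (X2 j l x) (\<Sum>p\<in>UNIV. gm x $ k $ p *\<^sub>R Xu p x)"
    unfolding gm_sym[of x k]
    by (simp add: B_def pinner.diff_left pinner.sum_left pinner.scaleR_left pinner.sum_right pinner.scaleR_right
        gm_nth mult.commute)
  then show ?thesis by (simp flip: X1_Xu)
qed

lemma B_pinner:
  assumes "\<And>k. pinner (X1 k x) n = 0"
  shows "pinner (B j l x) n = pinner (X2 j l x) n"
  by (simp add: B_def pinner.diff_left pinner.sum_left pinner.scaleR_left assms)

section \<open>Derivatives of the dual bases, of \<open>ln w\<close> and of the weight\<close>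

lemma pd_gm: "has_pd (\<lambda>y. gm y $ i $ j) (pinner (X1 i x) (X2 j l x) + pinner (X2 i l x) (X1 j x)) x (ax l)"
  unfolding gm_nth by (intro has_pd_pinner pd_X1)

lemma pd_A: "has_pd (\<lambda>y. A y $ i $ j) (pinner (X2 i l x) (a j)) x (ax l)"
proof -
  have "has_pd (\<lambda>y. pinner (X1 i y) (a j)) (pinner (X1 i x) 0 + pinner (X2 i l x) (a j)) x (ax l)"
    by (intro has_pd_pinner pd_X1 has_pd_const)
  then show ?thesis by (simp add: A_nth pinner.zero_right)
qed

text \<open>This is \<open>- G gm' G\<close> after the tangent vectors in \<open>gm'\<close> have
  been contracted with \<open>G\<close>; only the Christoffel symbols, \<open>X2\<close> paired with
  \<open>Xu\<close>, remain.\<close>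

definition dG where "dG k l i x = - (\<Sum>p\<in>UNIV. G x $ k $ p * pinner (X2 p i x) (Xu l x))
   - (\<Sum>p\<in>UNIV. G x $ p $ l * pinner (X2 p i x) (Xu k x))"

lemma pd_G: "has_pd (\<lambda>y. G y $ k $ l) (dG k l i x) x (ax i)"
proof -
  have "has_pd (\<lambda>y. G y $ k $ l) (- (\<Sum>p\<in>UNIV. \<Sum>q\<in>UNIV. G x $ k $ p *
      (pinner (X1 p x) (X2 q i x) + pinner (X2 p i x) (X1 q x)) * G x $ q $ l)) x (ax i)"
    unfolding G_def by (rule has_pd_cramer_inv[OF pd_gm det_gm])
  moreover have "(\<Sum>p\<in>UNIV. \<Sum>q\<in>UNIV. G x $ k $ p *
      (pinner (X1 p x) (X2 q i x) + pinner (X2 p i x) (X1 q x)) * G x $ q $ l) = - dG k l i x"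
  proof -
    have 1: "(\<Sum>p\<in>UNIV. \<Sum>q\<in>UNIV. G x $ k $ p * pinner (X2 p i x) (X1 q x) * G x $ q $ l)
       = (\<Sum>p\<in>UNIV. G x $ k $ p * pinner (X2 p i x) (Xu l x))"
      by (simp add: Xu_def pinner.sum_right pinner.scaleR_right sum_distrib_left G_sym[of x l] mult_ac)
    have 2: "(\<Sum>p\<in>UNIV. \<Sum>q\<in>UNIV. G x $ k $ p * pinner (X1 p x) (X2 q i x) * G x $ q $ l)
       = (\<Sum>p\<in>UNIV. G x $ p $ l * pinner (X2 p i x) (Xu k x))"
      by (subst sum.swap) (simp add: Xu_def pinner.sum_right pinner.scaleR_right sum_distrib_left mult_ac 
          pinner_commute[of "X1 _ x"])
    show ?thesis unfolding distrib_left distrib_right sum.distrib 1 2 dG_def by simp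
  qed
  ultimately show ?thesis by simp
qed

lemma pd_\<theta>: "has_pd (\<theta> i) (- (\<Sum>p\<in>UNIV. pinner (X2 p l x) (\<theta> i x) *\<^sub>R \<theta> p x)) x (ax l)"
proof -
  define d where "d j = - (\<Sum>p\<in>UNIV. \<Sum>q\<in>UNIV. Ai x $ j $ p * pinner (X2 p l x) (a q) * Ai x $ q $ i)" for j
  have "has_pd (\<lambda>y. Ai y $ j $ i) (d j) x (ax l)" for j
    unfolding Ai_def d_def by (rule has_pd_cramer_inv[OF pd_A det_A])
  then have "has_pd (\<theta> i) (\<Sum>j\<in>UNIV. Ai x $ j $ i *\<^sub>R 0 + d j *\<^sub>R a j) x (ax l)"
    unfolding \<theta>_def[abs_def] by (intro has_pd_sum has_pd_scaleR has_pd_const)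
  moreover have "(\<Sum>j\<in>UNIV. d j *\<^sub>R a j) = - (\<Sum>p\<in>UNIV. pinner (X2 p l x) (\<theta> i x) *\<^sub>R \<theta> p x)"
  proof -
    have "d j = - (\<Sum>p\<in>UNIV. Ai x $ j $ p * pinner (X2 p l x) (\<theta> i x))" for j
      by (simp add: d_def \<theta>_def pinner.sum_right pinner.scaleR_right sum_distrib_left mult_ac)
    then have "(\<Sum>j\<in>UNIV. d j *\<^sub>R a j) = - (\<Sum>j\<in>UNIV. \<Sum>p\<in>UNIV. (Ai x $ j $ p * pinner (X2 p l x) (\<theta> i x)) *\<^sub>R a j)"
      by (simp add: scaleR_sum_left sum_negf)
    also have "\<dots> = - (\<Sum>p\<in>UNIV. \<Sum>j\<in>UNIV. (Ai x $ j $ p * pinner (X2 p l x) (\<theta> i x)) *\<^sub>R a j)"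
      by (subst sum.swap) simp
    finally show ?thesis by (simp add: \<theta>_def[of _ x] scaleR_sum_right mult.commute)
  qed
  ultimately show ?thesis by simp
qed

text \<open>The formula differs from \<open>pd_\<theta>\<close> by its normal last term: the plane
  containing the \<theta> is constant, whereas the tangent space turns at a rate given by
  \<open>B\<close>.\<close>

lemma pd_Xu: "has_pd (Xu i) (- (\<Sum>p\<in>UNIV. pinner (X2 p l x) (Xu i x) *\<^sub>R Xu p x)
    + (\<Sum>j\<in>UNIV. G x $ i $ j *\<^sub>R B j l x)) x (ax l)"
proof -
  have "has_pd (Xu i) (\<Sum>j\<in>UNIV. G x $ i $ j *\<^sub>R X2 j l x + dG i j l x *\<^sub>R X1 j x) x (ax l)"
    unfolding Xu_def[abs_def] by (intro has_pd_sum has_pd_scaleR pd_G pd_X1)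
  moreover have "(\<Sum>j\<in>UNIV. dG i j l x *\<^sub>R X1 j x) =
    - (\<Sum>j\<in>UNIV. G x $ i $ j *\<^sub>R (\<Sum>p\<in>UNIV. pinner (X2 j l x) (Xu p x) *\<^sub>R X1 p x))
    - (\<Sum>p\<in>UNIV. pinner (X2 p l x) (Xu i x) *\<^sub>R Xu p x)"
  proof -
    have 1: "(\<Sum>j\<in>UNIV. \<Sum>p\<in>UNIV. (G x $ i $ p * pinner (X2 p l x) (Xu j x)) *\<^sub>R X1 j x)
      = (\<Sum>j\<in>UNIV. G x $ i $ j *\<^sub>R (\<Sum>p\<in>UNIV. pinner (X2 j l x) (Xu p x) *\<^sub>R X1 p x))"
      by (subst sum.swap) (simp add: scaleR_sum_right)
    have 2: "(\<Sum>j\<in>UNIV. \<Sum>p\<in>UNIV. (G x $ p $ j * pinner (X2 p l x) (Xu i x)) *\<^sub>R X1 j x)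
      = (\<Sum>p\<in>UNIV. pinner (X2 p l x) (Xu i x) *\<^sub>R Xu p x)"
      by (subst sum.swap) (simp add: Xu_def[of _ x] scaleR_sum_right mult.commute)
    show ?thesis
      by (simp add: dG_def scaleR_diff_left scaleR_minus_left scaleR_sum_left sum_subtractf sum_negf 1 2)
  qed
  ultimately show ?thesis
    by (simp add: B_def sum.distrib scaleR_diff_right sum_subtractf algebra_simps)
qed

definition dN where "dN i l x = - (\<Sum>p\<in>UNIV. pinner (X2 p l x) (\<theta> i x) *\<^sub>R \<theta> p x)
   + (\<Sum>p\<in>UNIV. pinner (X2 p l x) (Xu i x) *\<^sub>R Xu p x) - (\<Sum>j\<in>UNIV. G x $ i $ j *\<^sub>R B j l x)"

lemma pd_N: "has_pd (N i) (dN i l x) x (ax l)"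
  using has_pd_diff[OF pd_\<theta>[where i=i and l=l and x=x] pd_Xu[where i=i and l=l and x=x]] unfolding N_def[abs_def] dN_def by (simp add: algebra_simps)

text \<open>The partial derivatives of \<open>ln w\<close> see only the normal fields \<open>N\<close>, because by Jacobi's formula both
  \<open>ln (det A)\<close> and \<open>ln (det gm) / 2\<close> have traces as derivatives, in the dual bases \<open>\<theta>\<close> and \<open>Xu\<close>.\<close>

definition f where "f x = ln (W x)"
definition f1 where "f1 k x = (\<Sum>i\<in>UNIV. pinner (X2 i k x) (N i x))"
definition f2 where "f2 k l x = (\<Sum>i\<in>UNIV. pinner (X2 i k x) (dN i l x) + pinner (X3 i k l x) (N i x))"

text \<open>Squaring the determinant removes the absolute value, so differentiation needs no
  distinction by sign.\<close>

lemma f_eq: "f x = ln ((det (A x))\<^sup>2) / 2 - ln (det (gm x)) / 2"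
proof -
  have "ln (W x) = ln \<bar>det (A x)\<bar> - ln (det (gm x)) / 2"
    using det_A[of x] det_gm_pos[of x] by (simp add: W_def ln_div ln_sqrt)
  moreover have "ln ((det (A x))\<^sup>2) = 2 * ln \<bar>det (A x)\<bar>"
    using ln_realpow[of "\<bar>det (A x)\<bar>" 2] det_A[of x] by simp
  ultimately show ?thesis by (simp add: f_def)
qed

lemma pd_det_gm: "has_pd (\<lambda>y. det (gm y)) (2 * (\<Sum>i\<in>UNIV. pinner (X2 i l x) (Xu i x)) * det (gm x)) x (ax l)"
proof -
  have 1: "(\<Sum>i\<in>UNIV. \<Sum>j\<in>UNIV. pinner (X2 i l x) (X1 j x) * G x $ j $ i) = (\<Sum>i\<in>UNIV. pinner (X2 i l x) (Xu i x))"
    by (simp add: Xu_def pinner.sum_right pinner.scaleR_right G_sym mult.commute)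
  have 2: "(\<Sum>i\<in>UNIV. \<Sum>j\<in>UNIV. pinner (X1 i x) (X2 j l x) * G x $ j $ i) = (\<Sum>i\<in>UNIV. pinner (X2 i l x) (Xu i x))"
    by (subst sum.swap) (simp add: Xu_def pinner.sum_right pinner.scaleR_right mult.commute pinner_commute)
  have "(\<Sum>i\<in>UNIV. \<Sum>j\<in>UNIV. (pinner (X1 i x) (X2 j l x) + pinner (X2 i l x) (X1 j x)) * G x $ j $ i)
    = 2 * (\<Sum>i\<in>UNIV. pinner (X2 i l x) (Xu i x))"
    unfolding distrib_right sum.distrib 1 2 by simp
  then show ?thesis using has_pd_det[where M=gm and x=x, OF pd_gm[where l=l] det_gm] by (simp add: G_def)
qed

lemma pd_det_A: "has_pd (\<lambda>y. det (A y)) ((\<Sum>i\<in>UNIV. pinner (X2 i l x) (\<theta> i x)) * det (A x)) x (ax l)"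
  using has_pd_det[where M=A and x=x, OF pd_A[where l=l] det_A]
  by (simp add: \<theta>_def Ai_def pinner.sum_right pinner.scaleR_right mult.commute)

lemma pd_f: "has_pd f (f1 l x) x (ax l)"
proof -
  have 1: "has_pd (\<lambda>y. ln ((det (A y))\<^sup>2))
    (1 / (det (A x))\<^sup>2 * (2 * det (A x) * ((\<Sum>i\<in>UNIV. pinner (X2 i l x) (\<theta> i x)) * det (A x)))) x (ax l)"
    using det_A[of x] by (intro has_pd_compose[where g=ln] has_pd_power2 pd_det_A) (auto intro!: derivative_eq_intros)
  have 2: "has_pd (\<lambda>y. ln (det (gm y))) (1 / det (gm x) * (2 * (\<Sum>i\<in>UNIV. pinner (X2 i l x) (Xu i x)) * det (gm x))) x (ax l)"
    using det_gm_pos[of x] by (intro has_pd_compose[where g=ln] pd_det_gm) (auto intro!: derivative_eq_intros)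
  have "has_pd f (2 * (\<Sum>i\<in>UNIV. pinner (X2 i l x) (\<theta> i x)) / 2 - 2 * (\<Sum>i\<in>UNIV. pinner (X2 i l x) (Xu i x)) / 2) x (ax l)"
    unfolding f_eq[abs_def] 
    using has_pd_diff[OF has_pd_linear[OF bounded_linear_divide 1, of 2] has_pd_linear[OF bounded_linear_divide 2, of 2]]
      det_A[of x] det_gm[of x] by (simp add: power2_eq_square)
  then show ?thesis by (simp add: f1_def N_def pinner.diff_right sum_subtractf)
qed

lemma pd_f1: "has_pd (f1 k) (f2 k l x) x (ax l)"
  unfolding f1_def[abs_def] f2_def by (intro has_pd_sum has_pd_pinner pd_X2 pd_N)

definition \<rho> where "\<rho> x = sqrt (det (gm x)) * exp (- pinner (X x) (X x) / 4)"

lemma \<rho>_pos: "\<rho> x > 0" using det_gm_pos[of x] by (simp add: \<rho>_def)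

definition d\<rho> where "d\<rho> l x = \<rho> x * ((\<Sum>i\<in>UNIV. pinner (X2 i l x) (Xu i x)) - pinner (X x) (X1 l x) / 2)"

lemma pd_\<rho>: "has_pd \<rho> (d\<rho> l x) x (ax l)"
proof -
  have 1: "has_pd (\<lambda>y. sqrt (det (gm y))) (inverse (sqrt (det (gm x))) / 2 * (2 * (\<Sum>i\<in>UNIV. pinner (X2 i l x) (Xu i x)) * det (gm x))) x (ax l)"
    using det_gm_pos[of x] by (intro has_pd_compose[where g=sqrt] pd_det_gm DERIV_real_sqrt)
  have 2: "has_pd (\<lambda>y. exp (- pinner (X y) (X y) / 4)) (exp (- pinner (X x) (X x) / 4) * ((-1/4) * (pinner (X x) (X1 l x) + pinner (X1 l x) (X x)))) x (ax l)"
    using has_pd_compose[OF has_pd_linear[OF bounded_linear_mult_right has_pd_pinner[OF pd_X pd_X], of "-1/4" x l], of exp] DERIV_exp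
    by simp
  have e: "inverse (sqrt (det (gm x))) / 2 * (2 * s * det (gm x)) = s * sqrt (det (gm x))" for s
  proof -
    have "det (gm x) = sqrt (det (gm x)) * sqrt (det (gm x))" using det_gm_pos[of x] by simp
    then show ?thesis using det_gm_pos[of x] by (simp add: field_simps)
  qed
  show ?thesis using has_pd_mult[OF 1[unfolded e] 2]
    unfolding \<rho>_def[abs_def] d\<rho>_def by (simp add: algebra_simps pinner_commute)
qed

section \<open>Continuity of the coefficients\<close>

lemma cont_gm[continuous_intros]: "continuous_on UNIV (\<lambda>x. gm x $ i $ j)"
  and cont_A[continuous_intros]: "continuous_on UNIV (\<lambda>x. A x $ i $ j)"
  unfolding gm_nth A_nth by (intro continuous_intros)+

lemma cont_G[continuous_intros]: "continuous_on UNIV (\<lambda>x. G x $ i $ j)"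
  and cont_Ai[continuous_intros]: "continuous_on UNIV (\<lambda>x. Ai x $ i $ j)"
  unfolding G_def Ai_def by (intro continuous_on_cramer_inv cont_gm cont_A det_gm det_A)+

lemma cont_\<theta>[continuous_intros]: "continuous_on UNIV (\<theta> i)"
  and cont_Xu[continuous_intros]: "continuous_on UNIV (Xu i)"
  unfolding \<theta>_def[abs_def] Xu_def[abs_def] by (intro continuous_intros)+

lemma cont_N[continuous_intros]: "continuous_on UNIV (N i)"
  and cont_B[continuous_intros]: "continuous_on UNIV (B i j)"
  unfolding N_def[abs_def] B_def[abs_def] by (intro continuous_intros)+

lemma cont_dN[continuous_intros]: "continuous_on UNIV (dN i j)"
  unfolding dN_def[abs_def] by (intro continuous_intros)

lemma cont_f1[continuous_intros]: "continuous_on UNIV (f1 i)"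
  and cont_f2[continuous_intros]: "continuous_on UNIV (f2 i j)"
  unfolding f1_def[abs_def] f2_def[abs_def] by (intro continuous_intros)+

lemma cont_W[continuous_intros]: "continuous_on UNIV W"
  unfolding W_def[abs_def] by (intro continuous_intros continuous_on_det) (use det_gm in auto)

lemma cont_f[continuous_intros]: "continuous_on UNIV f"
  unfolding f_def[abs_def] using W_ge_1 by (intro continuous_intros) (smt (verit))

lemma cont_\<rho>[continuous_intros]: "continuous_on UNIV \<rho>"
  unfolding \<rho>_def[abs_def] by (intro continuous_intros continuous_on_det) auto

lemma cont_dG[continuous_intros]: "continuous_on UNIV (dG i j k)"
  and cont_d\<rho>[continuous_intros]: "continuous_on UNIV (d\<rho> i)"
  unfolding dG_def[abs_def] d\<rho>_def[abs_def] by (intro continuous_intros; simp)+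

text \<open>Over the tangent space, the plane spanned by \<open>a\<close> is the graph of the linear
  map that sends the frame vector with index \<open>b\<close> to \<open>Nf b x\<close>.\<close>

definition Nf where "Nf b x = (\<Sum>i\<in>UNIV. pinner (X1 i x) (DX x (frame x $ b)) *\<^sub>R N i x)"

lemma N_Nf: "N i x = (\<Sum>b\<in>UNIV. frame x $ b $ i *\<^sub>R Nf b x)"
proof -
  have e: "(\<Sum>b\<in>UNIV. frame x $ b $ i * pinner (X1 k x) (DX x (frame x $ b))) = (if i = k then 1 else 0)" for k
  proof -
    have "ax k $ i = (\<Sum>b\<in>UNIV. frame x $ b $ i * pinner (X1 k x) (DX x (frame x $ b)))"
      using arg_cong[OF frame_basis[of "ax k" x], of "\<lambda>v. v $ i"] by (simp add: DX_ax mult.commute)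
    then show ?thesis by (simp add: axis_def)
  qed
  have "(\<Sum>b\<in>UNIV. frame x $ b $ i *\<^sub>R Nf b x)
    = (\<Sum>k\<in>UNIV. \<Sum>b\<in>UNIV. (frame x $ b $ i * pinner (X1 k x) (DX x (frame x $ b))) *\<^sub>R N k x)"
    by (subst sum.swap) (simp add: Nf_def scaleR_sum_right)
  also have "\<dots> = (\<Sum>k\<in>UNIV. if i = k then N k x else 0)"
    unfolding scaleR_sum_left[symmetric] e by (intro sum.cong) auto
  finally show ?thesis by simp
qed

lemma Nf_normal: "pinner (Nf b x) (X1 k x) = 0"
  by (simp add: Nf_def pinner.sum_left pinner.scaleR_left N_normal)

text \<open>With \<open>E\<^sub>b\<close> the tangent frame, the vector \<open>\<Sum>\<tau>\<^sub>b (E\<^sub>b + Nf\<^sub>b)\<close> lies in the spacelike plane spanned by \<open>a\<close>,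
  so its square, which is the difference of the two sides, is positive.\<close>

lemma Nf_slope:
  fixes \<tau> :: "'m \<Rightarrow> real" and x
  defines "v \<equiv> \<Sum>b\<in>UNIV. \<tau> b *\<^sub>R Nf b x"
  shows "- pinner v v \<le> (\<Sum>b\<in>UNIV. (\<tau> b)\<^sup>2)"
    and "\<tau> c \<noteq> 0 \<Longrightarrow> - pinner v v < (\<Sum>b\<in>UNIV. (\<tau> b)\<^sup>2)"
proof -
  define E where "E = (\<Sum>b\<in>UNIV. \<tau> b *\<^sub>R DX x (frame x $ b))"
  \<comment> \<open>The coordinates, in the basis \<open>a\<close>, of the vector of the plane lying
    over \<open>E\<close>, obtained by expanding in the dual basis \<theta>.\<close>
  define w where "w = (\<chi> j. \<Sum>i\<in>UNIV. pinner (X1 i x) E * Ai x $ j $ i)"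
  have Eb: "pinner E (DX x (frame x $ b)) = \<tau> b" for b
    by (simp add: E_def pinner.sum_left pinner.scaleR_left frame if_distrib cong: if_cong)
  have EE: "pinner E E = (\<Sum>b\<in>UNIV. (\<tau> b)\<^sup>2)"
    by (subst (2) E_def) (simp add: pinner.sum_right pinner.scaleR_right Eb power2_eq_square)
  have nv: "pinner v (X1 k x) = 0" for k
    by (simp add: v_def pinner.sum_left pinner.scaleR_left Nf_normal)
  then have vD: "pinner v (DX x c) = 0" for c
    by (simp add: DX_def pinner.sum_right pinner.scaleR_right)
  have vE: "pinner v E = 0"
    by (simp add: E_def pinner.sum_right pinner.scaleR_right vD)
  have s: "(\<Sum>b\<in>UNIV. \<tau> b * pinner (X1 i x) (DX x (frame x $ b))) = pinner (X1 i x) E" for i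
    by (simp add: E_def pinner.sum_right pinner.scaleR_right)
  have "v = (\<Sum>i\<in>UNIV. pinner (X1 i x) E *\<^sub>R N i x)"
    unfolding v_def Nf_def scaleR_sum_right
    by (subst sum.swap) (simp add: s[symmetric] scaleR_sum_left)
  moreover have "(\<Sum>i\<in>UNIV. pinner (X1 i x) E *\<^sub>R Xu i x) = E"
  proof -
    define e where "e = (\<Sum>b\<in>UNIV. \<tau> b *\<^sub>R frame x $ b)"
    have ED: "E = (\<Sum>k\<in>UNIV. e $ k *\<^sub>R X1 k x)"
      unfolding DX_def[symmetric] E_def e_def DX_sum ..
    have "(\<Sum>i\<in>UNIV. pinner (X1 i x) E *\<^sub>R Xu i x) = (\<Sum>i\<in>UNIV. \<Sum>k\<in>UNIV. (e $ k * gm x $ k $ i) *\<^sub>R Xu i x)"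
      by (simp add: ED pinner.sum_right pinner.scaleR_right gm_nth scaleR_sum_left pinner_commute)
    also have "\<dots> = (\<Sum>k\<in>UNIV. e $ k *\<^sub>R X1 k x)"
      by (subst sum.swap) (simp add: X1_Xu[of _ x] scaleR_sum_right)
    finally show ?thesis using ED by simp
  qed
  moreover have "(\<Sum>i\<in>UNIV. pinner (X1 i x) E *\<^sub>R \<theta> i x) = comb w"
  proof -
    have "comb w = (\<Sum>j\<in>UNIV. \<Sum>i\<in>UNIV. (pinner (X1 i x) E * Ai x $ j $ i) *\<^sub>R a j)"
      by (simp add: comb_def w_def scaleR_sum_left)
    then show ?thesis by (subst (asm) sum.swap) (simp add: \<theta>_def scaleR_sum_right)
  qed
  ultimately have vw: "v = comb w - E"
    by (simp add: N_def scaleR_diff_right sum_subtractf)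
  have "comb w = v + E" using vw by simp
  then have "(norm w)\<^sup>2 = pinner v v + (\<Sum>b\<in>UNIV. (\<tau> b)\<^sup>2)"
    unfolding pinner_comb[symmetric] by (simp add: pinner.add_left pinner.add_right EE vE pinner_commute[of E v])
  then have nn: "(\<Sum>b\<in>UNIV. (\<tau> b)\<^sup>2) = - pinner v v + (norm w)\<^sup>2" by simp
  then show "- pinner v v \<le> (\<Sum>b\<in>UNIV. (\<tau> b)\<^sup>2)" by simp
  assume "\<tau> c \<noteq> 0"
  \<comment> \<open>Otherwise the normal vector \<open>v\<close> would equal the nonzero tangent
    vector \<open>- E\<close>.\<close>
  have "w \<noteq> 0"
  proof
    assume "w = 0"
    then have "v = - E" using vw by (simp add: comb_def)
    then have "pinner v (DX x (frame x $ c)) = - \<tau> c" using Eb[of c] by (simp add: pinner.minus_left)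
    then show False using vD \<open>\<tau> c \<noteq> 0\<close> by simp
  qed
  then show "- pinner v v < (\<Sum>b\<in>UNIV. (\<tau> b)\<^sup>2)" using nn by simp
qed

text \<open>The adjoint form of the slope bound. With \<open>T\<close> the left side and
  \<open>v\<close> the image of the coefficients \<tau>, Cauchy-Schwarz and \<open>Nf_slope\<close>
  bound \<open>T * T\<close> by \<open>- pinner n n\<close> times \<open>T\<close>; dividing by
  \<open>T\<close> finishes, strictly because the slope bound is strict.\<close>

lemma normal_Nf_le:
  assumes n: "\<And>k. pinner n (X1 k x) = 0"
  shows "(\<Sum>b\<in>UNIV. (pinner n (Nf b x))\<^sup>2) \<le> - pinner n n"
    and "n \<noteq> 0 \<Longrightarrow> (\<Sum>b\<in>UNIV. (pinner n (Nf b x))\<^sup>2) < - pinner n n"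
proof -
  define \<tau> v T where "\<tau> b = pinner n (Nf b x)" and "v = (\<Sum>b\<in>UNIV. \<tau> b *\<^sub>R Nf b x)" and "T = (\<Sum>b\<in>UNIV. (\<tau> b)\<^sup>2)" for b
  have nv: "pinner n v = T"
    by (simp add: v_def pinner.sum_right pinner.scaleR_right T_def \<tau>_def power2_eq_square)
  have "pinner v (X1 k x) = 0" for k
    by (simp add: v_def pinner.sum_left pinner.scaleR_left Nf_normal)
  then have cs: "T\<^sup>2 \<le> (- pinner n n) * (- pinner v v)"
    using normal_cauchy_schwarz[of v x n] n by (simp add: nv)
  have nn: "- pinner n n \<ge> 0" using normal_le[OF n] by simp
  have "T < - pinner n n" if "T \<noteq> 0"
  proof -
    from that obtain c where "\<tau> c \<noteq> 0" unfolding T_def by (metis sum.neutral power_zero_numeral)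
    then have V: "- pinner v v < T" unfolding T_def v_def by (rule Nf_slope(2))
    have T: "T > 0" using that unfolding T_def by (metis sum_nonneg zero_le_power2 less_eq_real_def)
    have "T * T > 0" using T by simp
    then have "- pinner n n \<noteq> 0" using cs by (auto simp: power2_eq_square)
    then have "(- pinner n n) * (- pinner v v) < (- pinner n n) * T"
      using V nn by (intro mult_strict_left_mono) auto
    then have "T * T < (- pinner n n) * T" using cs by (simp add: power2_eq_square)
    then show ?thesis by (rule mult_right_less_imp_less) (use T in simp)
  qed
  moreover have "n \<noteq> 0 \<Longrightarrow> - pinner n n > 0" using normal_neg[OF n] by simp
  ultimately have "T \<le> - pinner n n" "n \<noteq> 0 \<Longrightarrow> T < - pinner n n"
    using nn by (cases "T = 0"; simp)+
  then show "(\<Sum>b\<in>UNIV. (pinner n (Nf b x))\<^sup>2) \<le> - pinner n n"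
    and "n \<noteq> 0 \<Longrightarrow> (\<Sum>b\<in>UNIV. (pinner n (Nf b x))\<^sup>2) < - pinner n n"
    unfolding T_def \<tau>_def by auto
qed

end

section \<open>The drift Laplacian of the logarithm of w\<close>

text \<open>The condition on the normal parts determines its two sides modulo tangent vectors.
  Requiring the horizontal component to vanish fixes this freedom and leaves the equation
  \<open>pde\<close> for \<open>u\<close>.\<close>

locale self_shrinker_graph = spacelike_c3_graph u u1 u2 u3 a
  for u :: "real ^ 'm::finite \<Rightarrow> real ^ 'n::finite" and u1 u2 u3 a +
  assumes pde: "\<And>x. (\<Sum>k\<in>UNIV. \<Sum>l\<in>UNIV. G x $ k $ l *\<^sub>R u2 k l x) = (1/2) *\<^sub>R ((\<Sum>p\<in>UNIV. x $ p *\<^sub>R u1 p x) - u x)"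
begin

lemma pde_X: "(\<Sum>k\<in>UNIV. \<Sum>l\<in>UNIV. G x $ k $ l *\<^sub>R X2 k l x) = (1/2) *\<^sub>R (DX x x - X x)"
  using pde[of x] by (simp add: prod_eq_iff X2_def DX_Pair X_def fst_sum snd_sum)

lemma pinner_DX_Xu: "pinner (DX x v) (Xu j x) = v $ j"
  by (simp add: DX_def pinner.sum_left pinner.scaleR_left pinner_X1_Xu if_distrib cong: if_cong)

text \<open>The weighted inverse metric. Its derivative is recorded only in the direction of the
  first index, as the divergence requires.\<close>

definition \<Phi> where "\<Phi> i j x = \<rho> x * G x $ i $ j"
definition d\<Phi> where "d\<Phi> i j x = \<rho> x * dG i j i x + d\<rho> i x * G x $ i $ j"

lemma pd_\<Phi>: "has_pd (\<Phi> i j) (d\<Phi> i j x) x (ax i)"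
  unfolding \<Phi>_def[abs_def] d\<Phi>_def by (intro has_pd_mult pd_\<rho> pd_G)

text \<open>Self-adjointness of the drift Laplacian \<open>G\<^sub>k\<^sub>l \<partial>\<^sub>k \<partial>\<^sub>l - x \<sqdot> D / 2\<close> with respect to the weight \<open>\<rho>\<close>:
  its drift is produced by the tangential part of the self-shrinker equation.\<close>

lemma div_\<Phi>: "(\<Sum>i\<in>UNIV. d\<Phi> i j x) = - \<rho> x * x $ j / 2"
proof -
  have 1: "(\<Sum>i\<in>UNIV. (\<Sum>k\<in>UNIV. pinner (X2 k i x) (Xu k x)) * G x $ i $ j)
    = (\<Sum>i\<in>UNIV. \<Sum>p\<in>UNIV. G x $ p $ j * pinner (X2 p i x) (Xu i x))"
    by (simp add: sum_distrib_right, subst sum.swap) (simp add: X2_sym mult.commute)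
  have 2: "(\<Sum>i\<in>UNIV. pinner (X x) (X1 i x) * G x $ i $ j) = pinner (X x) (Xu j x)"
    by (simp add: Xu_def pinner.sum_right pinner.scaleR_right G_sym[of x j] mult.commute)
  have 3: "(\<Sum>i\<in>UNIV. \<Sum>p\<in>UNIV. G x $ i $ p * pinner (X2 p i x) (Xu j x)) = (x $ j - pinner (X x) (Xu j x)) / 2"
  proof -
    have "(\<Sum>i\<in>UNIV. \<Sum>p\<in>UNIV. G x $ i $ p * pinner (X2 p i x) (Xu j x))
      = pinner (\<Sum>i\<in>UNIV. \<Sum>p\<in>UNIV. G x $ i $ p *\<^sub>R X2 i p x) (Xu j x)"
      by (simp add: pinner.sum_left pinner.scaleR_left X2_sym)
    then show ?thesis by (simp add: pde_X pinner.scaleR_left pinner.diff_left pinner_DX_Xu)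
  qed
  \<comment> \<open>By (1), the derivative of the volume density cancels one half of
    \<open>dG\<close>. By (3), the other half is the equation paired with \<open>Xu\<close>, whose
    position term cancels the one from the Gaussian factor in (2).\<close>
  have "(\<Sum>i\<in>UNIV. d\<Phi> i j x) = \<rho> x * ((\<Sum>i\<in>UNIV. (\<Sum>k\<in>UNIV. pinner (X2 k i x) (Xu k x)) * G x $ i $ j)
     - (\<Sum>i\<in>UNIV. pinner (X x) (X1 i x) * G x $ i $ j) / 2
     - (\<Sum>i\<in>UNIV. \<Sum>p\<in>UNIV. G x $ i $ p * pinner (X2 p i x) (Xu j x))
     - (\<Sum>i\<in>UNIV. \<Sum>p\<in>UNIV. G x $ p $ j * pinner (X2 p i x) (Xu i x)))"
    unfolding d\<Phi>_def dG_def d\<rho>_def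
    by (simp add: sum.distrib sum_subtractf sum_negf algebra_simps sum_distrib_left sum_divide_distrib)
  then show ?thesis unfolding 1 2 3 by (simp add: algebra_simps diff_divide_distrib)
qed

text \<open>The source of all third-order information. On the right, differentiating the
  coefficients of \<open>DX x x\<close> yields \<open>X1 i x\<close>, which cancels the derivative
  of the position vector.\<close>

lemma pde_diff: "(\<Sum>k\<in>UNIV. \<Sum>l\<in>UNIV. G x $ k $ l *\<^sub>R X3 k l i x + dG k l i x *\<^sub>R X2 k l x)
   = (1/2) *\<^sub>R (\<Sum>p\<in>UNIV. x $ p *\<^sub>R X2 p i x)"
proof -
  have 1: "has_pd (\<lambda>y. \<Sum>k\<in>UNIV. \<Sum>l\<in>UNIV. G y $ k $ l *\<^sub>R X2 k l y)
     (\<Sum>k\<in>UNIV. \<Sum>l\<in>UNIV. G x $ k $ l *\<^sub>R X3 k l i x + dG k l i x *\<^sub>R X2 k l x) x (ax i)"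
    by (intro has_pd_sum has_pd_scaleR pd_G pd_X2)
  have "has_pd (\<lambda>y. y $ p) (ax i $ p) x (ax i)" for p
    using has_pd_linear[OF bounded_linear_vec_nth has_pd_id] .
  then have "has_pd (\<lambda>y. (1/2) *\<^sub>R ((\<Sum>p\<in>UNIV. y $ p *\<^sub>R X1 p y) - X y))
     ((1/2) *\<^sub>R ((\<Sum>p\<in>UNIV. x $ p *\<^sub>R X2 p i x + ax i $ p *\<^sub>R X1 p x) - X1 i x)) x (ax i)"
    by (intro has_pd_linear[OF bounded_linear_scaleR_right] has_pd_diff has_pd_sum has_pd_scaleR pd_X1 pd_X)
  moreover have "(\<Sum>p\<in>UNIV. ax i $ p *\<^sub>R X1 p x) = X1 i x"
    using DX_ax[of x i] by (simp add: DX_def)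
  ultimately have "has_pd (\<lambda>y. \<Sum>k\<in>UNIV. \<Sum>l\<in>UNIV. G y $ k $ l *\<^sub>R X2 k l y)
     ((1/2) *\<^sub>R (\<Sum>p\<in>UNIV. x $ p *\<^sub>R X2 p i x)) x (ax i)"
    unfolding pde_X DX_def by (simp add: sum.distrib)
  then show ?thesis using has_pd_unique[OF 1] by blast
qed

text \<open>\<open>Lf\<close> is the drift Laplacian of \<open>f = ln w\<close>.\<close>

definition Lf where "Lf x = (\<Sum>k\<in>UNIV. \<Sum>l\<in>UNIV. G x $ k $ l * f2 k l x) - (\<Sum>p\<in>UNIV. x $ p * f1 p x) / 2"

lemma cont_Lf[continuous_intros]: "continuous_on UNIV Lf"
  unfolding Lf_def[abs_def] by (intro continuous_intros; simp)

text \<open>The differentiated equation replaces the third derivatives: its drift part cancels the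
  first-order term of \<open>Lf\<close>, and its \<open>dG\<close> part cancels the Christoffel
  terms of \<open>dN\<close>. Only normal components survive.\<close>

lemma Lf_eq: "Lf x = - (\<Sum>k\<in>UNIV. \<Sum>l\<in>UNIV. G x $ k $ l * (\<Sum>i\<in>UNIV. \<Sum>p\<in>UNIV. pinner (X2 p l x) (N i x) * pinner (X2 i k x) (N p x)))
   - (\<Sum>k\<in>UNIV. \<Sum>l\<in>UNIV. G x $ k $ l * (\<Sum>i\<in>UNIV. \<Sum>j\<in>UNIV. G x $ i $ j * pinner (X2 i k x) (B j l x)))"
proof -
  define \<alpha> \<gamma> where "\<alpha> i p k = pinner (X2 p k x) (N i x)" and "\<gamma> i p k = pinner (X2 p k x) (Xu i x)" for i p k
  have sym: "\<alpha> i p k = \<alpha> i k p" "\<gamma> i p k = \<gamma> i k p" for i p k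
    by (simp_all add: \<alpha>_def \<gamma>_def X2_sym[of p])
  have \<theta>: "pinner (X2 p k x) (\<theta> i x) = \<alpha> i p k + \<gamma> i p k" for i p k
    by (simp add: \<alpha>_def \<gamma>_def N_def pinner.diff_right)
  have dN: "pinner (X2 i k x) (dN i l x) =
      - (\<Sum>p\<in>UNIV. (\<alpha> i p l + \<gamma> i p l) * (\<alpha> p i k + \<gamma> p i k) - \<gamma> i p l * \<gamma> p i k)
      - (\<Sum>j\<in>UNIV. G x $ i $ j * pinner (X2 i k x) (B j l x))" for i k l
    by (simp add: dN_def pinner.diff_right pinner.add_right pinner.minus_right pinner.sum_right pinner.scaleR_right \<theta>
       \<gamma>_def[symmetric] sum_subtractf)
  have third: "(\<Sum>k\<in>UNIV. \<Sum>l\<in>UNIV. G x $ k $ l * (\<Sum>i\<in>UNIV. pinner (X3 i k l x) (N i x)))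
     = (\<Sum>p\<in>UNIV. x $ p * f1 p x) / 2 - (\<Sum>i\<in>UNIV. \<Sum>k\<in>UNIV. \<Sum>l\<in>UNIV. dG k l i x * \<alpha> i k l)"
  proof -
    have "(\<Sum>k\<in>UNIV. \<Sum>l\<in>UNIV. G x $ k $ l * (\<Sum>i\<in>UNIV. pinner (X3 i k l x) (N i x)))
      = (\<Sum>k\<in>UNIV. \<Sum>i\<in>UNIV. \<Sum>l\<in>UNIV. G x $ k $ l * pinner (X3 i k l x) (N i x))"
      unfolding sum_distrib_left by (rule sum.cong[OF refl], rule sum.swap)
    also have "\<dots> = (\<Sum>i\<in>UNIV. \<Sum>k\<in>UNIV. \<Sum>l\<in>UNIV. G x $ k $ l * pinner (X3 i k l x) (N i x))"
      by (rule sum.swap)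
    \<comment> \<open>Full symmetry of the third derivatives moves the index \<open>i\<close> last,
      where \<open>pde_diff\<close> applies.\<close>
    also have "\<dots> = (\<Sum>i\<in>UNIV. \<Sum>k\<in>UNIV. \<Sum>l\<in>UNIV. G x $ k $ l * pinner (X3 k l i x) (N i x))"
      by (intro sum.cong refl) (metis X3_sym)
    also have "\<dots> = (\<Sum>i\<in>UNIV. pinner ((1/2) *\<^sub>R (\<Sum>p\<in>UNIV. x $ p *\<^sub>R X2 p i x)) (N i x) - (\<Sum>k\<in>UNIV. \<Sum>l\<in>UNIV. dG k l i x * \<alpha> i k l))"
      unfolding pde_diff[symmetric]
      by (simp add: sum.distrib pinner.add_left pinner.sum_left pinner.scaleR_left \<alpha>_def)
    also have "\<dots> = (\<Sum>i\<in>UNIV. \<Sum>p\<in>UNIV. x $ p * pinner (X2 p i x) (N i x)) / 2 - (\<Sum>i\<in>UNIV. \<Sum>k\<in>UNIV. \<Sum>l\<in>UNIV. dG k l i x * \<alpha> i k l)"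
      by (simp add: sum_subtractf pinner.scaleR_left pinner.sum_left sum_divide_distrib)
    also have "(\<Sum>i\<in>UNIV. \<Sum>p\<in>UNIV. x $ p * pinner (X2 p i x) (N i x)) = (\<Sum>p\<in>UNIV. x $ p * f1 p x)"
      by (subst sum.swap) (simp add: f1_def sum_distrib_left X2_sym)
    finally show ?thesis .
  qed
  have fourth: "- (\<Sum>i\<in>UNIV. \<Sum>k\<in>UNIV. \<Sum>l\<in>UNIV. dG k l i x * \<alpha> i k l)
     = (\<Sum>k\<in>UNIV. \<Sum>l\<in>UNIV. G x $ k $ l * (\<Sum>i\<in>UNIV. \<Sum>p\<in>UNIV. (\<alpha> i p l + \<gamma> i p l) * (\<alpha> p i k + \<gamma> p i k)
         - \<gamma> i p l * \<gamma> p i k - \<alpha> i p l * \<alpha> p i k))"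
  proof -
    have "- (\<Sum>i\<in>UNIV. \<Sum>k\<in>UNIV. \<Sum>l\<in>UNIV. dG k l i x * \<alpha> i k l)
      = (\<Sum>i\<in>UNIV. \<Sum>k\<in>UNIV. \<Sum>l\<in>UNIV. \<Sum>p\<in>UNIV. G x $ k $ p * \<gamma> l p i * \<alpha> i k l)
     + (\<Sum>i\<in>UNIV. \<Sum>k\<in>UNIV. \<Sum>l\<in>UNIV. \<Sum>p\<in>UNIV. G x $ p $ l * \<gamma> k p i * \<alpha> i k l)"
      unfolding sum.distrib[symmetric] sum_negf[symmetric]
      by (intro sum.cong refl) (simp add: dG_def \<gamma>_def[symmetric] left_diff_distrib sum_distrib_right sum.distrib)
    also have "\<dots> = (\<Sum>k\<in>UNIV. \<Sum>l\<in>UNIV. G x $ k $ l * (\<Sum>i\<in>UNIV. \<Sum>p\<in>UNIV. (\<alpha> i p l + \<gamma> i p l) * (\<alpha> p i k + \<gamma> p i k)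
         - \<gamma> i p l * \<gamma> p i k - \<alpha> i p l * \<alpha> p i k))"
      by (rule trace_identity) (use G_sym sym in blast)+
    finally show ?thesis .
  qed
  have "(\<Sum>k\<in>UNIV. \<Sum>l\<in>UNIV. G x $ k $ l * f2 k l x) =
      (\<Sum>k\<in>UNIV. \<Sum>l\<in>UNIV. G x $ k $ l * (\<Sum>i\<in>UNIV. pinner (X3 i k l x) (N i x)))
    + (\<Sum>k\<in>UNIV. \<Sum>l\<in>UNIV. G x $ k $ l * (\<Sum>i\<in>UNIV. pinner (X2 i k x) (dN i l x)))"
    by (simp add: f2_def sum.distrib distrib_left add.commute)
  also have "(\<Sum>k\<in>UNIV. \<Sum>l\<in>UNIV. G x $ k $ l * (\<Sum>i\<in>UNIV. pinner (X2 i k x) (dN i l x)))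
    = - (\<Sum>k\<in>UNIV. \<Sum>l\<in>UNIV. G x $ k $ l * (\<Sum>i\<in>UNIV. \<Sum>p\<in>UNIV. (\<alpha> i p l + \<gamma> i p l) * (\<alpha> p i k + \<gamma> p i k)
         - \<gamma> i p l * \<gamma> p i k - \<alpha> i p l * \<alpha> p i k))
     - (\<Sum>k\<in>UNIV. \<Sum>l\<in>UNIV. G x $ k $ l * (\<Sum>i\<in>UNIV. \<Sum>p\<in>UNIV. \<alpha> i p l * \<alpha> p i k))
     - (\<Sum>k\<in>UNIV. \<Sum>l\<in>UNIV. G x $ k $ l * (\<Sum>i\<in>UNIV. \<Sum>j\<in>UNIV. G x $ i $ j * pinner (X2 i k x) (B j l x)))"
    unfolding dN sum_subtractf sum_negf by (simp add: right_diff_distrib sum_subtractf sum_negf)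
  finally show ?thesis
    unfolding Lf_def third fourth[symmetric] by (simp add: \<alpha>_def)
qed

section \<open>The drift Laplacian in an orthonormal frame\<close>

lemma G_contract_pinner:
  "(\<Sum>k\<in>UNIV. \<Sum>l\<in>UNIV. G x $ k $ l * pinner (V k) (Y l))
   = (\<Sum>b\<in>UNIV. pinner (\<Sum>k\<in>UNIV. frame x $ b $ k *\<^sub>R V k) (\<Sum>l\<in>UNIV. frame x $ b $ l *\<^sub>R Y l))"
proof -
  have "(\<Sum>k\<in>UNIV. \<Sum>l\<in>UNIV. G x $ k $ l * pinner (V k) (Y l))
    = (\<Sum>k\<in>UNIV. \<Sum>b\<in>UNIV. \<Sum>l\<in>UNIV. frame x $ b $ k * frame x $ b $ l * pinner (V k) (Y l))"
    by (rule sum.cong[OF refl], subst sum.swap) (simp add: G_frame sum_distrib_right)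
  also have "\<dots> = (\<Sum>b\<in>UNIV. \<Sum>k\<in>UNIV. \<Sum>l\<in>UNIV. frame x $ b $ k * frame x $ b $ l * pinner (V k) (Y l))"
    by (rule sum.swap)
  finally show ?thesis
    unfolding pinner.sum_left unfolding pinner.sum_right by (simp add: pinner.scaleR_left pinner.scaleR_right mult_ac)
qed

lemma G_contract_mult:
  fixes s t :: "'m \<Rightarrow> real"
  shows "(\<Sum>k\<in>UNIV. \<Sum>l\<in>UNIV. G x $ k $ l * (s k * t l))
   = (\<Sum>b\<in>UNIV. (\<Sum>k\<in>UNIV. frame x $ b $ k * s k) * (\<Sum>l\<in>UNIV. frame x $ b $ l * t l))"
proof -
  have "(\<Sum>k\<in>UNIV. \<Sum>l\<in>UNIV. G x $ k $ l * (s k * t l))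
    = (\<Sum>k\<in>UNIV. \<Sum>b\<in>UNIV. \<Sum>l\<in>UNIV. frame x $ b $ k * frame x $ b $ l * (s k * t l))"
    by (rule sum.cong[OF refl], subst sum.swap) (simp add: G_frame sum_distrib_right)
  also have "\<dots> = (\<Sum>b\<in>UNIV. \<Sum>k\<in>UNIV. \<Sum>l\<in>UNIV. frame x $ b $ k * frame x $ b $ l * (s k * t l))"
    by (rule sum.swap)
  finally show ?thesis by (simp add: sum_product mult_ac)
qed

text \<open>The frame is introduced one index at a time: the contraction with \<open>G\<close> needs
  only the second index in the frame, and a trace argument converts the first.\<close>

definition Bh where "Bh i b x = (\<Sum>l\<in>UNIV. frame x $ b $ l *\<^sub>R B i l x)"
definition Bf where "Bf c b x = (\<Sum>i\<in>UNIV. frame x $ c $ i *\<^sub>R Bh i b x)"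

lemma Bf_normal: "pinner (Bf c b x) (X1 k x) = 0"
  by (simp add: Bf_def Bh_def pinner.sum_left pinner.scaleR_left B_normal)

text \<open>Both sides are traces of squares, of \<open>transpose C ** Q\<close> and of
  \<open>Q ** transpose C\<close>; cyclicity of the trace equates them.\<close>

lemma trace_frame:
  "(\<Sum>i\<in>UNIV. \<Sum>p\<in>UNIV. pinner (Bh p b x) (N i x) * pinner (Bh i b x) (N p x))
   = (\<Sum>c\<in>UNIV. \<Sum>d\<in>UNIV. pinner (Bf d b x) (Nf c x) * pinner (Bf c b x) (Nf d x))"
proof -
  define P :: "real ^ 'm ^ 'm" where "P = (\<chi> i p. pinner (Bh p b x) (N i x))"
  define Q :: "real ^ 'm ^ 'm" where "Q = (\<chi> c p. pinner (Bh p b x) (Nf c x))"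
  define C where "C = frame x"
  have P: "P = transpose C ** Q"
    by (simp add: P_def Q_def C_def vec_eq_iff matrix_matrix_mult_def transpose_def N_Nf pinner.sum_right pinner.scaleR_right)
  have R: "(Q ** transpose C) $ c $ d = pinner (Bf d b x) (Nf c x)" for c d
    by (simp add: Q_def C_def matrix_matrix_mult_def transpose_def Bf_def pinner.sum_left pinner.scaleR_left mult.commute)
  have "trace (P ** P) = trace (transpose C ** (Q ** transpose C ** Q))"
    by (simp add: P matrix_mul_assoc)
  also have "\<dots> = trace ((Q ** transpose C) ** (Q ** transpose C))"
    by (subst trace_mul_sym) (simp add: matrix_mul_assoc)
  finally have "trace (P ** P) = trace ((Q ** transpose C) ** (Q ** transpose C))" .
  moreover have "trace (M ** M) = (\<Sum>i\<in>UNIV. \<Sum>p\<in>UNIV. M $ i $ p * M $ p $ i)" for M :: "real ^ 'm ^ 'm"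
    by (simp add: trace_def matrix_matrix_mult_def)
  ultimately show ?thesis by (simp add: R P_def)
qed

lemma Lf_frame: "Lf x = - (\<Sum>b\<in>UNIV. \<Sum>c\<in>UNIV. \<Sum>d\<in>UNIV. pinner (Bf d b x) (Nf c x) * pinner (Bf c b x) (Nf d x))
   - (\<Sum>b\<in>UNIV. \<Sum>c\<in>UNIV. pinner (Bf c b x) (Bf c b x))"
proof -
  have "(\<Sum>k\<in>UNIV. \<Sum>l\<in>UNIV. G x $ k $ l * (\<Sum>i\<in>UNIV. \<Sum>p\<in>UNIV. pinner (X2 p l x) (N i x) * pinner (X2 i k x) (N p x)))
    = (\<Sum>k\<in>UNIV. \<Sum>l\<in>UNIV. \<Sum>i\<in>UNIV. \<Sum>p\<in>UNIV. G x $ k $ l * (pinner (B i k x) (N p x) * pinner (B p l x) (N i x)))"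
    by (simp add: B_pinner N_normal pinner_commute[of "X1 _ x"] sum_distrib_left mult.commute)
  also have "\<dots> = (\<Sum>k\<in>UNIV. \<Sum>i\<in>UNIV. \<Sum>l\<in>UNIV. \<Sum>p\<in>UNIV. G x $ k $ l * (pinner (B i k x) (N p x) * pinner (B p l x) (N i x)))"
    by (rule sum.cong[OF refl], rule sum.swap)
  also have "\<dots> = (\<Sum>i\<in>UNIV. \<Sum>k\<in>UNIV. \<Sum>l\<in>UNIV. \<Sum>p\<in>UNIV. G x $ k $ l * (pinner (B i k x) (N p x) * pinner (B p l x) (N i x)))"
    by (rule sum.swap)
  also have "\<dots> = (\<Sum>i\<in>UNIV. \<Sum>k\<in>UNIV. \<Sum>p\<in>UNIV. \<Sum>l\<in>UNIV. G x $ k $ l * (pinner (B i k x) (N p x) * pinner (B p l x) (N i x)))"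
    by (rule sum.cong[OF refl], rule sum.cong[OF refl], rule sum.swap)
  also have "\<dots> = (\<Sum>i\<in>UNIV. \<Sum>p\<in>UNIV. \<Sum>k\<in>UNIV. \<Sum>l\<in>UNIV. G x $ k $ l * (pinner (B i k x) (N p x) * pinner (B p l x) (N i x)))"
    by (rule sum.cong[OF refl], rule sum.swap)
  also have "\<dots> = (\<Sum>i\<in>UNIV. \<Sum>p\<in>UNIV. \<Sum>b\<in>UNIV. pinner (Bh p b x) (N i x) * pinner (Bh i b x) (N p x))"
    unfolding G_contract_mult by (simp add: Bh_def pinner.sum_left pinner.scaleR_left mult.commute)
  also have "\<dots> = (\<Sum>i\<in>UNIV. \<Sum>b\<in>UNIV. \<Sum>p\<in>UNIV. pinner (Bh p b x) (N i x) * pinner (Bh i b x) (N p x))"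
    by (rule sum.cong[OF refl], rule sum.swap)
  also have "\<dots> = (\<Sum>b\<in>UNIV. \<Sum>i\<in>UNIV. \<Sum>p\<in>UNIV. pinner (Bh p b x) (N i x) * pinner (Bh i b x) (N p x))"
    by (rule sum.swap)
  finally have 1: "(\<Sum>k\<in>UNIV. \<Sum>l\<in>UNIV. G x $ k $ l * (\<Sum>i\<in>UNIV. \<Sum>p\<in>UNIV. pinner (X2 p l x) (N i x) * pinner (X2 i k x) (N p x)))
    = (\<Sum>b\<in>UNIV. \<Sum>c\<in>UNIV. \<Sum>d\<in>UNIV. pinner (Bf d b x) (Nf c x) * pinner (Bf c b x) (Nf d x))"
    unfolding trace_frame .
  have "(\<Sum>k\<in>UNIV. \<Sum>l\<in>UNIV. G x $ k $ l * (\<Sum>i\<in>UNIV. \<Sum>j\<in>UNIV. G x $ i $ j * pinner (X2 i k x) (B j l x)))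
    = (\<Sum>k\<in>UNIV. \<Sum>l\<in>UNIV. G x $ k $ l * (\<Sum>i\<in>UNIV. \<Sum>j\<in>UNIV. G x $ i $ j * pinner (B i k x) (B j l x)))"
    by (simp add: B_pinner B_normal pinner_commute[of "X1 _ x"])
  also have "\<dots> = (\<Sum>k\<in>UNIV. \<Sum>l\<in>UNIV. \<Sum>c\<in>UNIV. G x $ k $ l *
      pinner (\<Sum>i\<in>UNIV. frame x $ c $ i *\<^sub>R B i k x) (\<Sum>j\<in>UNIV. frame x $ c $ j *\<^sub>R B j l x))"
    unfolding G_contract_pinner sum_distrib_left ..
  also have "\<dots> = (\<Sum>k\<in>UNIV. \<Sum>c\<in>UNIV. \<Sum>l\<in>UNIV. G x $ k $ l *
      pinner (\<Sum>i\<in>UNIV. frame x $ c $ i *\<^sub>R B i k x) (\<Sum>j\<in>UNIV. frame x $ c $ j *\<^sub>R B j l x))"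
    by (rule sum.cong[OF refl], rule sum.swap)
  also have "\<dots> = (\<Sum>c\<in>UNIV. \<Sum>k\<in>UNIV. \<Sum>l\<in>UNIV. G x $ k $ l *
      pinner (\<Sum>i\<in>UNIV. frame x $ c $ i *\<^sub>R B i k x) (\<Sum>j\<in>UNIV. frame x $ c $ j *\<^sub>R B j l x))"
    by (rule sum.swap)
  also have "\<dots> = (\<Sum>c\<in>UNIV. \<Sum>b\<in>UNIV. pinner (Bf c b x) (Bf c b x))"
  proof -
    have "(\<Sum>k\<in>UNIV. frame x $ b $ k *\<^sub>R (\<Sum>i\<in>UNIV. frame x $ c $ i *\<^sub>R B i k x)) = Bf c b x" for b c
      unfolding Bf_def Bh_def scaleR_sum_right by (subst sum.swap) (simp add: mult.commute)
    then show ?thesis unfolding G_contract_pinner by simp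
  qed
  also have "\<dots> = (\<Sum>b\<in>UNIV. \<Sum>c\<in>UNIV. pinner (Bf c b x) (Bf c b x))" by (rule sum.swap)
  finally show ?thesis unfolding Lf_eq 1 by simp
qed

text \<open>For each \<open>b\<close>, the trace of the square of a matrix is at most the sum of the
  squares of its entries.\<close>

lemma Lf_ge: "Lf x \<ge> (\<Sum>b\<in>UNIV. \<Sum>c\<in>UNIV. - pinner (Bf c b x) (Bf c b x) - (\<Sum>d\<in>UNIV. (pinner (Bf c b x) (Nf d x))\<^sup>2))"
proof -
  have "(\<Sum>c\<in>UNIV. \<Sum>d\<in>UNIV. pinner (Bf d b x) (Nf c x) * pinner (Bf c b x) (Nf d x))
     \<le> (\<Sum>c\<in>UNIV. \<Sum>d\<in>UNIV. (pinner (Bf c b x) (Nf d x))\<^sup>2)" for b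
  proof -
    have am: "s * t \<le> (s\<^sup>2 + t\<^sup>2) / 2" for s t :: real
      using sum_squares_bound[of s t] by simp
    have "(\<Sum>c\<in>UNIV. \<Sum>d\<in>UNIV. pinner (Bf d b x) (Nf c x) * pinner (Bf c b x) (Nf d x))
      \<le> (\<Sum>c\<in>UNIV. \<Sum>d\<in>UNIV. ((pinner (Bf d b x) (Nf c x))\<^sup>2 + (pinner (Bf c b x) (Nf d x))\<^sup>2) / 2)"
      by (intro sum_mono am)
    also have "\<dots> = ((\<Sum>c\<in>UNIV. \<Sum>d\<in>UNIV. (pinner (Bf d b x) (Nf c x))\<^sup>2) + (\<Sum>c\<in>UNIV. \<Sum>d\<in>UNIV. (pinner (Bf c b x) (Nf d x))\<^sup>2)) / 2"
      by (simp add: sum.distrib sum_divide_distrib[symmetric])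
    also have "(\<Sum>c\<in>UNIV. \<Sum>d\<in>UNIV. (pinner (Bf d b x) (Nf c x))\<^sup>2) = (\<Sum>c\<in>UNIV. \<Sum>d\<in>UNIV. (pinner (Bf c b x) (Nf d x))\<^sup>2)"
      by (rule sum.swap)
    finally show ?thesis by simp
  qed
  from sum_mono[of UNIV, OF this] show ?thesis
    unfolding Lf_frame by (simp add: sum_subtractf sum_negf)
qed

lemma Lf_nonneg: "Lf x \<ge> 0"
proof -
  have "- pinner (Bf c b x) (Bf c b x) - (\<Sum>d\<in>UNIV. (pinner (Bf c b x) (Nf d x))\<^sup>2) \<ge> 0" for c b
    using normal_Nf_le(1)[OF Bf_normal] by simp
  then have "(\<Sum>b\<in>UNIV. \<Sum>c\<in>UNIV. - pinner (Bf c b x) (Bf c b x) - (\<Sum>d\<in>UNIV. (pinner (Bf c b x) (Nf d x))\<^sup>2)) \<ge> 0"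
    by (intro sum_nonneg)
  then show ?thesis using Lf_ge[of x] by linarith
qed

text \<open>Each summand of \<open>Lf_ge\<close> is nonnegative, hence zero here, and the strict
  case of \<open>normal_Nf_le\<close> then forces \<open>Bf c b x = 0\<close>.\<close>

lemma B_zero:
  assumes "Lf x = 0"
  shows "B i l x = 0"
proof -
  define h where "h b c = - pinner (Bf c b x) (Bf c b x) - (\<Sum>d\<in>UNIV. (pinner (Bf c b x) (Nf d x))\<^sup>2)" for b c
  have h0: "h b c \<ge> 0" for b c
    using normal_Nf_le(1)[OF Bf_normal] by (simp add: h_def)
  have "(\<Sum>b\<in>UNIV. \<Sum>c\<in>UNIV. h b c) = 0"
    using Lf_ge[of x] h0 unfolding h_def[symmetric] assms by (intro antisym sum_nonneg) auto
  then have "h b c = 0" for b c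
    using h0 by (simp add: sum_nonneg_eq_0_iff sum_nonneg)
  then have Bf0: "Bf c b x = 0" for c b
    using normal_Nf_le(2)[OF Bf_normal, of c b x] by (force simp: h_def)
  have e: "ax i $ j = (\<Sum>b\<in>UNIV. pinner (X1 i x) (DX x (frame x $ b)) * frame x $ b $ j)" for i j
    using arg_cong[OF frame_basis[of "ax i" x], of "\<lambda>v. v $ j"] by (simp add: DX_ax)
  \<comment> \<open>Invertibility of the frame matrix, applied below once for each index of
    \<open>B\<close>.\<close>
  have inv: "V i = 0" if "\<And>c. (\<Sum>j\<in>UNIV. frame x $ c $ j *\<^sub>R V j) = 0" for V :: "'m \<Rightarrow> ('m, 'n) pseudo_euclidean" and i
  proof -
    have "V i = (\<Sum>j\<in>UNIV. ax i $ j *\<^sub>R V j)"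
      by (subst sum.remove[of _ i]) (auto simp: axis_def intro!: sum.neutral)
    also have "\<dots> = (\<Sum>b\<in>UNIV. \<Sum>j\<in>UNIV. (pinner (X1 i x) (DX x (frame x $ b)) * frame x $ b $ j) *\<^sub>R V j)"
      by (subst sum.swap) (simp add: e scaleR_sum_left)
    also have "\<dots> = (\<Sum>b\<in>UNIV. pinner (X1 i x) (DX x (frame x $ b)) *\<^sub>R (\<Sum>j\<in>UNIV. frame x $ b $ j *\<^sub>R V j))"
      by (simp add: scaleR_sum_right)
    finally show ?thesis using that by simp
  qed
  have "Bh i b x = 0" for i b
    by (rule inv[of "\<lambda>i. Bh i b x"]) (simp add: Bf0 flip: Bf_def)
  then show ?thesis
    by (intro inv[of "\<lambda>l. B i l x"]) (simp flip: Bh_def)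
qed

text \<open>When \<open>B\<close> vanishes, \<open>X2\<close> is tangent; its horizontal component
  is zero, and a tangent vector of a graph is determined by that component.\<close>

lemma u2_zero:
  assumes "B i l x = 0"
  shows "u2 i l x = 0"
proof -
  have e: "X2 i l x = DX x (\<chi> p. pinner (X2 i l x) (Xu p x))"
    using assms by (simp add: B_def DX_def)
  then have "(\<chi> p. pinner (X2 i l x) (Xu p x)) = 0"
    unfolding DX_Pair X2_def by (simp add: prod_eq_iff)
  then show ?thesis using e by (simp add: DX_Pair X2_def prod_eq_iff)
qed

text \<open>Constant \<open>ln w\<close> makes \<open>Lf\<close> vanish, hence \<open>B\<close> and
  all second derivatives of \<open>u\<close>. The value at the origin removes the constant of the
  resulting affine map.\<close>

lemma linear_if_f1_zero:
  assumes "\<And>k x. f1 k x = 0" "u 0 = 0"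
  shows "linear u"
proof -
  have "f2 k l x = 0" for k l x
    using pd_f1[of k l x] has_pd_const[of 0 x "ax l"] has_pd_unique assms(1) by (metis (no_types, lifting) ext)
  then have "Lf x = 0" for x by (simp add: Lf_def assms(1))
  then have u2: "u2 i l x = 0" for i l x by (intro u2_zero B_zero)
  have "(u1 i has_derivative (\<lambda>v. 0)) (at x)" for i x
    using du1[of i x] by (simp add: u2)
  then have c: "u1 i x = u1 i 0" for i x
    using has_derivative_zero_unique[of UNIV "u1 i" x 0] by auto
  define L where "L v = (\<Sum>i\<in>UNIV. v $ i *\<^sub>R u1 i 0)" for v
  have lin: "bounded_linear L"
    unfolding L_def by (intro bounded_linear_sum bounded_linear_scaleR_const bounded_linear_vec_nth)
  have "((\<lambda>x. u x - L x) has_derivative (\<lambda>v. 0)) (at x)" for x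
  proof -
    have "((\<lambda>x. u x - L x) has_derivative (\<lambda>v. L v - L v)) (at x)"
      using du[of x] lin unfolding c[of _ x] L_def[symmetric] by (intro has_derivative_diff bounded_linear_imp_has_derivative)
    then show ?thesis by simp
  qed
  then have "u x - L x = u 0 - L 0" for x
    using has_derivative_zero_unique[of UNIV "\<lambda>x. u x - L x" x 0] by auto
  then have "u = L" using assms(2) lin by (simp add: fun_eq_iff linear_0 bounded_linear.linear)
  then show ?thesis using lin by (simp add: bounded_linear.linear)
qed

section \<open>The weighted energy inequality\<close>

text \<open>The factors are the number of entries of \<open>G\<close>, the Leibniz bound for a
  cofactor with entries at most 2, and the lower bound for \<open>det (A x)\<close>.\<close>

definition K where "K = (real CARD('m))\<^sup>2 * (fact CARD('m) * 2 ^ CARD('m)) / (\<kappa> ^ CARD('m))\<^sup>2"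

lemma abs_gm_le: "\<bar>gm x $ i $ j\<bar> \<le> 2"
proof -
  have n: "norm (u1 i x) \<le> 1" for i
    using spacelike[of "ax i" x] DX_ax[of x i] by (simp add: DX_Pair X1_def)
  have "\<bar>u1 i x \<bullet> u1 j x\<bar> \<le> norm (u1 i x) * norm (u1 j x)" by (rule Cauchy_Schwarz_ineq2)
  also have "\<dots> \<le> 1 * 1" by (intro mult_mono n) auto
  finally have "\<bar>u1 i x \<bullet> u1 j x\<bar> \<le> 1" by simp
  moreover have "\<bar>ax i \<bullet> ax j\<bar> \<le> (1::real)" using Cauchy_Schwarz_ineq2[of "ax i" "ax j"] by simp
  ultimately show ?thesis by (simp add: gm_nth X1_def pinner_inner)
qed

lemma abs_G_le: "\<bar>G x $ k $ l\<bar> \<le> fact CARD('m) * 2 ^ CARD('m) / det (gm x)"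
proof -
  have "\<bar>det (\<chi> i j. if j = k then ax l $ i else gm x $ i $ j)\<bar> \<le> fact CARD('m) * 2 ^ CARD('m)"
    by (rule abs_det_le) (use abs_gm_le in \<open>auto simp: axis_def\<close>)
  then show ?thesis using det_gm_pos[of x]
    by (simp add: G_def cramer_inv_def abs_divide divide_right_mono)
qed

text \<open>The origin of the weight \<open>w^2\<close>: the uniform lower bound on
  \<open>det (A x)\<close> lets \<open>W\<close> control the degeneration of the metric.\<close>

lemma inverse_det_gm_le: "1 / det (gm x) \<le> (W x)\<^sup>2 / (\<kappa> ^ CARD('m))\<^sup>2"
proof -
  have "(\<kappa> ^ CARD('m))\<^sup>2 \<le> \<bar>det (A x)\<bar>\<^sup>2"
    using abs_det_A \<kappa>_pos by (intro power_mono) auto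
  moreover have "(W x)\<^sup>2 = \<bar>det (A x)\<bar>\<^sup>2 / det (gm x)"
    using det_gm_pos[of x] by (simp add: W_def power_divide)
  ultimately show ?thesis using det_gm_pos[of x] \<kappa>_pos
    by (simp add: field_simps)
qed

lemma G_form_le: "(\<Sum>k\<in>UNIV. \<Sum>l\<in>UNIV. G x $ k $ l * (y $ k * y $ l)) \<le> K * (W x)\<^sup>2 * (norm y)\<^sup>2"
proof -
  define c where "c = fact CARD('m) * 2 ^ CARD('m) * (norm y)\<^sup>2 / det (gm x)"
  have "G x $ k $ l * (y $ k * y $ l) \<le> c" for k l
  proof -
    have "G x $ k $ l * (y $ k * y $ l) \<le> \<bar>G x $ k $ l\<bar> * (\<bar>y $ k\<bar> * \<bar>y $ l\<bar>)"
      by (metis abs_ge_self abs_mult)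
    also have "\<dots> \<le> (fact CARD('m) * 2 ^ CARD('m) / det (gm x)) * (norm y * norm y)"
      using det_gm_pos[of x] by (intro mult_mono abs_G_le component_le_norm_cart) auto
    finally show ?thesis by (simp add: c_def power2_eq_square)
  qed
  then have "(\<Sum>k\<in>UNIV. \<Sum>l\<in>UNIV. G x $ k $ l * (y $ k * y $ l)) \<le> (\<Sum>k\<in>(UNIV::'m set). \<Sum>l\<in>(UNIV::'m set). c)"
    by (intro sum_mono)
  also have "\<dots> = (real CARD('m))\<^sup>2 * (fact CARD('m) * 2 ^ CARD('m)) * (norm y)\<^sup>2 * (1 / det (gm x))"
    by (simp add: c_def power2_eq_square)
  also have "\<dots> \<le> (real CARD('m))\<^sup>2 * (fact CARD('m) * 2 ^ CARD('m)) * (norm y)\<^sup>2 * ((W x)\<^sup>2 / (\<kappa> ^ CARD('m))\<^sup>2)"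
    by (intro mult_left_mono inverse_det_gm_le) auto
  finally show ?thesis by (simp add: K_def mult_ac)
qed

lemma K_pos: "K > 0"
  using \<kappa>_pos by (simp add: K_def)

text \<open>The squared length of the gradient of \<open>ln w\<close> in the induced metric.\<close>

definition E2 where "E2 x = (\<Sum>l\<in>UNIV. \<Sum>k\<in>UNIV. G x $ l $ k * (f1 l x * f1 k x))"

lemma cont_E2[continuous_intros]: "continuous_on UNIV E2"
  unfolding E2_def[abs_def] by (intro continuous_intros)

lemma E2_nonneg: "E2 x \<ge> 0"
  unfolding E2_def G_contract_mult by (intro sum_nonneg) simp

lemma f1_zero_if_E2_zero: "E2 x = 0 \<Longrightarrow> f1 i x = 0"
proof -
  assume "E2 x = 0"
  then have z: "(\<Sum>k\<in>UNIV. frame x $ b $ k * f1 k x) = 0" for b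
    unfolding E2_def G_contract_mult by (subst (asm) sum_nonneg_eq_0_iff) auto
  have e: "ax i $ j = (\<Sum>b\<in>UNIV. pinner (X1 i x) (DX x (frame x $ b)) * frame x $ b $ j)" for j
    using arg_cong[OF frame_basis[of "ax i" x], of "\<lambda>v. v $ j"] by (simp add: DX_ax)
  have "f1 i x = (\<Sum>j\<in>UNIV. ax i $ j * f1 j x)"
    by (subst sum.remove[of _ i]) (auto simp: axis_def intro!: sum.neutral)
  also have "\<dots> = (\<Sum>b\<in>UNIV. pinner (X1 i x) (DX x (frame x $ b)) * (\<Sum>j\<in>UNIV. frame x $ b $ j * f1 j x))"
    unfolding e sum_distrib_right sum_distrib_left by (subst sum.swap) (simp add: mult_ac)
  finally show ?thesis using z by simp
qed

section \<open>Cutoff functions and integration by parts\<close>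

definition \<eta> where "\<eta> R x = max 0 (1 - (x \<bullet> x) / R\<^sup>2)" for R :: real and x :: "real ^ 'm"

lemma pd_cutoff: "has_pd (\<lambda>x. (\<eta> R x)\<^sup>2) (- (4 * \<eta> R x * x $ l / R\<^sup>2)) x (ax l)"
proof -
  have "has_pd (\<lambda>x. 1 - (x \<bullet> x) / R\<^sup>2) (0 - (x \<bullet> ax l + ax l \<bullet> x) / R\<^sup>2) x (ax l)"
    by (intro has_pd_diff has_pd_const has_pd_linear[OF bounded_linear_divide] has_pd_bilinear[OF bounded_bilinear_inner] has_pd_id)
  from has_pd_compose[OF this DERIV_max_power2]
  show ?thesis unfolding \<eta>_def by (simp add: inner_axis inner_axis' mult_ac)
qed

lemma cont_\<eta>[continuous_intros]: "continuous_on UNIV (\<eta> R)"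
  \<comment> \<open>For \<open>R = 0\<close> division by zero gives the constant cutoff 1, so
    continuity still holds.\<close>
  unfolding \<eta>_def[abs_def] by (cases "R = 0") (auto intro!: continuous_intros)

lemma \<eta>_nonneg: "\<eta> R x \<ge> 0" by (simp add: \<eta>_def)

lemma \<eta>_outside: "R > 0 \<Longrightarrow> norm x > R \<Longrightarrow> \<eta> R x = 0"
  by (simp add: \<eta>_def dot_square_norm power_mono)

lemma \<eta>_mono:
  assumes "0 < R" "R \<le> R'"
  shows "\<eta> R x \<le> \<eta> R' x"
proof -
  have "(x \<bullet> x) / R'\<^sup>2 \<le> (x \<bullet> x) / R\<^sup>2"
    using assms by (intro divide_left_mono power_mono mult_pos_pos) auto
  then show ?thesis by (simp add: \<eta>_def)
qed

text \<open>Component \<open>l\<close> of the gradient of \<open>f\<close>, multiplied by the weight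
  \<rho> and the test function \<open>(\<eta> R)^2 f\<close>.\<close>

definition flux where "flux R l x = (\<Sum>k\<in>UNIV. (\<Phi> l k x * f1 k x) * ((\<eta> R x)\<^sup>2 * f x))"
definition dflux where "dflux R l x = (\<Sum>k\<in>UNIV. (\<Phi> l k x * f1 k x) * ((\<eta> R x)\<^sup>2 * f1 l x + - (4 * \<eta> R x * x $ l / R\<^sup>2) * f x)
    + (\<Phi> l k x * f2 k l x + d\<Phi> l k x * f1 k x) * ((\<eta> R x)\<^sup>2 * f x))"

lemma pd_flux: "has_pd (flux R l) (dflux R l x) x (ax l)"
  unfolding flux_def[abs_def] dflux_def by (intro has_pd_sum has_pd_mult pd_\<Phi> pd_f1 pd_f pd_cutoff)

lemma cont_\<Phi>[continuous_intros]: "continuous_on UNIV (\<Phi> i j)"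
  and cont_d\<Phi>[continuous_intros]: "continuous_on UNIV (d\<Phi> i j)"
  unfolding \<Phi>_def[abs_def] d\<Phi>_def[abs_def] by (intro continuous_intros)+

lemma cont_flux: "continuous_on UNIV (flux R l)"
  unfolding flux_def[abs_def] by (intro continuous_intros)

lemma cont_dflux: "continuous_on UNIV (dflux R l)"
  unfolding dflux_def[abs_def] by (cases "R = 0") (auto intro!: continuous_intros)

lemma integral_dflux: "R > 0 \<Longrightarrow> integral\<^sup>L lborel (dflux R l) = 0"
  by (rule integral_has_pd_zero[OF pd_flux cont_flux cont_dflux, of R]) (simp add: flux_def \<eta>_outside)

lemma integrable_dflux: "R > 0 \<Longrightarrow> integrable lborel (dflux R l)"
  by (rule integrable_continuous_compact_support[OF cont_dflux, of R]) (simp add: dflux_def \<eta>_outside)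

text \<open>The divergence of the flux. Through \<open>div_\<Phi>\<close>, differentiating the
  coefficients produces the drift that completes the second derivatives to
  \<open>Lf\<close>.\<close>

lemma sum_dflux: "(\<Sum>l\<in>UNIV. dflux R l x) = \<rho> x * (\<eta> R x)\<^sup>2 * E2 x + \<rho> x * (\<eta> R x)\<^sup>2 * f x * Lf x
    - \<rho> x * (4 * \<eta> R x / R\<^sup>2) * f x * (\<Sum>l\<in>UNIV. \<Sum>k\<in>UNIV. G x $ l $ k * (x $ l * f1 k x))"
proof -
  have 1: "(\<Sum>l\<in>UNIV. \<Sum>k\<in>UNIV. d\<Phi> l k x * f1 k x) = - \<rho> x * (\<Sum>p\<in>UNIV. x $ p * f1 p x) / 2"
    by (subst sum.swap, unfold sum_distrib_right[symmetric] div_\<Phi>)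
      (simp add: sum_distrib_left sum_divide_distrib sum_negf mult_ac)
  have 2: "(\<Sum>l\<in>UNIV. \<Sum>k\<in>UNIV. \<Phi> l k x * f2 k l x) = \<rho> x * (\<Sum>k\<in>UNIV. \<Sum>l\<in>UNIV. G x $ k $ l * f2 k l x)"
    by (subst sum.swap) (simp add: \<Phi>_def sum_distrib_left G_sym mult_ac)
  have "(\<Sum>l\<in>UNIV. dflux R l x) = (\<Sum>l\<in>UNIV. \<Sum>k\<in>UNIV.
      \<rho> x * (\<eta> R x)\<^sup>2 * (G x $ l $ k * (f1 l x * f1 k x))
      - \<rho> x * (4 * \<eta> R x / R\<^sup>2) * f x * (G x $ l $ k * (x $ l * f1 k x))
      + (\<eta> R x)\<^sup>2 * f x * (\<Phi> l k x * f2 k l x) + (\<eta> R x)\<^sup>2 * f x * (d\<Phi> l k x * f1 k x))"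
    unfolding dflux_def by (intro sum.cong refl) (simp add: \<Phi>_def algebra_simps)
  also have "\<dots> = \<rho> x * (\<eta> R x)\<^sup>2 * E2 x
      - \<rho> x * (4 * \<eta> R x / R\<^sup>2) * f x * (\<Sum>l\<in>UNIV. \<Sum>k\<in>UNIV. G x $ l $ k * (x $ l * f1 k x))
      + (\<eta> R x)\<^sup>2 * f x * (\<Sum>l\<in>UNIV. \<Sum>k\<in>UNIV. \<Phi> l k x * f2 k l x) + (\<eta> R x)\<^sup>2 * f x * (\<Sum>l\<in>UNIV. \<Sum>k\<in>UNIV. d\<Phi> l k x * f1 k x)"
    unfolding E2_def sum.distrib sum_subtractf sum_distrib_left ..
  finally show ?thesis unfolding 1 2 Lf_def by (simp add: algebra_simps)
qed

lemma f_nonneg: "f x \<ge> 0"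
  using W_ge_1[of x] by (simp add: f_def)

text \<open>Young's inequality in the frame, weighted so that half of the gradient term is spent. On
  the ball, \<open>|x|^2 \<le> R^2\<close> cancels one of the two factors \<open>1 / R^2\<close> in
  the square of \<open>t\<close>.\<close>

lemma cross_le: 
  assumes R: "R > 0"
  shows "(4 * \<eta> R x / R\<^sup>2) * f x * (\<Sum>l\<in>UNIV. \<Sum>k\<in>UNIV. G x $ l $ k * (x $ l * f1 k x))
   \<le> (\<eta> R x)\<^sup>2 * E2 x / 2 + 8 * K / R\<^sup>2 * (indicator (cball 0 R) x * ((W x)\<^sup>2 * (f x)\<^sup>2))"
proof (cases "norm x > R")
  case True
  then show ?thesis using R by (simp add: \<eta>_outside)
next
  case False
  define p q where "p b = (\<Sum>k\<in>UNIV. frame x $ b $ k * f1 k x)" and "q b = (\<Sum>k\<in>UNIV. frame x $ b $ k * x $ k)" for b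
  define s t where "s = \<eta> R x" and "t = f x / R\<^sup>2"
  have "(4 * \<eta> R x / R\<^sup>2) * f x * (\<Sum>l\<in>UNIV. \<Sum>k\<in>UNIV. G x $ l $ k * (x $ l * f1 k x)) = (\<Sum>b\<in>UNIV. 4 * s * t * (q b * p b))"
    unfolding G_contract_mult p_def q_def s_def t_def by (simp add: sum_distrib_left)
  also have "\<dots> \<le> (\<Sum>b\<in>UNIV. s\<^sup>2 / 2 * (p b * p b) + 8 * t\<^sup>2 * (q b * q b))"
  proof (rule sum_mono)
    fix b
    have "0 \<le> (s * p b - 4 * t * q b)\<^sup>2 / 2" by simp
    then show "4 * s * t * (q b * p b) \<le> s\<^sup>2 / 2 * (p b * p b) + 8 * t\<^sup>2 * (q b * q b)"
      by (simp add: power2_eq_square algebra_simps)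
  qed
  also have "\<dots> = s\<^sup>2 / 2 * E2 x + 8 * t\<^sup>2 * (\<Sum>k\<in>UNIV. \<Sum>l\<in>UNIV. G x $ k $ l * (x $ k * x $ l))"
    unfolding E2_def G_contract_mult p_def q_def by (simp add: sum.distrib sum_distrib_left)
  also have "\<dots> \<le> s\<^sup>2 / 2 * E2 x + 8 * t\<^sup>2 * (K * (W x)\<^sup>2 * (norm x)\<^sup>2)"
    by (intro add_left_mono mult_left_mono G_form_le) auto
  also have "\<dots> \<le> s\<^sup>2 / 2 * E2 x + 8 * t\<^sup>2 * (K * (W x)\<^sup>2 * R\<^sup>2)"
    using False K_pos by (intro add_left_mono mult_left_mono power_mono) auto
  also have "8 * t\<^sup>2 * (K * (W x)\<^sup>2 * R\<^sup>2) = 8 * K / R\<^sup>2 * (indicator (cball 0 R) x * ((W x)\<^sup>2 * (f x)\<^sup>2))"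
    using False R by (simp add: t_def power2_eq_square field_simps)
  finally show ?thesis by (simp add: s_def)
qed

text \<open>The integrated divergence is zero. Dropping the nonnegative term with
  \<open>f * Lf\<close> and absorbing half of the gradient term doubles the constant 8 of
  \<open>cross_le\<close>.\<close>

lemma caccioppoli:
  assumes R: "R > 0"
  shows "R\<^sup>2 * integral\<^sup>L lborel (\<lambda>x. \<rho> x * (\<eta> R x)\<^sup>2 * E2 x)
    \<le> 16 * K * integral\<^sup>L lborel (\<lambda>x. indicator (cball 0 R) x * (\<rho> x * ((W x)\<^sup>2 * (f x)\<^sup>2)))"
    (is "_ * integral\<^sup>L lborel ?l \<le> _ * integral\<^sup>L lborel ?r")
proof -
  have il: "integrable lborel ?l"
  proof (rule integrable_continuous_compact_support)
    show "continuous_on UNIV ?l" by (intro continuous_intros)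
    show "?l y = 0" if "norm y > R" for y using that R by (simp add: \<eta>_outside)
  qed
  have "integrable lborel (\<lambda>x. indicator (cball 0 R) x *\<^sub>R (\<rho> x * ((W x)\<^sup>2 * (f x)\<^sup>2)))"
    by (rule borel_integrable_compact[OF compact_cball], rule continuous_on_subset[OF _ subset_UNIV])
      (intro continuous_intros)
  then have ir: "integrable lborel ?r" by simp
  have "0 = integral\<^sup>L lborel (\<lambda>x. \<Sum>l\<in>UNIV. dflux R l x)"
    using R by (simp add: integral_dflux integrable_dflux)
  also have "\<dots> \<ge> integral\<^sup>L lborel (\<lambda>x. ?l x / 2 - 8 * K / R\<^sup>2 * ?r x)"
  proof (rule integral_mono)
    show "integrable lborel (\<lambda>x. ?l x / 2 - 8 * K / R\<^sup>2 * ?r x)"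
      using il ir by (intro Bochner_Integration.integrable_diff integrable_divide integrable_mult_right)
    show "integrable lborel (\<lambda>x. \<Sum>l\<in>UNIV. dflux R l x)"
      using R by (intro Bochner_Integration.integrable_sum integrable_dflux)
    fix x
    have "\<rho> x * ((4 * \<eta> R x / R\<^sup>2) * f x * (\<Sum>l\<in>UNIV. \<Sum>k\<in>UNIV. G x $ l $ k * (x $ l * f1 k x)))
      \<le> \<rho> x * ((\<eta> R x)\<^sup>2 * E2 x / 2 + 8 * K / R\<^sup>2 * (indicator (cball 0 R) x * ((W x)\<^sup>2 * (f x)\<^sup>2)))"
      using \<rho>_pos[of x] by (intro mult_left_mono cross_le R) auto
    moreover have "\<rho> x * (\<eta> R x)\<^sup>2 * f x * Lf x \<ge> 0"
      using \<rho>_pos[of x] f_nonneg[of x] Lf_nonneg[of x] by simp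
    ultimately show "?l x / 2 - 8 * K / R\<^sup>2 * ?r x \<le> (\<Sum>l\<in>UNIV. dflux R l x)"
      unfolding sum_dflux by (simp add: algebra_simps)
  qed
  also have "integral\<^sup>L lborel (\<lambda>x. ?l x / 2 - 8 * K / R\<^sup>2 * ?r x) = integral\<^sup>L lborel ?l / 2 - 8 * K / R\<^sup>2 * integral\<^sup>L lborel ?r"
    using il ir by simp
  finally show ?thesis using R by (simp add: field_simps)
qed

text \<open>A nonzero gradient at one point contributes a fixed positive energy \<open>J\<close>,
  which every larger cutoff retains; \<open>caccioppoli\<close> turns it into growth like
  \<open>R^2\<close>.\<close>

lemma quadratic_growth:
  assumes "f1 i x0 \<noteq> 0"
  shows "\<exists>c R0. c > 0 \<and> R0 > 0 \<and> (\<forall>R\<ge>R0. c * R\<^sup>2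
     \<le> integral\<^sup>L lborel (\<lambda>x. indicator (cball 0 R) x * (\<rho> x * ((W x)\<^sup>2 * (f x)\<^sup>2))))"
proof -
  \<comment> \<open>Large enough for the cutoff to be positive at \<open>x0\<close>.\<close>
  define R0 where "R0 = norm x0 + 1"
  have R0: "R0 > 0" by (simp add: R0_def add_nonneg_pos)
  define h where "h R x = \<rho> x * (\<eta> R x)\<^sup>2 * E2 x" for R x
  have hn: "h R x \<ge> 0" for R x
    using \<rho>_pos[of x] E2_nonneg[of x] by (simp add: h_def)
  have ch: "continuous_on UNIV (h R)" for R
    unfolding h_def[abs_def] by (intro continuous_intros)
  have ih: "integrable lborel (h R)" if "R > 0" for R
    by (rule integrable_continuous_compact_support[OF ch, of R]) (simp add: h_def \<eta>_outside that)
  have "h R0 x0 > 0"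
  proof -
    have "E2 x0 > 0" using f1_zero_if_E2_zero[of x0 i] assms E2_nonneg[of x0] by force
    moreover have "\<eta> R0 x0 > 0"
    proof -
      have "(norm x0)\<^sup>2 < R0\<^sup>2" unfolding R0_def by (intro power_strict_mono) auto
      then show ?thesis using R0 by (simp add: \<eta>_def dot_square_norm)
    qed
    ultimately show ?thesis using \<rho>_pos[of x0] by (simp add: h_def)
  qed
  then obtain d where d: "d > 0" "\<And>x. dist x x0 < d \<Longrightarrow> dist (h R0 x) (h R0 x0) < h R0 x0 / 2"
    using ch[of R0, unfolded continuous_on_iff, rule_format, of x0 "h R0 x0 / 2"] by auto
  \<comment> \<open>By continuity the integrand exceeds half of its value at \<open>x0\<close>
    throughout the ball of radius \<open>d\<close>.\<close>
  define J where "J = h R0 x0 / 2 * measure lborel (ball x0 d)"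
  have fin: "emeasure lborel (ball x0 d) < \<infinity>" by (intro emeasure_bounded_finite) simp
  have J: "J > 0" using \<open>h R0 x0 > 0\<close> content_ball_pos[OF d(1), of x0] by (simp add: J_def)
  have "J = integral\<^sup>L lborel (\<lambda>x. h R0 x0 / 2 * indicator (ball x0 d) x)"
    by (simp add: J_def)
  also have "\<dots> \<le> integral\<^sup>L lborel (h R0)"
  proof (rule integral_mono[OF _ ih[OF R0]])
    show "integrable lborel (\<lambda>x. h R0 x0 / 2 * indicator (ball x0 d) x)"
      using fin by (intro integrable_mult_right integrable_real_indicator) auto
    show "h R0 x0 / 2 * indicator (ball x0 d) x \<le> h R0 x" for x
      using d(2)[of x] hn[of R0 x] abs_ge_self[of "h R0 x0 - h R0 x"] abs_minus_commute[of "h R0 x0"]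
      by (auto simp: indicator_def dist_commute dist_real_def split: if_splits)
  qed
  finally have JR0: "J \<le> integral\<^sup>L lborel (h R0)" .
  have "J / (16 * K) * R\<^sup>2 \<le> integral\<^sup>L lborel (\<lambda>x. indicator (cball 0 R) x * (\<rho> x * ((W x)\<^sup>2 * (f x)\<^sup>2)))" if "R \<ge> R0" for R
  proof -
    have R: "R > 0" using that R0 by simp
    have "h R0 x \<le> h R x" for x
      unfolding h_def using \<rho>_pos[of x] E2_nonneg[of x] \<eta>_mono[OF R0 that] \<eta>_nonneg
      by (intro mult_right_mono mult_left_mono power_mono) auto
    then have "integral\<^sup>L lborel (h R0) \<le> integral\<^sup>L lborel (h R)"
      by (intro integral_mono ih R0 R)
    then have "R\<^sup>2 * J \<le> R\<^sup>2 * integral\<^sup>L lborel (h R)" using JR0 by (intro mult_left_mono) auto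
    also have "\<dots> \<le> 16 * K * integral\<^sup>L lborel (\<lambda>x. indicator (cball 0 R) x * (\<rho> x * ((W x)\<^sup>2 * (f x)\<^sup>2)))"
      using caccioppoli[OF R] unfolding h_def .
    finally show ?thesis using K_pos by (simp add: field_simps)
  qed
  then show ?thesis using J K_pos R0 by (intro exI[of _ "J / (16 * K)"] exI[of _ R0]) auto
qed

end

section \<open>Graphs of smooth maps and their self-shrinker equation\<close>

context spacelike_c3_graph
begin

lemma graph_position_has_derivative: "(graph_position u has_derivative DX x) (at x)"
proof -
  have "((\<lambda>y. (y, u y)) has_derivative (\<lambda>v. (v, \<Sum>i\<in>UNIV. v $ i *\<^sub>R u1 i x))) (at x)"
    by (intro has_derivative_Pair has_derivative_ident du)
  then show ?thesis by (simp add: graph_position_def[abs_def] DX_Pair[abs_def])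
qed

lemma frechet_graph_position: "frechet_derivative (graph_position u) (at x) = DX x"
  by (rule frechet_derivative_at[OF graph_position_has_derivative, symmetric])

lemma tangent_space_eq: "tangent_space u x = range (DX x)"
  by (simp add: tangent_space_def frechet_graph_position)

lemma linear_DX: "linear (DX x)"
  using graph_position_has_derivative[of x] by (rule has_derivative_linear)

text \<open>An explicit formula for the normal projection, manifestly linear, to replace the
  definite description.\<close>

definition npart where "npart x p = p - (\<Sum>b\<in>UNIV. pinner p (DX x (frame x $ b)) *\<^sub>R DX x (frame x $ b))"

lemma linear_npart: "linear (npart x)"
  unfolding npart_def
  by (rule linearI) (simp_all add: pinner.add_left pinner.scaleR_left sum.distrib scaleR_add_left scaleR_sum_right
      scaleR_diff_right)

lemma npart_normal: "pinner (npart x p) (X1 k x) = 0"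
  by (rule normal_frame)
    (simp add: npart_def pinner.diff_left pinner.sum_left pinner.scaleR_left frame if_distrib cong: if_cong)

lemma npart_tangent: "p - npart x p \<in> range (DX x)"
proof -
  have "p - npart x p = DX x (\<Sum>b\<in>UNIV. pinner p (DX x (frame x $ b)) *\<^sub>R frame x $ b)"
    unfolding npart_def DX_sum by simp
  then show ?thesis by simp
qed

text \<open>Two candidates differ by a vector that is both tangent and normal, hence of square zero,
  and normal vectors are negative.\<close>

lemma npart_unique:
  assumes "\<And>k. pinner v (X1 k x) = 0" "p - v \<in> range (DX x)"
  shows "v = npart x p"
proof -
  have nn: "pinner (v - npart x p) (X1 k x) = 0" for k
    by (simp add: pinner.diff_left assms npart_normal)
  have "(p - npart x p) - (p - v) \<in> range (DX x)"
    by (intro subspace_diff[OF linear_subspace_image[OF linear_DX subspace_UNIV]] npart_tangent assms(2))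
  then obtain w where "v - npart x p = DX x w" by auto
  then have "pinner (v - npart x p) (v - npart x p) = 0"
    using nn by (simp add: DX_def pinner.sum_right pinner.scaleR_right)
  then show ?thesis using normal_neg[OF nn] by fastforce
qed

lemma npart_DX: "npart x (DX x v) = 0"
  by (rule npart_unique[symmetric]) (simp_all add: pinner.zero_left)

lemma npart_eq_0: "npart x p = 0 \<Longrightarrow> p \<in> range (DX x)"
  using npart_tangent[of p x] by simp

lemma normal_part_eq: "normal_part u x p = npart x p"
  unfolding normal_part_def
proof (rule the_equality)
  show "(\<forall>t\<in>tangent_space u x. pinner (npart x p) t = 0) \<and> p - npart x p \<in> tangent_space u x"
    using npart_tangent unfolding tangent_space_eq
    by (auto simp: DX_def pinner.sum_right pinner.scaleR_right npart_normal)
  fix v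
  assume v: "(\<forall>t\<in>tangent_space u x. pinner v t = 0) \<and> p - v \<in> tangent_space u x"
  then have "pinner v (DX x (ax k)) = 0" for k
    unfolding tangent_space_eq by blast
  then have "pinner v (X1 k x) = 0" for k by (simp add: DX_ax)
  then show "v = npart x p" using v unfolding tangent_space_eq by (intro npart_unique) auto
qed

lemma orthonormal_basis_frame:
  assumes "orthonormal_basis_of (tangent_space u x) e"
  shows "e i = DX x (fst (e i))"
    and "pinner (DX x (fst (e i))) (DX x (fst (e j))) = (if i = j then 1 else 0)"
proof -
  have "e i \<in> span (range e)" for i by (intro span_base) auto
  then have "e i \<in> range (DX x)" for i using assms by (simp add: orthonormal_basis_of_def tangent_space_eq)
  then have "\<exists>v. e i = DX x v" for i by auto
  then show e: "e i = DX x (fst (e i))" for i by (metis DX_Pair fst_conv)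
  show "pinner (DX x (fst (e i))) (DX x (fst (e j))) = (if i = j then 1 else 0)"
    using assms by (simp flip: e add: orthonormal_basis_of_def)
qed

text \<open>Every orthonormal tangent basis has a coefficient matrix whose determinant has the same
  absolute value, so the choice inside \<open>w_fun\<close> is immaterial once some basis
  exists.\<close>

lemma w_fun_eq:
  assumes "orthonormal_basis_of (tangent_space u (fst p)) e0"
  shows "w_fun u a p = W (fst p)"
proof -
  define e where "e = (SOME e. orthonormal_basis_of (tangent_space u (fst p)) e)"
  have e: "orthonormal_basis_of (tangent_space u (fst p)) e"
    unfolding e_def using someI_ex[of "orthonormal_basis_of (tangent_space u (fst p))"] assms by blast
  define C where "C = (\<chi> i. fst (e i))"
  have C: "pinner (DX (fst p) (C $ i)) (DX (fst p) (C $ j)) = (if i = j then 1 else 0)" for i j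
    using orthonormal_basis_frame(2)[OF e] by (simp add: C_def)
  have "pinner (e i) (a j) = (C ** A (fst p)) $ i $ j" for i j
    by (subst orthonormal_basis_frame(1)[OF e])
      (simp add: C_def matrix_matrix_mult_def DX_def pinner.sum_left pinner.scaleR_left A_nth)
  then have "(\<chi> i j. pinner (e i) (a j)) = C ** A (fst p)"
    by (simp add: vec_eq_iff)
  then have "w_fun u a p = \<bar>det C\<bar> * \<bar>det (A (fst p))\<bar>"
    unfolding w_fun_def Let_def e_def[symmetric] by (simp add: det_mul abs_mult)
  then show ?thesis by (simp add: abs_det_orthonormal[OF C] W_def)
qed

lemma has_pd_X1: "has_pd (X1 k) (\<Sum>l\<in>UNIV. d $ l *\<^sub>R X2 k l x) x d"
proof -
  have "has_pd (X1 k) (0, \<Sum>l\<in>UNIV. d $ l *\<^sub>R u2 k l x) x d"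
    unfolding X1_def[abs_def] by (intro has_pd_Pair has_pd_const has_pd_has_derivative[OF du1])
  moreover have "(\<Sum>l\<in>UNIV. d $ l *\<^sub>R X2 k l x) = (0, \<Sum>l\<in>UNIV. d $ l *\<^sub>R u2 k l x)"
    by (simp add: X2_def prod_eq_iff fst_sum snd_sum)
  ultimately show ?thesis by simp
qed

text \<open>In the product rule for \<open>DX y (fst (e y))\<close>, derivatives of the coefficients
  multiply tangent vectors, which the normal projection removes.\<close>

lemma second_fundamental_form_eq:
  assumes S: "open S" "x \<in> S" and e: "e differentiable (at x)" and tan: "\<And>y. y \<in> S \<Longrightarrow> e y = DX y (fst (e y))"
  shows "second_fundamental_form u e e x
    = npart x (\<Sum>k\<in>UNIV. \<Sum>l\<in>UNIV. (fst (e x) $ k * fst (e x) $ l) *\<^sub>R X2 k l x)"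
proof -
  define c D where "c = fst (e x)" and "D = frechet_derivative e (at x) c"
  have D: "has_pd e D x c"
    unfolding D_def using e frechet_derivative_works has_pd_has_derivative by blast
  have "has_pd (\<lambda>y. DX y (fst (e y))) (\<Sum>k\<in>UNIV. fst (e x) $ k *\<^sub>R (\<Sum>l\<in>UNIV. c $ l *\<^sub>R X2 k l x) + fst D $ k *\<^sub>R X1 k x) x c"
    unfolding DX_def
    by (intro has_pd_sum has_pd_scaleR has_pd_X1 has_pd_linear[OF bounded_linear_vec_nth] has_pd_linear[OF bounded_linear_fst] D)
  then have "D = (\<Sum>k\<in>UNIV. fst (e x) $ k *\<^sub>R (\<Sum>l\<in>UNIV. c $ l *\<^sub>R X2 k l x) + fst D $ k *\<^sub>R X1 k x)"
    using has_pd_unique[OF has_pd_transform[OF D S tan]] by blast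
  also have "\<dots> = (\<Sum>k\<in>UNIV. \<Sum>l\<in>UNIV. (c $ k * c $ l) *\<^sub>R X2 k l x) + DX x (fst D)"
    by (simp add: c_def sum.distrib scaleR_sum_right DX_def)
  finally have D_eq: "D = (\<Sum>k\<in>UNIV. \<Sum>l\<in>UNIV. (c $ k * c $ l) *\<^sub>R X2 k l x) + DX x (fst D)" .
  have "npart x D = npart x (\<Sum>k\<in>UNIV. \<Sum>l\<in>UNIV. (c $ k * c $ l) *\<^sub>R X2 k l x)"
    by (subst D_eq) (simp only: linear_add[OF linear_npart] npart_DX add_0_right)
  then show ?thesis
    by (simp add: second_fundamental_form_def normal_part_eq D_def c_def)
qed

text \<open>Summing the products of frame coefficients over the frame gives the inverse
  metric.\<close>

lemma mean_curvature_eq: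
  assumes "has_mean_curvature u H x"
  shows "H = npart x (\<Sum>k\<in>UNIV. \<Sum>l\<in>UNIV. G x $ k $ l *\<^sub>R X2 k l x)"
proof -
  obtain S e where S: "x \<in> S" "open S" and sm: "\<And>i. smooth_on S (e i)"
    and on: "\<And>y. y \<in> S \<Longrightarrow> orthonormal_basis_of (tangent_space u y) (\<lambda>i. e i y)"
    and H: "H = (\<Sum>i\<in>UNIV. second_fundamental_form u (e i) (e i) x)"
    using assms unfolding has_mean_curvature_def local_orthonormal_frame_def by blast
  have dif: "e i differentiable (at x)" for i
    using sm[of i] S(1) Ck_on.simps(2)[of 0 S "e i"] unfolding smooth_on_def by blast
  define c where "c i = fst (e i x)" for i
  have Gc: "G x $ k $ l = (\<Sum>i\<in>UNIV. c i $ k * c i $ l)" for k l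
    using G_orthonormal[of x "\<chi> i. c i"] orthonormal_basis_frame(2)[OF on[OF S(1)]] by (simp add: c_def)
  have "H = (\<Sum>i\<in>UNIV. npart x (\<Sum>k\<in>UNIV. \<Sum>l\<in>UNIV. (c i $ k * c i $ l) *\<^sub>R X2 k l x))"
    unfolding H c_def
    by (intro sum.cong refl second_fundamental_form_eq[OF S(2,1) dif] orthonormal_basis_frame(1)[OF on])
  also have "\<dots> = npart x (\<Sum>i\<in>UNIV. \<Sum>k\<in>UNIV. \<Sum>l\<in>UNIV. (c i $ k * c i $ l) *\<^sub>R X2 k l x)"
    by (simp only: linear_sum[OF linear_npart])
  also have "(\<Sum>i\<in>UNIV. \<Sum>k\<in>UNIV. \<Sum>l\<in>UNIV. (c i $ k * c i $ l) *\<^sub>R X2 k l x)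
     = (\<Sum>k\<in>UNIV. \<Sum>i\<in>UNIV. \<Sum>l\<in>UNIV. (c i $ k * c i $ l) *\<^sub>R X2 k l x)"
    by (rule sum.swap)
  also have "\<dots> = (\<Sum>k\<in>UNIV. \<Sum>l\<in>UNIV. \<Sum>i\<in>UNIV. (c i $ k * c i $ l) *\<^sub>R X2 k l x)"
    by (rule sum.cong[OF refl], rule sum.swap)
  finally show ?thesis by (simp add: Gc scaleR_sum_left)
qed

lemma self_shrinker_pde:
  assumes "self_shrinker u"
  shows "(\<Sum>k\<in>UNIV. \<Sum>l\<in>UNIV. G x $ k $ l *\<^sub>R u2 k l x) = (1/2) *\<^sub>R ((\<Sum>p\<in>UNIV. x $ p *\<^sub>R u1 p x) - u x)"
proof -
  define Q where "Q = (\<Sum>k\<in>UNIV. \<Sum>l\<in>UNIV. G x $ k $ l *\<^sub>R X2 k l x)"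
  have e: "npart x Q = - (1/2) *\<^sub>R npart x (X x)"
    unfolding Q_def using assms mean_curvature_eq[of "- (1/2) *\<^sub>R npart x (X x)" x]
    by (simp add: self_shrinker_def normal_part_eq X_def graph_position_def)
  \<comment> \<open>Subtracting half of the tangent vector \<open>DX x x\<close> leaves the normal
    part unchanged and makes the horizontal component zero. The remaining vector is tangent, so its
    vertical component vanishes too.\<close>
  then have "npart x (Q + (1/2) *\<^sub>R X x - (1/2) *\<^sub>R DX x x) = 0"
    using linear_npart[of x] by (simp add: linear_add linear_diff linear_scale npart_DX e)
  then obtain v where v: "Q + (1/2) *\<^sub>R X x - (1/2) *\<^sub>R DX x x = DX x v"
    using npart_eq_0 by blast
  have Q: "Q = (0, \<Sum>k\<in>UNIV. \<Sum>l\<in>UNIV. G x $ k $ l *\<^sub>R u2 k l x)"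
    by (simp add: Q_def X2_def prod_eq_iff fst_sum snd_sum)
  have "v = 0" using v by (simp add: Q DX_Pair X_def prod_eq_iff)
  then have "snd Q + (1/2) *\<^sub>R u x - (1/2) *\<^sub>R (\<Sum>p\<in>UNIV. x $ p *\<^sub>R u1 p x) = 0"
    using arg_cong[OF v, of snd] by (simp add: DX_Pair X_def)
  then show ?thesis by (simp add: Q algebra_simps)
qed

lemma metric_matrix_eq: "metric_matrix u x = gm x"
  by (simp add: metric_matrix_def frechet_graph_position DX_ax gm_def)

end

section \<open>From smooth maps to the coordinate setting, and the conclusion\<close>

lemma smooth_on_differentiable: "smooth_on UNIV h \<Longrightarrow> h differentiable (at x)"
  unfolding smooth_on_def using Ck_on.simps(2)[of 0 UNIV h] by blast

lemma smooth_on_frechet_derivative: "smooth_on UNIV h \<Longrightarrow> smooth_on UNIV (\<lambda>x. frechet_derivative h (at x) v)"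
  unfolding smooth_on_def using Ck_on.simps(2) by blast

lemma smooth_on_has_derivative:
  fixes h :: "real ^ 'm::finite \<Rightarrow> 'b::real_normed_vector"
  assumes "smooth_on UNIV h"
  shows "(h has_derivative (\<lambda>v. \<Sum>i\<in>UNIV. v $ i *\<^sub>R frechet_derivative h (at x) (axis i 1))) (at x)"
proof -
  have d: "(h has_derivative frechet_derivative h (at x)) (at x)"
    using smooth_on_differentiable[OF assms] frechet_derivative_works by blast
  then have l: "linear (frechet_derivative h (at x))" by (rule has_derivative_linear)
  have "frechet_derivative h (at x) v = (\<Sum>i\<in>UNIV. v $ i *\<^sub>R frechet_derivative h (at x) (axis i 1))" for v
  proof -
    have "v = (\<Sum>i\<in>UNIV. v $ i *\<^sub>R axis i 1)"
      using basis_expansion[of v] by (simp add: scalar_mult_eq_scaleR)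
    then have "frechet_derivative h (at x) v = frechet_derivative h (at x) (\<Sum>i\<in>UNIV. v $ i *\<^sub>R axis i 1)" by simp
    then show ?thesis by (simp add: linear_sum[OF l] linear_scale[OF l])
  qed
  then have "frechet_derivative h (at x) = (\<lambda>v. \<Sum>i\<in>UNIV. v $ i *\<^sub>R frechet_derivative h (at x) (axis i 1))" by blast
  then show ?thesis using d by simp
qed

lemma smooth_on_continuous: "smooth_on UNIV h \<Longrightarrow> continuous_on UNIV h"
  unfolding smooth_on_def using Ck_on.simps(1) by blast

theorem theorem1p3:
  fixes u :: "real ^ 'm::finite \<Rightarrow> real ^ 'n::finite"
    and P2 :: "('m, 'n) pseudo_euclidean set"
    and a :: "'m \<Rightarrow> ('m, 'n) pseudo_euclidean"
  assumes "smooth_on UNIV u"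
    and "spacelike_graph u"
    and "self_shrinker u"
    and "0 \<in> entire_graph u"
    and "\<not> subspace (entire_graph u)"
    and "spacelike_plane P2"
    and "orthonormal_basis_of P2 a"
  shows "Limsup at_top (\<lambda>R::real.
           ennreal ((ln R)\<^sup>2) /
           (\<integral>\<^sup>+p\<in>D_set u R. ennreal ((w_fun u a p)\<^sup>2 * (ln (w_fun u a p))\<^sup>2 * exp (- z_fun p / 4))
              \<partial>riemannian_volume u)) < \<infinity>"
proof -
  define u1 where "u1 i x = frechet_derivative u (at x) (axis i 1)" for i x
  define u2 where "u2 j i x = frechet_derivative (u1 j) (at x) (axis i 1)" for j i x
  define u3 where "u3 j k i x = frechet_derivative (u2 j k) (at x) (axis i 1)" for j k i x
  have s1: "smooth_on UNIV (u1 i)" for i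
    unfolding u1_def by (rule smooth_on_frechet_derivative[OF assms(1)])
  have s2: "smooth_on UNIV (u2 i j)" for i j
    unfolding u2_def by (rule smooth_on_frechet_derivative[OF s1])
  have s3: "smooth_on UNIV (u3 i j k)" for i j k
    unfolding u3_def by (rule smooth_on_frechet_derivative[OF s2])
  have d1: "(u has_derivative (\<lambda>v. \<Sum>i\<in>UNIV. v $ i *\<^sub>R u1 i x)) (at x)" for x
    unfolding u1_def by (rule smooth_on_has_derivative[OF assms(1)])
  define D where "D x v = (v, \<Sum>i\<in>UNIV. v $ i *\<^sub>R u1 i x)" for x v
  have "(graph_position u has_derivative D x) (at x)" for x
    unfolding graph_position_def D_def[abs_def] by (intro has_derivative_Pair has_derivative_ident d1)
  then have "frechet_derivative (graph_position u) (at x) = D x" for x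
    by (metis frechet_derivative_at)
  then have T: "tangent_space u x = range (D x)" for x
    by (simp add: tangent_space_def)
  have D_eq: "D x v = (\<Sum>k\<in>UNIV. v $ k *\<^sub>R (axis k 1, u1 k x))" for x v
    using basis_expansion[of v] by (simp add: D_def prod_eq_iff fst_sum snd_sum scalar_mult_eq_scaleR)
  \<comment> \<open>Existence of the mean curvature already supplies an orthonormal frame near every
    point.\<close>
  have on_ex: "\<exists>e. orthonormal_basis_of (tangent_space u x) e" for x
    using assms(3) unfolding self_shrinker_def has_mean_curvature_def local_orthonormal_frame_def by blast
  interpret spacelike_c3_graph u u1 u2 u3 a
  proof
    show "(u has_derivative (\<lambda>v. \<Sum>i\<in>UNIV. v $ i *\<^sub>R u1 i x)) (at x)" for x by (rule d1)
    show "(u1 j has_derivative (\<lambda>v. \<Sum>i\<in>UNIV. v $ i *\<^sub>R u2 j i x)) (at x)" for j x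
      unfolding u2_def by (rule smooth_on_has_derivative[OF s1])
    show "(u2 j k has_derivative (\<lambda>v. \<Sum>i\<in>UNIV. v $ i *\<^sub>R u3 j k i x)) (at x)" for j k x
      unfolding u3_def by (rule smooth_on_has_derivative[OF s2])
    show "continuous_on UNIV (u3 i j k)" for i j k by (rule smooth_on_continuous[OF s3])
    show "norm (\<Sum>i\<in>UNIV. v $ i *\<^sub>R u1 i x) < norm v" if "v \<noteq> 0" for x v
    proof -
      have "D x v \<noteq> 0" using that by (simp add: D_def zero_prod_def)
      then have "pinner (D x v) (D x v) > 0"
        using assms(2) unfolding spacelike_graph_def positive_definite_on_def T by blast
      then have "(norm (\<Sum>i\<in>UNIV. v $ i *\<^sub>R u1 i x))\<^sup>2 < (norm v)\<^sup>2"
        by (simp add: D_def pinner_inner dot_square_norm)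
      then show ?thesis by (rule power_less_imp_less_base) simp
    qed
    show "\<exists>c :: 'm \<Rightarrow> real ^ 'm. \<forall>i j. pinner (\<Sum>k\<in>UNIV. c i $ k *\<^sub>R (axis k 1, u1 k x))
       (\<Sum>k\<in>UNIV. c j $ k *\<^sub>R (axis k 1, u1 k x)) = (if i = j then 1 else 0)" for x
    proof -
      obtain e where e: "orthonormal_basis_of (tangent_space u x) e" using on_ex by blast
      have "e i \<in> span (range e)" for i by (intro span_base) auto
      then have "e i \<in> range (D x)" for i using e by (simp add: orthonormal_basis_of_def T)
      then have "\<exists>c. e i = D x c" for i by auto
      then obtain c where c: "\<And>i. e i = D x (c i)" by metis
      show ?thesis
        unfolding D_eq[symmetric] c[symmetric] using e by (intro exI[of _ c]) (simp add: orthonormal_basis_of_def flip: c)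
    qed
    show "pinner (a i) (a j) = (if i = j then 1 else 0)" for i j
      using assms(7) by (simp add: orthonormal_basis_of_def)
  qed
  interpret self_shrinker_graph u u1 u2 u3 a
    by unfold_locales (rule self_shrinker_pde[OF assms(3)])
  have u0: "u 0 = 0"
    using assms(4) by (auto simp: entire_graph_def graph_position_def zero_prod_def)
  \<comment> \<open>This is where the graph being no linear subspace enters, together with
    \<open>u 0 = 0\<close>.\<close>
  have "\<exists>i x. f1 i x \<noteq> 0"
  proof (rule ccontr)
    assume "\<not> ?thesis"
    then have lin: "linear u" using u0 by (intro linear_if_f1_zero) auto
    have "linear (\<lambda>x. (x, u x))"
      using lin by (intro linearI) (simp_all add: linear_add linear_scale)
    then have "subspace (range (\<lambda>x. (x, u x)))" using linear_subspace_image[OF _ subspace_UNIV] by blast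
    then show False using assms(5) by (simp add: entire_graph_def graph_position_def)
  qed
  then obtain c R0 where c: "c > 0" "R0 > 0" and growth: "\<And>R. R \<ge> R0 \<Longrightarrow> c * R\<^sup>2
     \<le> integral\<^sup>L lborel (\<lambda>x. indicator (cball 0 R) x * (\<rho> x * ((W x)\<^sup>2 * (f x)\<^sup>2)))"
    using quadratic_growth by blast
  have w: "w_fun u a p = W (fst p)" for p
    using w_fun_eq on_ex by blast
  have cX: "continuous_on UNIV (graph_position u)"
    using cont_X by (simp add: X_def[abs_def] graph_position_def[abs_def])
  define F where "F p = (W (fst p))\<^sup>2 * (ln (W (fst p)))\<^sup>2 * exp (- z_fun p / 4)" for p :: "('m, 'n) pseudo_euclidean"
  have Fm: "F \<in> borel_measurable borel"
  proof (rule borel_measurable_continuous_onI)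
    have 1: "continuous_on UNIV (\<lambda>p::('m, 'n) pseudo_euclidean. W (fst p))"
      by (rule continuous_on_compose2[OF cont_W]) (auto intro!: continuous_intros)
    have 2: "continuous_on UNIV (\<lambda>p::('m, 'n) pseudo_euclidean. ln (W (fst p)))"
      by (rule continuous_on_compose2[OF cont_f[unfolded f_def[abs_def]]]) (auto intro!: continuous_intros)
    show "continuous_on UNIV F"
      unfolding F_def[abs_def] z_fun_def pinner_inner
      by (rule continuous_on_mult[OF continuous_on_mult[OF continuous_on_power[OF 1] continuous_on_power[OF 2]]])
        (intro continuous_intros; simp)
  qed
  have closed: "closed (D_set u R)" for R
  proof -
    have "D_set u R = {p. snd p = u (fst p)} \<inter> {p. z_fun p \<le> R\<^sup>2}"
      by (auto simp: D_set_def entire_graph_def graph_position_def image_iff prod_eq_iff)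
    moreover have "closed {p::('m, 'n) pseudo_euclidean. snd p = u (fst p)}"
      by (intro closed_Collect_eq continuous_intros continuous_on_compose2[OF cont_u]) auto
    moreover have "closed {p::('m, 'n) pseudo_euclidean. z_fun p \<le> R\<^sup>2}"
      unfolding z_fun_def pinner_inner by (intro closed_Collect_le continuous_intros)
    ultimately show ?thesis by auto
  qed
  \<comment> \<open>A nonnegative integral that may be infinite, in which case the quotient is zero;
    only a lower bound is used.\<close>
  define I where "I R = (\<integral>\<^sup>+p\<in>D_set u R. ennreal (F p) \<partial>riemannian_volume u)" for R
  have I_ge: "I R \<ge> ennreal (c * R\<^sup>2)" if R: "R \<ge> R0" for R
  proof -
    have gm_meas: "(\<lambda>x. ennreal (sqrt (det (gm x)))) \<in> borel_measurable borel"
      by (intro measurable_compose[OF borel_measurable_continuous_onI measurable_ennreal] continuous_intros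
          continuous_on_det cont_gm)
    have [measurable]: "graph_position u \<in> borel_measurable borel"
      by (rule borel_measurable_continuous_onI[OF cX])
    have [measurable]: "D_set u R \<in> sets borel" using closed by simp
    note [measurable] = Fm gm_meas
    let ?J = "\<lambda>x. indicator (cball 0 R) x * (\<rho> x * ((W x)\<^sup>2 * (f x)\<^sup>2))"
    have "integrable lborel (\<lambda>x. indicator (cball 0 R) x *\<^sub>R (\<rho> x * ((W x)\<^sup>2 * (f x)\<^sup>2)))"
      by (rule borel_integrable_compact[OF compact_cball], rule continuous_on_subset[OF _ subset_UNIV])
        (intro continuous_intros)
    then have "ennreal (integral\<^sup>L lborel ?J) = (\<integral>\<^sup>+x. ennreal (?J x) \<partial>lborel)"
      using less_imp_le[OF \<rho>_pos] by (subst nn_integral_eq_integral) (auto intro!: AE_I2 mult_nonneg_nonneg)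
    also have "\<dots> \<le> (\<integral>\<^sup>+x. ennreal (sqrt (det (gm x))) * (ennreal (F (graph_position u x)) * indicator (D_set u R) (graph_position u x)) \<partial>lborel)"
    proof (rule nn_integral_mono)
      fix x
      show "ennreal (?J x) \<le> ennreal (sqrt (det (gm x))) * (ennreal (F (graph_position u x)) * indicator (D_set u R) (graph_position u x))"
      \<comment> \<open>Over the ball, \<open>z = |x|^2 - |u x|^2\<close> is at most
        \<open>R^2\<close>, so the point lies in \<open>D_R\<close> and the integrands agree;
        elsewhere the left side is zero.\<close>
      proof (cases "norm x \<le> R")
        case True
        have "z_fun (graph_position u x) \<le> (norm x)\<^sup>2"
          by (simp add: z_fun_def pinner_inner graph_position_def dot_square_norm)
        also have "\<dots> \<le> R\<^sup>2" using True by (intro power_mono) auto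
        finally have "graph_position u x \<in> D_set u R" by (simp add: D_set_def entire_graph_def)
        moreover have "?J x = sqrt (det (gm x)) * F (graph_position u x)"
          using True by (simp add: \<rho>_def F_def f_def z_fun_def graph_position_def X_def mult_ac)
        ultimately show ?thesis using det_gm_pos[of x] by (simp add: ennreal_mult')
      qed simp
    qed
    also have "\<dots> = I R"
      unfolding I_def riemannian_volume_def metric_matrix_eq
      by (subst nn_integral_distr, measurable, subst nn_integral_density) auto
    finally show ?thesis using growth[OF R] by (meson ennreal_leI order_trans)
  qed
  have "\<forall>\<^sub>F R in at_top. ennreal ((ln R)\<^sup>2) / I R \<le> ennreal (1 / c)"
    \<comment> \<open>The bound \<open>R \<ge> 1\<close> gives \<open>0 \<le> ln R \<le> R\<close>,
      so the logarithm squared is covered by quadratic growth.\<close>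
    using eventually_ge_at_top[of "max 1 R0"]
  proof eventually_elim
    case (elim R)
    then have R: "R \<ge> 1" "R \<ge> R0" by auto
    have "ennreal ((ln R)\<^sup>2) / I R \<le> ennreal ((ln R)\<^sup>2) / ennreal (c * R\<^sup>2)"
      unfolding divide_ennreal_def by (intro mult_left_mono inverse_ennreal_antimono I_ge R) simp
    also have "\<dots> = ennreal ((ln R)\<^sup>2 / (c * R\<^sup>2))"
      using c R by (intro divide_ennreal) auto
    also have "\<dots> \<le> ennreal (1 / c)"
    proof (rule ennreal_leI)
      have "(ln R)\<^sup>2 \<le> R\<^sup>2" using R ln_bound[of R] by (intro power_mono) auto
      then show "(ln R)\<^sup>2 / (c * R\<^sup>2) \<le> 1 / c" using c R by (simp add: field_simps)
    qed
    finally show ?case .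
  qed
  then have "Limsup at_top (\<lambda>R. ennreal ((ln R)\<^sup>2) / I R) \<le> ennreal (1 / c)"
    by (rule Limsup_bounded)
  also have "\<dots> < \<infinity>" by simp
  finally show ?thesis unfolding I_def F_def w .
qed

end
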